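(* Let $G$ be a 2-connected simple graph and let $\delta>2$ be an integer. Then $G$ satisfies $(\spadesuit)_\delta$ if and only if $G$ belongs to $\mathcal{F}_\delta$.
   Context: A graph is 2-connected if connected, with at least two vertices and no cut vertex (a single edge counts as 2-connected). For a 2-connected simple graph $H=(V,E)$, $w_H:E\to\{1,\delta-1\}$ is defined by $w_H(e)=1$ if $H\setminus e$ is 2-connected and $w_H(e)=\delta-1$ if $H/e$ is 2-connected. $H$ satisfies $(\spadesuit)_\delta$ if $w_H$ is well defined and $w_H(E)=\delta(|V|-1)$ and $w_H(E(S))+1=\delta(|S|-1)$ for every good flat $S\subset V$, where $w_H(F)=\sum_{e\in F}w_H(e)$, $E(S)$ is the set of edges with both ends in $S$, and $S$ is a good flat if $H|_S$ is 2-connected and the graph obtained from $H$ by contracting all edges of $E(S)$ is 2-connected. Gluing: for graphs $G_1,\dots,G_{\delta-1}$ satisfying $(\spadesuit)_\delta$ and edges $e_i\in E(G_i)$ with $w_{G_i}(e_i)=\delta-1$, take the disjoint union and identify $e_1,\dots,e_{\delta-1}$ (with endpoints) into one edge. Subdivision: for a graph satisfying $(\spadesuit)_\delta$ and an edge of weight $1$, replace that edge by a path of $\delta-1$ edges. $\mathcal{F}_\delta$ is the smallest class of graphs containing the cycle with $\delta$ vertices and closed under gluing and subdivision. *)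

theory Defs
  imports Main
begin

record 'a graph =
  verts :: "'a set"
  edges :: "'a set set"

definition simple_graph :: "'a graph \<Rightarrow> bool" where
  "simple_graph H \<longleftrightarrow> finite (verts H) \<and> edges H \<subseteq> {e. e \<subseteq> verts H \<and> card e = 2}"

definition adj :: "'a set set \<Rightarrow> ('a \<times> 'a) set" where
  "adj F = {(u, v). {u, v} \<in> F}"

definition connected_graph :: "'a graph \<Rightarrow> bool" where
  "connected_graph H \<longleftrightarrow>
     verts H \<noteq> {} \<and> (\<forall>u\<in>verts H. \<forall>v\<in>verts H. (u, v) \<in> (adj (edges H))\<^sup>*)"

definition delete_vertex :: "'a graph \<Rightarrow> 'a \<Rightarrow> 'a graph" where
  "delete_vertex H v = \<lparr>verts = verts H - {v}, edges = {e \<in> edges H. v \<notin> e}\<rparr>"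

definition cut_vertex :: "'a graph \<Rightarrow> 'a \<Rightarrow> bool" where
  "cut_vertex H v \<longleftrightarrow> v \<in> verts H \<and>
     (\<exists>x \<in> verts H - {v}. \<exists>y \<in> verts H - {v}.
        (x, y) \<in> (adj (edges H))\<^sup>* \<and> (x, y) \<notin> (adj (edges (delete_vertex H v)))\<^sup>*)"

definition two_connected :: "'a graph \<Rightarrow> bool" where
  "two_connected H \<longleftrightarrow> connected_graph H \<and> 2 \<le> card (verts H) \<and> (\<forall>v. \<not> cut_vertex H v)"

definition delete_edge :: "'a graph \<Rightarrow> 'a set \<Rightarrow> 'a graph" where
  "delete_edge H e = \<lparr>verts = verts H, edges = edges H - {e}\<rparr>"

text \<open>The vertices of the contraction \<open>H/F\<close> are the vertex classes connected by \<open>F\<close>.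
  Parallel edges are merged, which does not affect two-connectedness. Loops are dropped, but
  none arise below: \<open>F\<close> is always a single edge of a simple graph, or all edges induced by a
  vertex set.\<close>

definition contract :: "'a graph \<Rightarrow> 'a set set \<Rightarrow> 'a set graph" where
  "contract H F =
     (let cls = (\<lambda>x. {y \<in> verts H. (x, y) \<in> (adj F)\<^sup>*}) in
      \<lparr>verts = cls ` verts H,
       edges = {{cls x, cls y} | x y. {x, y} \<in> edges H - F \<and> cls x \<noteq> cls y}\<rparr>)"

definition induced_edges :: "'a graph \<Rightarrow> 'a set \<Rightarrow> 'a set set" where
  "induced_edges H S = {e \<in> edges H. e \<subseteq> S}"

definition restrict :: "'a graph \<Rightarrow> 'a set \<Rightarrow> 'a graph" where
  "restrict H S = \<lparr>verts = S, edges = induced_edges H S\<rparr>"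

definition is_weight :: "nat \<Rightarrow> 'a graph \<Rightarrow> 'a set \<Rightarrow> nat \<Rightarrow> bool" where
  "is_weight \<delta> H e k \<longleftrightarrow>
     (two_connected (delete_edge H e) \<and> k = 1) \<or> (two_connected (contract H {e}) \<and> k = \<delta> - 1)"

definition weight_well_defined :: "nat \<Rightarrow> 'a graph \<Rightarrow> bool" where
  "weight_well_defined \<delta> H \<longleftrightarrow> (\<forall>e\<in>edges H. \<exists>!k. is_weight \<delta> H e k)"

definition weight :: "nat \<Rightarrow> 'a graph \<Rightarrow> 'a set \<Rightarrow> nat" where
  "weight \<delta> H e = (THE k. is_weight \<delta> H e k)"

text \<open>The set \<open>verts H\<close> itself is never a good flat, since contracting all edges of a connected
  graph leaves a single vertex.\<close>

definition good_flat :: "'a graph \<Rightarrow> 'a set \<Rightarrow> bool" where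
  "good_flat H S \<longleftrightarrow> S \<subseteq> verts H \<and> two_connected (restrict H S) \<and>
     two_connected (contract H (induced_edges H S))"

text \<open>The subtractions on \<^typ>\<open>nat\<close> are exact: \<open>verts H\<close> and every good flat have at least two
  elements.\<close>

definition spade :: "nat \<Rightarrow> 'a graph \<Rightarrow> bool" where
  "spade \<delta> H \<longleftrightarrow> simple_graph H \<and> two_connected H \<and> weight_well_defined \<delta> H \<and>
     (\<Sum>e\<in>edges H. weight \<delta> H e) = \<delta> * (card (verts H) - 1) \<and>
     (\<forall>S. good_flat H S \<longrightarrow>
        (\<Sum>e\<in>induced_edges H S. weight \<delta> H e) + 1 = \<delta> * (card S - 1))"

definition is_cycle :: "nat \<Rightarrow> 'a graph \<Rightarrow> bool" where
  "is_cycle n H \<longleftrightarrow> (\<exists>p. distinct p \<and> length p = n \<and> verts H = set p \<and>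
     edges H = {{p ! i, p ! (Suc i mod n)} | i. i < n})"

text \<open>\<open>H\<close> is, up to isomorphism, the disjoint union of the graphs \<open>G i\<close>, \<open>i \<in> I\<close>, with the edges
  \<open>e i\<close> identified to the single edge \<open>c\<close>: the copies of the \<open>G i\<close> under the maps \<open>f i\<close> cover \<open>H\<close>
  and two of them meet exactly in the ends of \<open>c\<close>. Either way of matching the ends is allowed.\<close>

definition is_gluing :: "'i set \<Rightarrow> ('i \<Rightarrow> 'a graph) \<Rightarrow> ('i \<Rightarrow> 'a set) \<Rightarrow> 'a graph \<Rightarrow> bool" where
  "is_gluing I G e H \<longleftrightarrow> (\<exists>f c.
     (\<forall>i\<in>I. inj_on (f i) (verts (G i)) \<and> f i ` e i = c) \<and>
     (\<forall>i\<in>I. \<forall>j\<in>I. i \<noteq> j \<longrightarrow> f i ` verts (G i) \<inter> f j ` verts (G j) = c) \<and>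
     verts H = (\<Union>i\<in>I. f i ` verts (G i)) \<and>
     edges H = (\<Union>i\<in>I. (\<lambda>d. f i ` d) ` edges (G i)))"

definition path_edges :: "'a list \<Rightarrow> 'a set set" where
  "path_edges p = {{p ! i, p ! Suc i} | i. Suc i < length p}"

text \<open>\<open>H\<close> arises from \<open>G\<close> by replacing the edge \<open>e\<close> by a path of \<open>n\<close> edges, whose \<open>n - 1\<close> inner
  vertices are the new vertices \<open>xs\<close>.\<close>

definition is_subdivision :: "nat \<Rightarrow> 'a graph \<Rightarrow> 'a set \<Rightarrow> 'a graph \<Rightarrow> bool" where
  "is_subdivision n G e H \<longleftrightarrow> (\<exists>u v xs. e = {u, v} \<and>
     distinct xs \<and> length xs = n - 1 \<and> set xs \<inter> verts G = {} \<and>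
     verts H = verts G \<union> set xs \<and>
     edges H = (edges G - {e}) \<union> path_edges (u # xs @ [v]))"

text \<open>The class is closed under isomorphism. Restricting it to graphs on one vertex type loses
  nothing: the graphs that enter a gluing or a subdivision embed, on the level of vertices, into
  the result, so every construction of a graph can be carried out inside its own vertex set.\<close>

inductive class_F :: "nat \<Rightarrow> 'a graph \<Rightarrow> bool" for \<delta> :: nat where
  cycle: "is_cycle \<delta> H \<Longrightarrow> class_F \<delta> H"
| gluing: "\<lbrakk>\<And>i. i < \<delta> - 1 \<Longrightarrow> class_F \<delta> (G i);
            \<And>i. i < \<delta> - 1 \<Longrightarrow> spade \<delta> (G i);
            \<And>i. i < \<delta> - 1 \<Longrightarrow> e i \<in> edges (G i) \<and> weight \<delta> (G i) (e i) = \<delta> - 1;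
            is_gluing {..<\<delta> - 1} G e H\<rbrakk> \<Longrightarrow> class_F \<delta> H"
| subdivision: "\<lbrakk>class_F \<delta> G; spade \<delta> G; e \<in> edges G; weight \<delta> G e = 1;
            is_subdivision (\<delta> - 1) G e H\<rbrakk> \<Longrightarrow> class_F \<delta> H"

end

theory Submission imports Defs begin

text \<open>
  In a 2-connected graph on a set \<open>V\<close> of at least three vertices an edge \<open>e\<close>
  can be contracted if and only if \<open>V - e\<close> is connected, and deleted if it cannot be
  contracted; and \<open>S\<close> is a good flat if and only if it is 2-connected with nonempty
  connected complement. So both conditions become statements about connectivity of vertex sets, and a
  good flat \<open>S\<close> satisfies its equation if and only if the edges that meet \<open>T = V -
  S\<close> have total weight \<open>d |T| + 1\<close>.

  That every graph satisfying the weight conditions can be constructed is an induction on the number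
  of vertices. If some edge cannot be contracted, its ends split the graph into pieces, and counting
  weights shows that there are \<open>d - 1\<close> of them. Suppose that all edges can be contracted.
  A graph whose vertices all have degree 2 is a cycle, of length \<open>d\<close> by counting. If
  removing some path of vertices of degree 2, together with its two attachment vertices, disconnects
  the graph, then a subdivision can be undone. Otherwise choose a minimal side \<open>D\<close> of a
  separating pair that contains a vertex of degree at least 3, and put \<open>gap T = (d - 1) |{edges
  meeting T}| - d |T|\<close>. Paths of vertices of degree 2 inside \<open>D\<close>, and stars of
  such paths around a branch vertex, have 2-connected complements by minimality, hence gap 1; gluing
  overlapping stars together never increases the gap, so \<open>gap D \<le> 1\<close>. But the
  complement of the other side is a good flat, which forces \<open>gap D = d - 1\<close>.
\<close>

subsection \<open>Connectivity\<close>

text \<open>The obstacle is that the side opposite to the minimal \<open>D\<close> need not be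
  connected a priori, and only the complement of a connected set can be a good flat. This is where
  the induction uses both directions of the equivalence: if the opposite side fell apart,
  \<open>D\<close> with its two attachment vertices joined by an edge would be balanced on fewer
  vertices, hence constructible, hence exclusive; yet that edge could be contracted, since
  \<open>D\<close> is connected, and deleted, since minimality makes \<open>D\<close> with the two
  vertices 2-connected.

  The search for \<open>D\<close> can start because the average degree is below 3: an edge at a
  vertex of degree 2 supplies a degenerate side, consisting of all other vertices. Gaps do not grow
  when a star is added because it overlaps the old union in paths of vertices of degree 2, each of
  gap 1, or else shares an edge with it.\<close>

definition conn :: "'a set set \<Rightarrow> 'a set \<Rightarrow> bool" where
  "conn E X \<longleftrightarrow> (\<forall>A B. A \<union> B = X \<longrightarrow> A \<inter> B = {} \<longrightarrow> A \<noteq> {} \<longrightarrow> B \<noteq> {} \<longrightarrow>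
     (\<exists>a\<in>A. \<exists>b\<in>B. {a, b} \<in> E))"

text \<open>The cardinality bound also forces \<open>X\<close> to be finite, infinite sets having
  cardinality 0. Edges of \<open>E\<close> that leave \<open>X\<close> have no influence on
  \<open>conn\<close> and \<open>biconn\<close>, so induced subgraphs are given by their vertex sets
  alone. The empty set counts as connected.\<close>

definition biconn :: "'a set set \<Rightarrow> 'a set \<Rightarrow> bool" where
  "biconn E X \<longleftrightarrow> 2 \<le> card X \<and> conn E X \<and> (\<forall>x\<in>X. conn E (X - {x}))"

text \<open>A union of components of \<open>X\<close>, possibly none or all of them. Since
  connectedness is defined by cuts, most contradictions below consist in exhibiting such a set in
  \<open>V\<close> minus one or two vertices.\<close>

definition closed_in :: "'a set set \<Rightarrow> 'a set \<Rightarrow> 'a set \<Rightarrow> bool" where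
  "closed_in E X A \<longleftrightarrow> A \<subseteq> X \<and> (\<forall>a\<in>A. \<forall>b\<in>X - A. {a, b} \<notin> E)"

lemma connI:
  assumes "\<And>A B. A \<union> B = X \<Longrightarrow> A \<inter> B = {} \<Longrightarrow> A \<noteq> {} \<Longrightarrow> B \<noteq> {} \<Longrightarrow>
    (\<And>a b. a \<in> A \<Longrightarrow> b \<in> B \<Longrightarrow> {a, b} \<notin> E) \<Longrightarrow> False"
  shows "conn E X"
  unfolding conn_def using assms by blast

lemma connD:
  assumes "conn E X" "A \<union> B = X" "A \<inter> B = {}" "A \<noteq> {}" "B \<noteq> {}"
  shows "\<exists>a\<in>A. \<exists>b\<in>B. {a, b} \<in> E"
  using assms unfolding conn_def by blast

lemma not_connE:
  assumes "\<not> conn E X"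
  obtains A B where "A \<union> B = X" "A \<inter> B = {}" "A \<noteq> {}" "B \<noteq> {}"
    "\<And>a b. a \<in> A \<Longrightarrow> b \<in> B \<Longrightarrow> {a, b} \<notin> E"
proof -
  from assms have "\<exists>A B. A \<union> B = X \<and> A \<inter> B = {} \<and> A \<noteq> {} \<and> B \<noteq> {} \<and> (\<forall>a\<in>A. \<forall>b\<in>B. {a, b} \<notin> E)"
  proof (rule contrapos_np)
    assume n: "\<not> ?thesis"
    show "conn E X"
    proof (rule connI)
      fix A B assume a: "A \<union> B = X" "A \<inter> B = {}" "A \<noteq> {}" "B \<noteq> {}"
        "\<And>a b. a \<in> A \<Longrightarrow> b \<in> B \<Longrightarrow> {a, b} \<notin> E"
      show False by (rule notE[OF n]) (intro exI[of _ A] exI[of _ B] conjI ballI a)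
    qed
  qed
  then obtain A B where "A \<union> B = X" "A \<inter> B = {}" "A \<noteq> {}" "B \<noteq> {}" "\<forall>a\<in>A. \<forall>b\<in>B. {a, b} \<notin> E"
    by (elim exE conjE)
  then show thesis using that[of A B] by simp
qed

lemma conn_closed:
  assumes "conn E X" "closed_in E X A" "A \<noteq> {}"
  shows "A = X"
proof (rule ccontr)
  assume "A \<noteq> X"
  with assms(2) have "A \<union> (X - A) = X" "A \<inter> (X - A) = {}" "X - A \<noteq> {}"
    by (auto simp: closed_in_def)
  then show False using connD[OF assms(1), of A "X - A"] assms(2,3) unfolding closed_in_def by blast
qed

lemma closed_inD: "closed_in E X A \<Longrightarrow> a \<in> A \<Longrightarrow> b \<in> X \<Longrightarrow> {a, b} \<in> E \<Longrightarrow> b \<in> A"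
  unfolding closed_in_def by blast

lemma closed_in_compl: "closed_in E X A \<Longrightarrow> closed_in E X (X - A)"
  unfolding closed_in_def by (metis DiffD1 DiffD2 DiffI Diff_subset insert_commute)

lemma not_conn_closed:
  assumes "\<not> conn E X"
  obtains A where "closed_in E X A" "A \<noteq> {}" "A \<noteq> X"
proof -
  obtain A B where AB: "A \<union> B = X" "A \<inter> B = {}" "A \<noteq> {}" "B \<noteq> {}"
    "\<And>a b. a \<in> A \<Longrightarrow> b \<in> B \<Longrightarrow> {a, b} \<notin> E"
    using not_connE[OF assms] by blast
  then have "X - A = B" by auto
  then have "closed_in E X A" using AB(1,5) unfolding closed_in_def by auto
  then show thesis using that AB by auto
qed

text \<open>A partition of the image pulls back to one of \<open>X\<close>. Edges may collapse to a
  point, which makes retractions and contractions instances.\<close>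

lemma conn_image:
  assumes "conn E X" "f ` X = Y"
    and "\<And>a b. a \<in> X \<Longrightarrow> b \<in> X \<Longrightarrow> {a, b} \<in> E \<Longrightarrow> f a = f b \<or> {f a, f b} \<in> E'"
  shows "conn E' Y"
proof (rule connI)
  fix A B assume AB: "A \<union> B = Y" "A \<inter> B = {}" "A \<noteq> {}" "B \<noteq> {}"
    and no: "\<And>a b. a \<in> A \<Longrightarrow> b \<in> B \<Longrightarrow> {a, b} \<notin> E'"
  let ?A = "{x \<in> X. f x \<in> A}" and ?B = "{x \<in> X. f x \<in> B}"
  have AB': "?A \<union> ?B = X" "?A \<inter> ?B = {}" using AB(1,2) assms(2) by auto
  have ne: "{x \<in> X. f x \<in> C} \<noteq> {}" if "C \<subseteq> Y" "C \<noteq> {}" for C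
  proof -
    obtain y where "y \<in> C" using \<open>C \<noteq> {}\<close> by blast
    moreover then obtain x where "x \<in> X" "f x = y" using assms(2) \<open>C \<subseteq> Y\<close> by blast
    ultimately show ?thesis by blast
  qed
  have "?A \<noteq> {}" "?B \<noteq> {}" using ne[of A] ne[of B] AB by auto
  from connD[OF assms(1) AB' this] obtain a b
    where "a \<in> X" "f a \<in> A" "b \<in> X" "f b \<in> B" "{a, b} \<in> E" by blast
  then show False using assms(3)[of a b] no[of "f a" "f b"] AB(2) by (metis disjoint_iff)
qed

lemma conn_cong:
  assumes "conn E X" "\<And>a b. a \<in> X \<Longrightarrow> b \<in> X \<Longrightarrow> a \<noteq> b \<Longrightarrow> {a, b} \<in> E \<Longrightarrow> {a, b} \<in> E'"
  shows "conn E' X"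
  by (rule conn_image[OF assms(1), of id]) (use assms(2) in auto)

lemma conn_mono: "conn E X \<Longrightarrow> E \<subseteq> E' \<Longrightarrow> conn E' X"
  by (erule conn_cong) auto

lemma conn_empty [simp]: "conn E {}"
  by (simp add: conn_def)

lemma conn_singleton [simp]: "conn E {x}"
  by (auto simp: conn_def Un_singleton_iff)

lemma conn_edge:
  assumes "{a, b} \<in> E"
  shows "conn E {a, b}"
proof (rule connI)
  fix A B assume AB: "A \<union> B = {a, b}" "A \<inter> B = {}" "A \<noteq> {}" "B \<noteq> {}"
    and no: "\<And>a b. a \<in> A \<Longrightarrow> b \<in> B \<Longrightarrow> {a, b} \<notin> E"
  obtain p q where pq: "p \<in> A" "q \<in> B" using AB by blast
  then have "p \<noteq> q" "p \<in> {a, b}" "q \<in> {a, b}" using AB by blast+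
  then have "{p, q} = {a, b}" by blast
  then show False using no pq assms by metis
qed

lemma conn_one_side:
  assumes "conn E X" "X \<subseteq> A \<union> B" "A \<inter> B = {}" "\<And>a b. a \<in> A \<Longrightarrow> b \<in> B \<Longrightarrow> {a, b} \<notin> E"
  shows "X \<subseteq> A \<or> X \<subseteq> B"
proof (rule ccontr)
  assume "\<not> ?thesis"
  then have "A \<inter> X \<union> B \<inter> X = X" "(A \<inter> X) \<inter> (B \<inter> X) = {}" "A \<inter> X \<noteq> {}" "B \<inter> X \<noteq> {}"
    using assms(2,3) by auto
  from connD[OF assms(1) this] show False using assms(4) by blast
qed

lemma conn_UN:
  assumes "\<And>i. i \<in> I \<Longrightarrow> conn E (X i)" "\<And>i. i \<in> I \<Longrightarrow> p \<in> X i"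
  shows "conn E (\<Union>i\<in>I. X i)"
proof (rule connI)
  fix A B assume AB: "A \<union> B = (\<Union>i\<in>I. X i)" "A \<inter> B = {}" "A \<noteq> {}" "B \<noteq> {}"
    and no: "\<And>a b. a \<in> A \<Longrightarrow> b \<in> B \<Longrightarrow> {a, b} \<notin> E"
  have *: "X i \<subseteq> A \<or> X i \<subseteq> B" if "i \<in> I" for i
    using that AB(1) by (intro conn_one_side[OF assms(1)[OF that] _ AB(2) no]) auto
  obtain a b where ab: "a \<in> A" "b \<in> B" using AB by blast
  then obtain i j where ij: "i \<in> I" "j \<in> I" "a \<in> X i" "b \<in> X j" using AB(1) by blast
  have "X i \<subseteq> A" "X j \<subseteq> B" using *[OF ij(1)] *[OF ij(2)] ij(3,4) ab AB(2) by auto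
  then show False using assms(2)[OF ij(1)] assms(2)[OF ij(2)] AB(2) by auto
qed

text \<open>\<open>Y\<close> replaces the edge \<open>{u, v}\<close>, which may be missing from
  \<open>E\<close>: a partition of \<open>X\<close> crossed by this edge only would separate
  \<open>u\<close> from \<open>v\<close> inside the connected set \<open>Y\<close>.\<close>

lemma conn_Un_edge:
  assumes "conn (insert {u, v} E) X" "conn E Y" "X \<inter> Y \<noteq> {}"
    "u \<in> X \<Longrightarrow> v \<in> X \<Longrightarrow> u \<in> Y \<and> v \<in> Y"
  shows "conn E (X \<union> Y)"
proof (rule connI)
  fix A B assume AB: "A \<union> B = X \<union> Y" "A \<inter> B = {}" "A \<noteq> {}" "B \<noteq> {}"
    and no: "\<And>a b. a \<in> A \<Longrightarrow> b \<in> B \<Longrightarrow> {a, b} \<notin> E"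
  have Y: "Y \<subseteq> A \<or> Y \<subseteq> B"
    using AB(1) by (intro conn_one_side[OF assms(2) _ AB(2) no]) auto
  have X: "X \<subseteq> A \<or> X \<subseteq> B"
  proof (rule ccontr)
    assume "\<not> ?thesis"
    then have "A \<inter> X \<union> B \<inter> X = X" "(A \<inter> X) \<inter> (B \<inter> X) = {}" "A \<inter> X \<noteq> {}" "B \<inter> X \<noteq> {}"
      using AB by auto
    from connD[OF assms(1) this]
    obtain a b where ab: "a \<in> A" "a \<in> X" "b \<in> B" "b \<in> X" "{a, b} \<in> insert {u, v} E" by blast
    then have "{a, b} = {u, v}" using no by blast
    then have "a \<in> Y" "b \<in> Y" using assms(4) ab(2,4) by (auto simp: doubleton_eq_iff)
    then show False using Y ab AB(2) by auto
  qed
  then show False using Y AB assms(3) by auto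
qed

lemma conn_Un:
  assumes "conn E X" "conn E Y" "X \<inter> Y \<noteq> {}"
  shows "conn E (X \<union> Y)"
proof -
  obtain p where p: "p \<in> X" "p \<in> Y" using assms(3) by blast
  have "conn E (\<Union>i\<in>{X, Y}. i)"
  proof (rule conn_UN[where p = p])
    show "conn E i" if "i \<in> {X, Y}" for i using that assms by blast
    show "p \<in> i" if "i \<in> {X, Y}" for i using that p by blast
  qed
  moreover have "(\<Union>i\<in>{X, Y}. i) = X \<union> Y" by blast
  ultimately show ?thesis by metis
qed

lemma conn_Un_adj:
  assumes "conn E X" "conn E Y" "a \<in> X" "b \<in> Y" "{a, b} \<in> E"
  shows "conn E (X \<union> Y)"
proof -
  have "conn E (X \<union> {a, b})" by (rule conn_Un[OF assms(1) conn_edge[OF assms(5)]]) (use assms in blast)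
  then have "conn E ((X \<union> {a, b}) \<union> Y)" by (rule conn_Un[OF _ assms(2)]) (use assms in blast)
  moreover have "(X \<union> {a, b}) \<union> Y = X \<union> Y" using assms by auto
  ultimately show ?thesis by simp
qed

lemma conn_insert:
  assumes "conn E X" "b \<in> X" "{a, b} \<in> E"
  shows "conn E (insert a X)"
  using conn_Un_adj[OF conn_singleton assms(1) singletonI assms(2,3)] by simp

text \<open>One side of a cut of \<open>X\<close> has two vertices, so the cut survives the deletion
  of one of them. For two vertices in all the claim fails, singletons being connected.\<close>

lemma conn_from_deleted:
  assumes "\<And>x. x \<in> X \<Longrightarrow> conn E (X - {x})" "3 \<le> card X"
  shows "conn E X"
proof (rule connI)
  fix A B assume AB: "A \<union> B = X" "A \<inter> B = {}" "A \<noteq> {}" "B \<noteq> {}"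
    and no: "\<And>a b. a \<in> A \<Longrightarrow> b \<in> B \<Longrightarrow> {a, b} \<notin> E"
  have fin: "finite A" "finite B" using assms(2) AB(1) by (metis card.infinite finite_Un not_numeral_le_zero)+
  have *: False if "A' \<union> B' = X" "A' \<inter> B' = {}" "B' \<noteq> {}" "a \<in> A'" "a' \<in> A'" "a \<noteq> a'"
    "\<And>a b. a \<in> A' \<Longrightarrow> b \<in> B' \<Longrightarrow> {a, b} \<notin> E" for A' B' a a'
  proof -
    have "(A' - {a}) \<union> B' = X - {a}" "(A' - {a}) \<inter> B' = {}" "A' - {a} \<noteq> {}" "a \<in> X" using that by auto
    from connD[OF assms(1)[OF \<open>a \<in> X\<close>] this(1-3) that(3)] show False using that(7) by blast
  qed
  have "card A + card B = card X" using AB fin by (metis card_Un_disjoint)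
  then have "2 \<le> card A \<or> 2 \<le> card B" using assms(2) by linarith
  then show False
  proof
    assume "2 \<le> card A"
    then obtain a a' where "a \<in> A" "a' \<in> A" "a \<noteq> a'"
      by (metis card_le_Suc0_iff_eq fin(1) not_less_eq_eq numeral_2_eq_2)
    then show False using *[of A B a a'] AB no by blast
  next
    assume "2 \<le> card B"
    then obtain a a' where "a \<in> B" "a' \<in> B" "a \<noteq> a'"
      by (metis card_le_Suc0_iff_eq fin(2) not_less_eq_eq numeral_2_eq_2)
    moreover have "B \<union> A = X" "B \<inter> A = {}" using AB by auto
    moreover have "\<And>b a. b \<in> B \<Longrightarrow> a \<in> A \<Longrightarrow> {b, a} \<notin> E" using no by (metis insert_commute)
    ultimately show False using *[of B A a a'] AB(3) by blast
  qed
qed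

lemma conn_component:
  assumes "finite X" "a \<in> X"
  obtains C where "a \<in> C" "C \<subseteq> X" "conn E C" "closed_in E X C"
proof -
  let ?P = "\<lambda>C. a \<in> C \<and> C \<subseteq> X \<and> conn E C"
  have "\<exists>C. ?P C \<and> (\<forall>C'. ?P C' \<longrightarrow> card C' \<le> card C)"
    by (rule ex_has_greatest_nat[where k = "{a}" and b = "Suc (card X)"]) (use assms card_mono in \<open>auto simp: less_Suc_eq_le\<close>)
  then obtain C where C: "a \<in> C" "C \<subseteq> X" "conn E C" "\<And>C'. ?P C' \<Longrightarrow> card C' \<le> card C" by blast
  have "closed_in E X C" unfolding closed_in_def
  proof (intro conjI ballI notI)
    fix c b assume cb: "c \<in> C" "b \<in> X - C" "{c, b} \<in> E"
    then have "{b, c} \<in> E" by (simp add: insert_commute)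
    then have "conn E (insert b C)" using conn_insert[OF C(3)] cb by blast
    then have "card (insert b C) \<le> card C" using C(1,2,4) cb by blast
    then show False using cb finite_subset[OF C(2) assms(1)] by auto
  qed (rule C)
  then show ?thesis using C that by blast
qed

text \<open>Everything outside \<open>F\<close> is sent to one end of \<open>{u, v}\<close>.\<close>

lemma conn_retract:
  assumes "conn E X" "u \<in> F" "v \<in> F" "{u, v} \<inter> X \<noteq> {}"
    and cl: "\<And>a b. a \<in> X - F \<Longrightarrow> b \<in> X \<inter> F \<Longrightarrow> {a, b} \<in> E \<Longrightarrow> b = u \<or> b = v"
  shows "conn (insert {u, v} E) (X \<inter> F)"
proof -
  define p where "p = (if u \<in> X then u else v)"
  have p: "p \<in> X" "p \<in> F" "p = u \<or> p = v" using assms by (auto simp: p_def)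
  let ?f = "\<lambda>a. if a \<in> F then a else p"
  have pq: "{p, b} = {u, v}" if "b \<in> X" "b = u \<or> b = v" "b \<noteq> p" for b
    using that p by auto
  show ?thesis
  proof (rule conn_image[OF assms(1), of ?f])
    show "?f ` X = X \<inter> F" using p by auto
    fix a b assume ab: "a \<in> X" "b \<in> X" "{a, b} \<in> E"
    consider "a \<in> F \<longleftrightarrow> b \<in> F" | "a \<notin> F" "b \<in> F" | "b \<notin> F" "a \<in> F" by blast
    then show "?f a = ?f b \<or> {?f a, ?f b} \<in> insert {u, v} E"
    proof cases
      case 1 then show ?thesis using ab by auto
    next
      case 2
      then have "b = u \<or> b = v" using cl[of a b] ab by blast
      then show ?thesis using pq[of b] 2 ab by auto
    next
      case 3
      then have "a = u \<or> a = v" using cl[of b a] ab by (auto simp: insert_commute)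
      then show ?thesis using pq[of a] 3 ab by (auto simp: insert_commute)
    qed
  qed
qed

section \<open>Two-connected vertex sets\<close>

lemma biconn_finite: "biconn E X \<Longrightarrow> finite X"
  unfolding biconn_def using card.infinite by fastforce

lemma biconn_conn_del: "biconn E X \<Longrightarrow> conn E (X - {x})"
  unfolding biconn_def by (cases "x \<in> X") auto

lemma biconn_conn: "biconn E X \<Longrightarrow> conn E X"
  unfolding biconn_def by simp

lemma biconnI:
  assumes "3 \<le> card X" "\<And>x. x \<in> X \<Longrightarrow> conn E (X - {x})"
  shows "biconn E X"
  unfolding biconn_def using assms conn_from_deleted[OF assms(2,1)] by simp

lemma biconn_cong:
  assumes "biconn E X" "\<And>a b. a \<in> X \<Longrightarrow> b \<in> X \<Longrightarrow> a \<noteq> b \<Longrightarrow> {a, b} \<in> E \<Longrightarrow> {a, b} \<in> E'"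
  shows "biconn E' X"
proof -
  have "conn E' X" by (rule conn_cong[OF biconn_conn[OF assms(1)] assms(2)])
  moreover have "conn E' (X - {x})" for x
    by (rule conn_cong[OF biconn_conn_del[OF assms(1)]]) (use assms(2) in simp)
  ultimately show ?thesis using assms(1) unfolding biconn_def by blast
qed

text \<open>Whatever lies outside \<open>F\<close> is attached at \<open>u\<close> and
  \<open>v\<close> only and retracts onto a virtual edge between them. Deleting one vertex leaves at
  least one of the two ends, so \<open>conn_retract\<close> still applies.\<close>

lemma biconn_retract:
  assumes "biconn E X" "u \<in> F" "v \<in> F" "u \<noteq> v" "{u, v} \<subseteq> X"
    and cl: "\<And>a b. a \<in> X - F \<Longrightarrow> b \<in> X \<inter> F \<Longrightarrow> {a, b} \<in> E \<Longrightarrow> b = u \<or> b = v"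
  shows "biconn (insert {u, v} E) (X \<inter> F)"
proof -
  have fin: "finite X" using assms(1) biconn_finite by blast
  have "card {u, v} \<le> card (X \<inter> F)" using assms fin by (intro card_mono) auto
  then have "2 \<le> card (X \<inter> F)" using assms(4) by simp
  moreover have "conn (insert {u, v} E) (X \<inter> F)"
    by (rule conn_retract[OF biconn_conn[OF assms(1)] assms(2,3) _ cl]) (use assms(5) in simp_all)
  moreover have "conn (insert {u, v} E) (X \<inter> F - {x})" for x
  proof -
    have "conn (insert {u, v} E) ((X - {x}) \<inter> F)"
    proof (rule conn_retract[OF biconn_conn_del[OF assms(1)] assms(2,3)])
      show "{u, v} \<inter> (X - {x}) \<noteq> {}" using assms(4,5) by auto
      show "b = u \<or> b = v" if "a \<in> X - {x} - F" "b \<in> (X - {x}) \<inter> F" "{a, b} \<in> E" for a b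
        using cl[of a b] that by simp
    qed
    moreover have "(X - {x}) \<inter> F = X \<inter> F - {x}" by blast
    ultimately show ?thesis by simp
  qed
  ultimately show ?thesis unfolding biconn_def by blast
qed

text \<open>Consider a cut that only the edge \<open>{u, v}\<close> may cross. A part that contains
  neither end would be closed in \<open>V\<close>; if each part contains one end, that end would cut
  off in \<open>V\<close> whatever its part contains of \<open>B\<close>, so \<open>B\<close> would
  be empty.\<close>

lemma biconn_bridge:
  assumes "biconn E V" "u \<in> V" "v \<in> V" "u \<noteq> v" "closed_in E (V - {u, v}) B" "B \<noteq> {}"
  shows "conn (E - {{u, v}}) (B \<union> {u, v})"
proof (rule connI)
  fix P Q assume PQ: "P \<union> Q = B \<union> {u, v}" "P \<inter> Q = {}" "P \<noteq> {}" "Q \<noteq> {}"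
    and no: "\<And>a b. a \<in> P \<Longrightarrow> b \<in> Q \<Longrightarrow> {a, b} \<notin> E - {{u, v}}"
  have B: "B \<subseteq> V - {u, v}" using assms(5) by (simp add: closed_in_def)
  have out: False if "P' \<union> Q' = B \<union> {u, v}" "P' \<inter> Q' = {}" "P' \<subseteq> B" "P' \<noteq> {}"
     "\<And>a b. a \<in> P' \<Longrightarrow> b \<in> Q' \<Longrightarrow> {a, b} \<notin> E - {{u, v}}" for P' Q'
  proof -
    have "closed_in E V P'" unfolding closed_in_def
    proof (intro conjI ballI notI)
      fix a b assume ab: "a \<in> P'" "b \<in> V - P'" "{a, b} \<in> E"
      then have "b \<in> Q'" using assms(5) that(1,3) closed_inD[OF assms(5), of a b] by blast
      moreover have "{a, b} \<noteq> {u, v}" using ab that B by (auto simp: doubleton_eq_iff)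
      ultimately show False using that(5) ab by blast
    qed (use that B in auto)
    then have "P' = V" using conn_closed[OF biconn_conn[OF assms(1)]] that by blast
    then show False using that B assms by blast
  qed
  have one: "B \<inter> P' = {}" if "P' \<union> Q' = B \<union> {u, v}" "P' \<inter> Q' = {}" "u' \<in> P'" "v' \<in> Q'" "{u', v'} = {u, v}"
     "\<And>a b. a \<in> P' \<Longrightarrow> b \<in> Q' \<Longrightarrow> {a, b} \<notin> E - {{u, v}}" for P' Q' u' v'
  proof (rule ccontr)
    assume ne: "B \<inter> P' \<noteq> {}"
    have "closed_in E (V - {u'}) (B \<inter> P')" unfolding closed_in_def
    proof (intro conjI ballI notI)
      fix a b assume ab: "a \<in> B \<inter> P'" "b \<in> V - {u'} - B \<inter> P'" "{a, b} \<in> E"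
      have "b \<in> Q'" using closed_inD[OF assms(5), of a b] ab that(1,3-5) by (auto simp: doubleton_eq_iff)
      moreover have "{a, b} \<noteq> {u, v}" using ab B by (auto simp: doubleton_eq_iff)
      ultimately show False using that(6) ab by blast
    qed (use B that(5) in blast)
    then have "B \<inter> P' = V - {u'}" using conn_closed[OF biconn_conn_del[OF assms(1)]] ne by blast
    moreover have "v' \<in> V - {u'}" using that(5) assms by (auto simp: doubleton_eq_iff)
    ultimately show False using that(2,4) by blast
  qed
  have no': "\<And>a b. a \<in> Q \<Longrightarrow> b \<in> P \<Longrightarrow> {a, b} \<notin> E - {{u, v}}" using no by (metis insert_commute)
  have PQ': "Q \<union> P = B \<union> {u, v}" "Q \<inter> P = {}" using PQ by auto
  have "u \<in> P \<or> u \<in> Q" "v \<in> P \<or> v \<in> Q" using PQ by auto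
  then consider "u \<in> P" "v \<in> P" | "u \<in> Q" "v \<in> Q" | "u \<in> P" "v \<in> Q" | "u \<in> Q" "v \<in> P" by blast
  then show False
  proof cases
    case 1 then show ?thesis using out[OF PQ' _ PQ(4) no'] PQ by blast
  next
    case 2 then show ?thesis using out[OF PQ(1,2) _ PQ(3) no] PQ by blast
  next
    case 3
    have "B \<inter> P = {}" using one[OF PQ(1,2) 3 _ no] by simp
    moreover have "B \<inter> Q = {}" using one[OF PQ' 3(2,1) _ no'] by (simp add: insert_commute)
    ultimately show ?thesis using assms(6) PQ by blast
  next
    case 4
    have "B \<inter> Q = {}" using one[OF PQ' 4 _ no'] by simp
    moreover have "B \<inter> P = {}" using one[OF PQ(1,2) 4(2,1) _ no] by (simp add: insert_commute)
    ultimately show ?thesis using assms(6) PQ by blast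
  qed
qed

text \<open>When a vertex \<open>x\<close> other than the ends is removed, some side of
  \<open>{u, v}\<close> avoids \<open>x\<close> and connects \<open>u\<close> with \<open>v\<close>
  in place of the edge, by \<open>biconn_bridge\<close>. When an end is removed, the edge disappears
  anyway.\<close>

lemma biconn_del:
  assumes "biconn E V" "u \<in> V" "v \<in> V" "u \<noteq> v" "\<not> conn E (V - {u, v})"
  shows "biconn (E - {{u, v}}) V"
proof -
  obtain A where A: "closed_in E (V - {u, v}) A" "A \<noteq> {}" "A \<noteq> V - {u, v}"
    using not_conn_closed[OF assms(5)] by blast
  define B where "B = V - {u, v} - A"
  have B: "closed_in E (V - {u, v}) B" "B \<noteq> {}" "A \<inter> B = {}"
    using closed_in_compl[OF A(1)] A unfolding B_def closed_in_def by auto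
  have fin: "finite V" using assms(1) biconn_finite by blast
  have "card V \<ge> 3"
  proof -
    obtain a where "a \<in> A" using A(2) by auto
    moreover have "A \<subseteq> V - {u, v}" using A(1) by (simp add: closed_in_def)
    ultimately have "{a, u, v} \<subseteq> V" "a \<noteq> u" "a \<noteq> v" using assms by auto
    moreover then have "card {a, u, v} = 3" using assms(4) by simp
    ultimately have "{a, u, v} \<subseteq> V" "card {a, u, v} = 3" by simp_all
    then show ?thesis using card_mono[OF fin] by metis
  qed
  moreover have "conn (E - {{u, v}}) (V - {x})" if "x \<in> V" for x
  proof -
    have c: "conn E (V - {x})" by (rule biconn_conn_del[OF assms(1)])
    show ?thesis
    proof (cases "x \<in> {u, v}")
      case True
      then show ?thesis by (intro conn_cong[OF c]) (auto simp: doubleton_eq_iff)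
    next
      case False
      obtain C where C: "closed_in E (V - {u, v}) C" "C \<noteq> {}" "x \<notin> C"
        using A(1,2) B by (metis disjoint_iff)
      have c1: "conn (E - {{u, v}}) (C \<union> {u, v})" using biconn_bridge[OF assms(1-4) C(1,2)] .
      have c2: "conn (insert {u, v} (E - {{u, v}})) (V - {x})" by (rule conn_mono[OF c]) blast
      have "conn (E - {{u, v}}) ((V - {x}) \<union> (C \<union> {u, v}))"
        by (rule conn_Un_edge[OF c2 c1]) (use False assms in auto)
      moreover have "(V - {x}) \<union> (C \<union> {u, v}) = V - {x}"
        using False C assms by (auto simp: closed_in_def)
      ultimately show ?thesis by simp
    qed
  qed
  ultimately show ?thesis by (rule biconnI)
qed

subsection \<open>Balanced graphs\<close>

text \<open>The weight here prefers contraction, so that it is defined for every edge; it is the weight of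
  the paper if no edge can be both deleted and contracted, which is \<open>exclusive\<close> below. A balanced
  graph need not be assumed exclusive: this is what makes the pieces of a gluing accessible to
  induction, since deletability of the common edge in a piece is not visible in the whole graph.\<close>

definition wgt :: "int \<Rightarrow> 'a set set \<Rightarrow> 'a set \<Rightarrow> 'a set \<Rightarrow> int" where
  "wgt d E V e = (if conn E (V - e) then d - 1 else 1)"

definition induced :: "'a set set \<Rightarrow> 'a set \<Rightarrow> 'a set set" where
  "induced E S = {e \<in> E. e \<subseteq> S}"

definition meeting :: "'a set set \<Rightarrow> 'a set \<Rightarrow> 'a set set" where
  "meeting E T = {e \<in> E. e \<inter> T \<noteq> {}}"

definition simple_on :: "'a set \<Rightarrow> 'a set set \<Rightarrow> bool" where
  "simple_on V E \<longleftrightarrow> finite V \<and> (\<forall>e\<in>E. e \<subseteq> V \<and> card e = 2)"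

text \<open>The bound \<open>3 \<le> card V\<close> keeps out the single edge: its contraction is a
  single vertex although \<open>conn E (V - e)\<close> holds, \<open>V - e\<close> being
  empty.\<close>

definition balanced :: "int \<Rightarrow> 'a set \<Rightarrow> 'a set set \<Rightarrow> bool" where
  "balanced d V E \<longleftrightarrow> simple_on V E \<and> biconn E V \<and> 3 \<le> card V \<and>
     sum (wgt d E V) E = d * (int (card V) - 1) \<and>
     (\<forall>S. S \<subset> V \<longrightarrow> biconn E S \<longrightarrow> conn E (V - S) \<longrightarrow>
        sum (wgt d E V) (induced E S) + 1 = d * (int (card S) - 1))"

definition exclusive :: "'a set \<Rightarrow> 'a set set \<Rightarrow> bool" where
  "exclusive V E \<longleftrightarrow> (\<forall>e\<in>E. conn E (V - e) \<longrightarrow> \<not> biconn (E - {e}) V)"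

lemma simple_on_edge:
  assumes "simple_on V E" "e \<in> E"
  obtains a b where "e = {a, b}" "a \<noteq> b" "a \<in> V" "b \<in> V"
proof -
  have "card e = 2" "e \<subseteq> V" using assms by (auto simp: simple_on_def)
  then obtain a b where "e = {a, b}" "a \<noteq> b" by (auto simp: card_2_iff)
  then show thesis using that \<open>e \<subseteq> V\<close> by simp
qed

lemma simple_on_finite: "simple_on V E \<Longrightarrow> finite E"
  unfolding simple_on_def by (rule finite_subset[of _ "Pow V"]) auto

lemma simple_on_neq: "simple_on V E \<Longrightarrow> {a, b} \<in> E \<Longrightarrow> a \<noteq> b \<and> a \<in> V \<and> b \<in> V"
  unfolding simple_on_def by (metis card_2_iff doubleton_eq_iff insert_subset)

lemma sum_induced_meeting:
  fixes f :: "'a set \<Rightarrow> int"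
  assumes "simple_on V E"
  shows "sum f E = sum f (induced E (V - T)) + sum f (meeting E T)"
proof -
  have "E = induced E (V - T) \<union> meeting E T" "induced E (V - T) \<inter> meeting E T = {}"
    using assms unfolding induced_def meeting_def simple_on_def by auto
  moreover have "finite (induced E (V - T))" "finite (meeting E T)"
    using simple_on_finite[OF assms] by (auto simp: induced_def meeting_def)
  ultimately show ?thesis using sum.union_disjoint by metis
qed

text \<open>Subtract the equation of the flat from the total. The right-hand form concerns only the
  edges around \<open>V - S\<close>, so it can be transferred when the graph changes
  elsewhere.\<close>

lemma flat_dual:
  assumes "simple_on V E" "sum (wgt d E V) E = d * (int (card V) - 1)" "S \<subseteq> V"
  shows "sum (wgt d E V) (induced E S) + 1 = d * (int (card S) - 1) \<longleftrightarrow>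
    sum (wgt d E V) (meeting E (V - S)) = d * int (card (V - S)) + 1"
proof -
  have fin: "finite V" using assms by (simp add: simple_on_def)
  have "V - (V - S) = S" using assms(3) by auto
  then have "sum (wgt d E V) E = sum (wgt d E V) (induced E S) + sum (wgt d E V) (meeting E (V - S))"
    using sum_induced_meeting[OF assms(1), of _ "V - S"] by simp
  moreover have "card V = card S + card (V - S)"
    using fin assms(3) by (metis card_mono card_Diff_subset finite_subset le_add_diff_inverse)
  ultimately show ?thesis using assms(2) by (simp add: algebra_simps) linarith
qed

lemma balanced_dual:
  assumes "balanced d V E" "T \<subseteq> V" "T \<noteq> {}" "conn E T" "biconn E (V - T)"
  shows "sum (wgt d E V) (meeting E T) = d * int (card T) + 1"
proof -
  have "V - (V - T) = T" "V - T \<subset> V" using assms by auto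
  then show ?thesis
    using flat_dual[of V E d "V - T"] assms unfolding balanced_def by simp
qed

text \<open>Such a flat is a contractible edge, of weight \<open>d - 1\<close>, and
  \<open>(d - 1) + 1 = d\<close>.\<close>

lemma flat_edge:
  assumes "simple_on V E" "biconn E S" "conn E (V - S)" "card S = 2"
  shows "sum (wgt d E V) (induced E S) + 1 = d * (int (card S) - 1)"
proof -
  obtain a b where ab: "S = {a, b}" "a \<noteq> b" using assms(4) by (auto simp: card_2_iff)
  have "\<exists>p\<in>{a}. \<exists>q\<in>{b}. {p, q} \<in> E"
    using connD[OF biconn_conn[OF assms(2)], of "{a}" "{b}"] ab by auto
  then have "S \<in> E" using ab by simp
  have "induced E S = {S}"
  proof -
    have "e = S" if "e \<in> E" "e \<subseteq> S" for e
      using that assms(1,4) card_subset_eq[of S e] card.infinite[of S] by (fastforce simp: simple_on_def)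
    then show ?thesis using \<open>S \<in> E\<close> by (auto simp: induced_def)
  qed
  then show ?thesis using assms(3,4) by (simp add: wgt_def)
qed

text \<open>Flats with two vertices are settled by \<open>flat_edge\<close>. For each larger flat
  either form of its equation may be supplied, whichever is local to the part of the graph at
  hand.\<close>

lemma balancedI:
  assumes "simple_on V E" "biconn E V" "3 \<le> card V" "sum (wgt d E V) E = d * (int (card V) - 1)"
    and fl: "\<And>S. S \<subset> V \<Longrightarrow> biconn E S \<Longrightarrow> conn E (V - S) \<Longrightarrow> 3 \<le> card S \<Longrightarrow>
       sum (wgt d E V) (induced E S) + 1 = d * (int (card S) - 1) \<or>
       sum (wgt d E V) (meeting E (V - S)) = d * int (card (V - S)) + 1"
  shows "balanced d V E"
  unfolding balanced_def
proof (intro conjI allI impI assms)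
  fix S assume S: "S \<subset> V" "biconn E S" "conn E (V - S)"
  show "sum (wgt d E V) (induced E S) + 1 = d * (int (card S) - 1)"
  proof (cases "card S = 2")
    case True then show ?thesis using flat_edge assms(1) S by blast
  next
    case False
    then have "3 \<le> card S" using S(2) unfolding biconn_def by linarith
    then show ?thesis using fl[OF S] flat_dual[OF assms(1,4), of S] S(1) by blast
  qed
qed

text \<open>The outside of \<open>F\<close>, connected together with whichever of \<open>x\<close>
  and \<open>y\<close> remain, acts like the edge \<open>{x, y}\<close>. Contractibility of edges
  and goodness of flats are connectivity of complements, so both pass between a graph and its piece
  \<open>F\<close> by this equivalence.\<close>

lemma conn_part_iff:
  assumes "F \<subseteq> V" "x \<in> F" "y \<in> F"
    and cl: "\<And>a b. a \<in> V - F \<Longrightarrow> b \<in> F \<Longrightarrow> {a, b} \<in> E \<Longrightarrow> b = x \<or> b = y"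
    and link: "\<And>Z. Z \<subset> {x, y} \<Longrightarrow> conn E ((V - F) \<union> ({x, y} - Z))"
    and X: "X \<subseteq> F" "\<not> {x, y} \<subseteq> X"
  shows "conn (insert {x, y} E) (F - X) \<longleftrightarrow> conn E (V - X)"
proof
  assume c: "conn (insert {x, y} E) (F - X)"
  have "X \<inter> {x, y} \<subset> {x, y}" using X by auto
  from link[OF this] have l: "conn E ((V - F) \<union> ({x, y} - X))" by (simp add: Diff_Int)
  have "conn E ((F - X) \<union> ((V - F) \<union> ({x, y} - X)))"
    by (rule conn_Un_edge[OF c l]) (use X assms(2,3) in auto)
  moreover have "(F - X) \<union> ((V - F) \<union> ({x, y} - X)) = V - X" using X assms(1-3) by auto
  ultimately show "conn E (V - X)" by simp
next
  assume c: "conn E (V - X)"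
  have "conn (insert {x, y} E) ((V - X) \<inter> F)"
  proof (rule conn_retract[OF c assms(2,3)])
    show "{x, y} \<inter> (V - X) \<noteq> {}" using X assms(1-3) by auto
    show "b = x \<or> b = y" if "a \<in> V - X - F" "b \<in> (V - X) \<inter> F" "{a, b} \<in> E" for a b
      using cl[of a b] that by simp
  qed
  moreover have "(V - X) \<inter> F = F - X" using assms(1) by auto
  ultimately show "conn (insert {x, y} E) (F - X)" by simp
qed

lemma conn_induced_iff: "X \<subseteq> F \<Longrightarrow> conn (insert c (induced E F)) X \<longleftrightarrow> conn (insert c E) X"
  by (intro iffI; erule conn_cong) (auto simp: induced_def)

lemma biconn_induced_iff: "X \<subseteq> F \<Longrightarrow> biconn (insert c (induced E F)) X \<longleftrightarrow> biconn (insert c E) X"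
  by (intro iffI; erule biconn_cong) (auto simp: induced_def)

lemma closed_in_nbr:
  assumes "simple_on V E" "closed_in E (V - {x, y}) D" "a \<in> D" "{a, b} \<in> E"
  shows "b \<in> D \<or> b = x \<or> b = y"
  using assms closed_inD[OF assms(2,3), of b] simple_on_neq[OF assms(1,4)] by blast

text \<open>Retracting \<open>D\<close> leaves \<open>V - D\<close> with a virtual edge
  \<open>{x, y}\<close>. Either this is a genuine edge, or what remains behind \<open>{x, y}\<close>
  is disconnected and \<open>biconn_del\<close> removes it again.\<close>

lemma biconn_side:
  assumes "simple_on V E" "biconn E V" "x \<in> V" "y \<in> V" "x \<noteq> y" "closed_in E (V - {x, y}) D"
    "D \<noteq> V - {x, y}" "{x, y} \<in> E \<or> \<not> conn E (V - {x, y} - D)"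
  shows "biconn E (V - D)"
proof -
  have D: "D \<subseteq> V - {x, y}" using assms(6) by (simp add: closed_in_def)
  have t: "biconn (insert {x, y} E) (V \<inter> (V - D))"
  proof (rule biconn_retract[OF assms(2)])
    show "b = x \<or> b = y" if "a \<in> V - (V - D)" "b \<in> V \<inter> (V - D)" "{a, b} \<in> E" for a b
      using closed_in_nbr[OF assms(1,6), of a b] that by auto
  qed (use D assms in auto)
  then have t: "biconn (insert {x, y} E) (V - D)" by (simp add: Int_absorb1)
  show ?thesis
  proof (cases "{x, y} \<in> E")
    case True then show ?thesis using t by (simp add: insert_absorb)
  next
    case False
    have "\<not> conn (insert {x, y} E) (V - D - {x, y})"
    proof
      assume "conn (insert {x, y} E) (V - D - {x, y})"
      then have "conn E (V - D - {x, y})" by (rule conn_cong) (auto simp: doubleton_eq_iff)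
      moreover have "V - D - {x, y} = V - {x, y} - D" by auto
      ultimately show False using assms(8) False by simp
    qed
    then have "biconn (insert {x, y} E - {{x, y}}) (V - D)"
      by (intro biconn_del[OF t]) (use D assms in auto)
    then show ?thesis using False by simp
  qed
qed

text \<open>The side \<open>D\<close> of a separating pair \<open>{x, y}\<close> inherits the balance once \<open>{x, y}\<close> is made an edge:
  the complement of \<open>D\<close> is itself a good flat, and its contribution cancels.\<close>

lemma balanced_split:
  assumes balanced: "balanced d V E" and xy: "x \<in> V" "y \<in> V" "x \<noteq> y"
    and D: "closed_in E (V - {x, y}) D" "D \<noteq> {}" "conn E D" "D \<noteq> V - {x, y}"
    and alt: "{x, y} \<in> E \<or> \<not> conn E (V - {x, y} - D)"
  shows "balanced d (D \<union> {x, y}) (insert {x, y} (induced E (D \<union> {x, y})))"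
proof -
  define F where "F = D \<union> {x, y}"
  define c where "c = {x, y}"
  define E' where "E' = insert c (induced E F)"
  have sg: "simple_on V E" and tcV: "biconn E V" using balanced by (auto simp: balanced_def)
  have finV: "finite V" using sg by (simp add: simple_on_def)
  have DV: "D \<subseteq> V - {x, y}" using D(1) by (simp add: closed_in_def)
  have FV: "F \<subseteq> V" "c \<subseteq> F" using DV xy by (auto simp: F_def c_def)
  have nbr: "b \<in> F" if "a \<in> D" "{a, b} \<in> E" for a b
    using closed_in_nbr[OF sg D(1) that] by (auto simp: F_def)
  have cl: "b = x \<or> b = y" if "a \<in> V - F" "b \<in> F" "{a, b} \<in> E" for a b
    using nbr[of b a] that by (auto simp: F_def insert_commute)
  have tcO: "biconn E (V - D)" using biconn_side[OF sg tcV xy D(1,4) alt] .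
  have VD: "V - D = (V - F) \<union> {x, y}" using DV xy by (auto simp: F_def)
  have link: "conn E ((V - F) \<union> ({x, y} - Z))" if "Z \<subset> {x, y}" for Z
  proof -
    have *: "Z = {} \<or> Z = {x} \<or> Z = {y}" using that by auto
    have "(V - F) \<union> ({x, y} - Z) = V - D - Z" using VD * FV by (auto simp: c_def)
    then show ?thesis using * biconn_conn_del[OF tcO] biconn_conn[OF tcO] by auto
  qed
  have part: "conn E' (F - X) \<longleftrightarrow> conn E (V - X)" if "X \<subseteq> F" "\<not> c \<subseteq> X" for X
    using conn_part_iff[OF FV(1) _ _ cl link that(1)] that conn_induced_iff[of "F - X" F c E]
    by (auto simp: E'_def c_def F_def)
  have tcF: "biconn E' F"
  proof -
    have "biconn (insert {x, y} E) (V \<inter> F)"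
      by (rule biconn_retract[OF tcV]) (use xy cl in \<open>auto simp: F_def\<close>)
    then show ?thesis using biconn_induced_iff[of F F c E] FV by (simp add: E'_def c_def Int_absorb1)
  qed
  have sgF: "simple_on F E'"
    using sg finV FV xy(3) finite_subset[of F V] unfolding simple_on_def E'_def induced_def c_def by auto
  have cardF: "card F = card D + 2"
  proof -
    have "finite D" using DV finV finite_subset by blast
    moreover have "D \<inter> {x, y} = {}" using DV by auto
    ultimately show ?thesis unfolding F_def using xy(3) by (simp add: card_Un_disjoint)
  qed
  have D1: "card D \<ge> 1" using D(2) DV finV by (metis One_nat_def Suc_leI card_gt_0_iff finite_Diff finite_subset)
  have wgt_eq: "wgt d E' F e = wgt d E V e" if "e \<in> E'" "e \<noteq> c" for e
  proof -
    have "e \<subseteq> F" "card e = 2" using that sgF by (auto simp: simple_on_def)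
    moreover then have "\<not> c \<subseteq> e" using that(2) xy(3) card_subset_eq[of e c] card.infinite[of e]
      by (fastforce simp: c_def)
    ultimately show ?thesis using part[of e] by (simp add: wgt_def)
  qed
  have meet_eq: "meeting E' T = meeting E T" if "T \<subseteq> D" for T
  proof -
    have "c \<inter> T = {}" using that DV by (auto simp: c_def)
    moreover have "e \<subseteq> F" if e: "e \<in> E" "e \<inter> T \<noteq> {}" for e
    proof -
      obtain a b where "e = {a, b}" using simple_on_edge[OF sg e(1)] by blast
      then show ?thesis using nbr[of a b] nbr[of b a] e \<open>T \<subseteq> D\<close>
        by (auto simp: F_def insert_commute)
    qed
    ultimately show ?thesis by (auto simp: meeting_def E'_def induced_def)
  qed
  have meet_sum: "sum (wgt d E' F) (meeting E' T) = sum (wgt d E V) (meeting E T)" if "T \<subseteq> D" for T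
  proof -
    have "c \<inter> T = {}" using that DV by (auto simp: c_def)
    then show ?thesis unfolding meet_eq[OF that, symmetric]
      by (intro sum.cong refl wgt_eq) (auto simp: meeting_def)
  qed
  have D_sum: "sum (wgt d E V) (meeting E D) = d * int (card D) + 1"
    by (rule balanced_dual[OF balanced _ D(2,3) tcO]) (use DV in auto)
  \<comment> \<open>Since \<open>D\<close> is connected, the new edge has weight
    \<open>d - 1\<close>. Together with \<open>d |D| + 1\<close> from \<open>D_sum\<close> this
    makes \<open>d (|D| + 1)\<close>, and \<open>F\<close> has two vertices more than
    \<open>D\<close>.\<close>
  have total: "sum (wgt d E' F) E' = d * (int (card F) - 1)"
  proof -
    have "F - D = c" using DV by (auto simp: F_def c_def)
    moreover have "induced E' c = {c}"
    proof -
      have "e = c" if "e \<in> E'" "e \<subseteq> c" for e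
      proof -
        have "card e = 2" "card c = 2" "finite c" using that sgF xy(3) by (auto simp: simple_on_def c_def)
        then show ?thesis using card_subset_eq[of c e] that by simp
      qed
      then show ?thesis by (auto simp: induced_def E'_def)
    qed
    moreover have "conn E' (F - c)"
    proof -
      have "F - c = D" using DV by (auto simp: F_def c_def)
      moreover have "conn E' D" by (rule conn_cong[OF D(3)]) (auto simp: E'_def induced_def F_def)
      ultimately show ?thesis by simp
    qed
    ultimately show ?thesis
      using sum_induced_meeting[OF sgF, of "wgt d E' F" D] meet_sum[of D] D_sum cardF
      by (simp add: wgt_def algebra_simps)
  qed
  have "balanced d F E'"
  proof (rule balancedI[OF sgF tcF _ total])
    show "3 \<le> card F" using cardF D1 by simp
    fix S assume S: "S \<subset> F" "biconn E' S" "conn E' (F - S)" "3 \<le> card S"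
    have SF: "S \<subseteq> F" using S(1) by auto
    have tcS: "biconn (insert {x, y} E) S" using S(2) biconn_induced_iff[OF SF, of c E] by (simp add: E'_def c_def)
    show "sum (wgt d E' F) (induced E' S) + 1 = d * (int (card S) - 1) \<or>
       sum (wgt d E' F) (meeting E' (F - S)) = d * int (card (F - S)) + 1"
    \<comment> \<open>A flat containing both \<open>x\<close> and \<open>y\<close> is compared
      through its complement \<open>T\<close>, which lies in \<open>D\<close>: \<open>V - T\<close>
      is \<open>S\<close> joined to the 2-connected set \<open>V - D\<close> at these two vertices.
      Any other flat of the piece is a flat of the whole graph.\<close>
    proof (cases "c \<subseteq> S")
      case True
      define T where "T = F - S"
      have T: "T \<subseteq> D" "T \<noteq> {}" using S(1) True by (auto simp: T_def F_def c_def)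
      have VT: "V - T = S \<union> (V - D)" using SF DV True xy by (auto simp: T_def F_def c_def)
      have del: "conn E (V - T - {z})" for z
      proof -
        have "conn E ((S - {z}) \<union> (V - D - {z}))"
        proof (rule conn_Un_edge[OF biconn_conn_del[OF tcS] biconn_conn_del[OF tcO]])
          show "(S - {z}) \<inter> (V - D - {z}) \<noteq> {}" using True xy DV by (auto simp: c_def)
          show "x \<in> V - D - {z} \<and> y \<in> V - D - {z}" if "x \<in> S - {z}" "y \<in> S - {z}"
            using that xy DV by auto
        qed
        moreover have "(S - {z}) \<union> (V - D - {z}) = V - T - {z}" using VT by auto
        ultimately show ?thesis by simp
      qed
      have "card S \<le> card (V - T)" using VT finite_Diff[OF finV, of T] by (metis Un_upper1 card_mono)
      then have "biconn E (V - T)" using del S(4) by (intro biconnI) auto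
      moreover have "conn E T" by (rule conn_cong[OF S(3)[folded T_def]])
          (use T DV in \<open>auto simp: E'_def induced_def c_def doubleton_eq_iff\<close>)
      ultimately have "sum (wgt d E V) (meeting E T) = d * int (card T) + 1"
        using T DV by (intro balanced_dual[OF balanced]) auto
      then show ?thesis using meet_sum[OF T(1)] by (simp add: T_def)
    next
      case False
      have "biconn E S" by (rule biconn_cong[OF S(2)])
          (use False in \<open>auto simp: E'_def induced_def c_def doubleton_eq_iff\<close>)
      moreover have "conn E (V - S)" using part[OF SF False] S(3) by simp
      moreover have "S \<subset> V" using S(1) FV by auto
      ultimately have "sum (wgt d E V) (induced E S) + 1 = d * (int (card S) - 1)"
        using balanced unfolding balanced_def by blast
      moreover have "sum (wgt d E' F) (induced E' S) = sum (wgt d E V) (induced E S)"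
      proof -
        have "induced E' S = induced E S" using False SF by (auto simp: induced_def E'_def)
        moreover have "sum (wgt d E' F) (induced E' S) = sum (wgt d E V) (induced E' S)"
          by (intro sum.cong refl wgt_eq) (use False in \<open>auto simp: induced_def\<close>)
        ultimately show ?thesis by simp
      qed
      ultimately show ?thesis by simp
    qed
  qed
  then show ?thesis unfolding F_def E'_def c_def .
qed

subsection \<open>Gluing\<close>

lemma edge_not_superset:
  assumes "simple_on V E" "e \<in> E" "x \<noteq> y" "e \<noteq> {x, y}"
  shows "\<not> {x, y} \<subseteq> e"
proof -
  obtain a b where "e = {a, b}" using simple_on_edge[OF assms(1,2)] by blast
  then show ?thesis using assms(3,4) by auto
qed

text \<open>The common edge has weight \<open>d - 1\<close> in each piece but weight 1 in the union,
  where several pieces hang on it. The other edges of a piece have total weight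
  \<open>d (|F i| - 2) + 1\<close>, and \<open>1 + d (|V| - 2) + (d - 1) = d (|V| - 1)\<close>
  explains why the number of pieces is \<open>d - 1\<close>.\<close>

lemma balanced_glue:
  assumes d: "3 \<le> d" and I: "finite I" "int (card I) = d - 1" and xy: "x \<noteq> y"
    and balanced: "\<And>i. i \<in> I \<Longrightarrow> balanced d (F i) (G i)"
    and c: "\<And>i. i \<in> I \<Longrightarrow> {x, y} \<in> G i" "\<And>i. i \<in> I \<Longrightarrow> conn (G i) (F i - {x, y})"
    and int: "\<And>i j. i \<in> I \<Longrightarrow> j \<in> I \<Longrightarrow> i \<noteq> j \<Longrightarrow> F i \<inter> F j = {x, y}"
  defines "V \<equiv> \<Union>i\<in>I. F i" and "E \<equiv> \<Union>i\<in>I. G i"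
  shows "balanced d V E" and "(\<And>i. i \<in> I \<Longrightarrow> exclusive (F i) (G i)) \<Longrightarrow> exclusive V E"
proof -
  let ?c = "{x, y}"
  have sgi: "simple_on (F i) (G i)" and tci: "biconn (G i) (F i)" if "i \<in> I" for i
    using balanced[OF that] by (auto simp: balanced_def)
  have two: "\<exists>j\<in>I. j \<noteq> i" for i
  proof (rule ccontr)
    assume "\<not> ?thesis"
    then have "I \<subseteq> {i}" by auto
    then have "card I \<le> card {i}" by (intro card_mono) auto
    then show False using I d by simp
  qed
  have Ine: "I \<noteq> {}" using two by auto
  have cF: "x \<in> F i" "y \<in> F i" if "i \<in> I" for i
    using c(1)[OF that] sgi[OF that] by (auto simp: simple_on_def)
  have sgV: "simple_on V E" using sgi I(1) unfolding simple_on_def V_def E_def by fastforce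
  have cE: "?c \<in> E" using c(1) Ine by (auto simp: E_def)
  have insE: "insert ?c E = E" using cE by auto
  have GE: "G i \<subseteq> E" "F i \<subseteq> V" if "i \<in> I" for i using that by (auto simp: E_def V_def)
  \<comment> \<open>An edge that comes from another piece but has both ends in \<open>F i\<close>
    lies in the intersection of the two pieces, so it is the common edge.\<close>
  have EG: "e \<in> G i" if i: "i \<in> I" and e: "e \<in> E" "e \<subseteq> F i" for i e
  proof -
    obtain j where j: "j \<in> I" "e \<in> G j" using e by (auto simp: E_def)
    show ?thesis
    proof (cases "j = i")
      case False
      have "e \<subseteq> F j" using sgi[OF j(1)] j(2) by (auto simp: simple_on_def)
      then have "e \<subseteq> ?c" using int[OF i j(1)] False e(2) by blast
      moreover have "card e = 2" "card ?c = 2" "finite ?c" using sgV e xy by (auto simp: simple_on_def)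
      ultimately have "e = ?c" using card_subset_eq[of ?c e] by simp
      then show ?thesis using c(1)[OF i] by simp
    qed (use j in simp)
  qed
  have cl: "a \<in> F i" if i: "i \<in> I" and ab: "{a, b} \<in> E" "b \<in> F i" "b \<notin> ?c" for i a b
  proof -
    obtain j where j: "j \<in> I" "{a, b} \<in> G j" using ab by (auto simp: E_def)
    then have "{a, b} \<subseteq> F j" using sgi[OF j(1)] by (auto simp: simple_on_def)
    then have "j = i" using int[OF i j(1)] ab(2,3) by blast
    then show ?thesis using \<open>{a, b} \<subseteq> F j\<close> by simp
  qed
  have delF: "conn E (F i - {z})" if "i \<in> I" for i z
    by (rule conn_mono[OF biconn_conn_del[OF tci[OF that]] GE(1)[OF that]])
  have conF: "conn E (F i)" if "i \<in> I" for i
    by (rule conn_mono[OF biconn_conn[OF tci[OF that]] GE(1)[OF that]])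
  have cardF: "3 \<le> card (F i)" "finite (F i)" if "i \<in> I" for i
    using balanced[OF that] by (auto simp: balanced_def simple_on_def)
  have finV: "finite V" using sgV by (simp add: simple_on_def)
  have cardV: "3 \<le> card V"
  proof -
    obtain i where "i \<in> I" using Ine by auto
    then show ?thesis using cardF(1)[of i] card_mono[OF finV GE(2)[of i]] by linarith
  qed
  have tcV: "biconn E V"
  proof (rule biconnI[OF cardV])
    fix z
    obtain p where p: "p \<in> ?c" "p \<noteq> z" using xy by blast
    have "conn E (\<Union>i\<in>I. F i - {z})"
      by (rule conn_UN[where p = p]) (use delF cF p in auto)
    moreover have "(\<Union>i\<in>I. F i - {z}) = V - {z}" by (auto simp: V_def)
    ultimately show "conn E (V - {z})" by simp
  qed
  have part: "conn E (F i - X) \<longleftrightarrow> conn E (V - X)" if i: "i \<in> I" and X: "X \<subseteq> F i" "\<not> ?c \<subseteq> X" for i X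
  proof -
    have link: "conn E ((V - F i) \<union> (?c - Z))" if Z: "Z \<subset> ?c" for Z
    proof -
      obtain p where p: "p \<in> ?c" "p \<notin> Z" using Z by blast
      have Z': "Z = {} \<or> Z = {x} \<or> Z = {y}" using Z by auto
      have "conn E (\<Union>j\<in>I - {i}. F j - Z)"
        by (rule conn_UN[where p = p]) (use delF conF cF p Z' in auto)
      moreover have "(\<Union>j\<in>I - {i}. F j - Z) = (V - F i) \<union> (?c - Z)"
      proof -
        obtain j where j: "j \<in> I" "j \<noteq> i" using two by auto
        show ?thesis using int[OF i] cF(1)[OF j(1)] cF(2)[OF j(1)] j Z unfolding V_def by blast
      qed
      ultimately show ?thesis by simp
    qed
    have "conn (insert ?c E) (F i - X) \<longleftrightarrow> conn E (V - X)"
    proof (rule conn_part_iff[OF GE(2)[OF i] cF[OF i] _ link X])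
      show "b = x \<or> b = y" if "a \<in> V - F i" "b \<in> F i" "{a, b} \<in> E" for a b
        using cl[OF i that(3,2)] that(1) by auto
    qed
    then show ?thesis by (simp add: insE)
  qed
  have connG: "conn (G i) X \<longleftrightarrow> conn E X" if i: "i \<in> I" and X: "X \<subseteq> F i" for i X
    by (intro iffI; erule conn_cong) (use EG[OF i] GE(1)[OF i] X in auto)
  have tcG: "biconn (G i) X \<longleftrightarrow> biconn E X" if i: "i \<in> I" and X: "X \<subseteq> F i" for i X
    by (intro iffI; erule biconn_cong) (use EG[OF i] GE(1)[OF i] X in auto)
  have wgt_eq: "wgt d (G i) (F i) e = wgt d E V e" if i: "i \<in> I" and e: "e \<in> G i" "e \<noteq> ?c" for i e
  proof -
    have "e \<subseteq> F i" using sgi[OF i] e by (auto simp: simple_on_def)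
    then show ?thesis using part[OF i _ edge_not_superset[OF sgi[OF i] e(1) xy e(2)]] connG[OF i]
      by (simp add: wgt_def)
  qed
  have nc: "\<not> conn E (V - ?c)"
  proof
    assume cc: "conn E (V - ?c)"
    obtain i where i: "i \<in> I" using Ine by auto
    obtain j where j: "j \<in> I" "j \<noteq> i" using two by auto
    have ne: "F k - ?c \<noteq> {}" if "k \<in> I" for k
    proof
      assume "F k - ?c = {}"
      then have "card (F k) \<le> card ?c" by (intro card_mono) auto
      then show False using cardF(1)[OF that] xy by simp
    qed
    have "closed_in E (V - ?c) (F i - ?c)" unfolding closed_in_def
    proof (intro conjI ballI notI)
      show "F i - ?c \<subseteq> V - ?c" using GE(2)[OF i] by auto
      fix a b assume "a \<in> F i - ?c" "b \<in> V - ?c - (F i - ?c)" "{a, b} \<in> E"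
      then show False using cl[OF i, of b a] by (auto simp: insert_commute)
    qed
    then have "F i - ?c = V - ?c" using conn_closed[OF cc] ne[OF i] by simp
    moreover have "F j - ?c \<subseteq> V - ?c" using GE(2)[OF j(1)] by auto
    ultimately show False using int[OF i j(1)] j(2) ne[OF j(1)] by blast
  qed
  have wtc: "wgt d E V ?c = 1" using nc by (simp add: wgt_def)
  have wtci: "wgt d (G i) (F i) ?c = d - 1" if "i \<in> I" for i using c(2)[OF that] by (simp add: wgt_def)
  have Csum: "sum (wgt d E V) (G i - {?c}) = d * int (card (F i - ?c)) + 1" if i: "i \<in> I" for i
  proof -
    have "sum (wgt d (G i) (F i)) (G i) = wgt d (G i) (F i) ?c + sum (wgt d (G i) (F i)) (G i - {?c})"
      using sum.remove[OF simple_on_finite[OF sgi[OF i]] c(1)[OF i]] by simp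
    moreover have "sum (wgt d (G i) (F i)) (G i - {?c}) = sum (wgt d E V) (G i - {?c})"
      by (intro sum.cong refl wgt_eq[OF i]) auto
    moreover have "int (card (F i - ?c)) = int (card (F i)) - 2"
      using cF[OF i] cardF[OF i] xy by (subst card_Diff_subset) auto
    then have "int (card (F i)) = int (card (F i - ?c)) + 2" by linarith
    moreover have "sum (wgt d (G i) (F i)) (G i) = d * (int (card (F i)) - 1)"
      using balanced[OF i] by (simp add: balanced_def)
    ultimately show ?thesis using wtci[OF i] by (simp add: algebra_simps)
  qed
  have cardVs: "int (card V) = 2 + (\<Sum>i\<in>I. int (card (F i - ?c)))"
  proof -
    have "V = ?c \<union> (\<Union>i\<in>I. F i - ?c)" using cF Ine by (auto simp: V_def)
    moreover have "card (?c \<union> (\<Union>i\<in>I. F i - ?c)) = card ?c + card (\<Union>i\<in>I. F i - ?c)"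
      using I(1) cardF(2) by (intro card_Un_disjoint) auto
    moreover have "card (\<Union>i\<in>I. F i - ?c) = (\<Sum>i\<in>I. card (F i - ?c))"
      using I(1) cardF(2) int by (intro card_UN_disjoint) blast+
    ultimately show ?thesis using xy by simp
  qed
  have total: "sum (wgt d E V) E = d * (int (card V) - 1)"
  proof -
    have "E - {?c} = (\<Union>i\<in>I. G i - {?c})" by (auto simp: E_def)
    moreover have "sum (wgt d E V) (\<Union>i\<in>I. G i - {?c}) = (\<Sum>i\<in>I. sum (wgt d E V) (G i - {?c}))"
    proof (rule sum.UNION_disjoint)
      show "\<forall>i\<in>I. finite (G i - {?c})" using simple_on_finite[OF sgi] by auto
      show "\<forall>i\<in>I. \<forall>j\<in>I. i \<noteq> j \<longrightarrow> (G i - {?c}) \<inter> (G j - {?c}) = {}"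
      proof (intro ballI impI)
        fix i j assume ij: "i \<in> I" "j \<in> I" "i \<noteq> j"
        have False if e: "e \<in> G i" "e \<in> G j" "e \<noteq> ?c" for e
        proof -
          have "e \<subseteq> F i" "e \<subseteq> F j" using sgi ij e by (auto simp: simple_on_def)
          then have "e \<subseteq> ?c" using int[OF ij] by blast
          then show False using edge_not_superset[OF sgi[OF ij(1)] e(1) xy e(3)] sgi[OF ij(1)] e card_subset_eq[of ?c e] xy
            by (auto simp: simple_on_def)
        qed
        then show "(G i - {?c}) \<inter> (G j - {?c}) = {}" by auto
      qed
    qed (rule I)
    moreover have "sum (wgt d E V) E = wgt d E V ?c + sum (wgt d E V) (E - {?c})"
      using sum.remove[OF simple_on_finite[OF sgV] cE] by simp
    moreover have "(\<Sum>i\<in>I. sum (wgt d E V) (G i - {?c})) = (\<Sum>i\<in>I. d * int (card (F i - ?c)) + 1)"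
      by (intro sum.cong refl Csum)
    ultimately have "sum (wgt d E V) E = 1 + (d * (\<Sum>i\<in>I. int (card (F i - ?c))) + int (card I))"
      using wtc by (simp add: sum.distrib sum_distrib_left)
    then show ?thesis using cardVs I(2) by (simp add: algebra_simps)
  qed
  show "balanced d V E"
  proof (rule balancedI[OF sgV tcV cardV total])
    fix S assume S: "S \<subset> V" "biconn E S" "conn E (V - S)" "3 \<le> card S"
    show "sum (wgt d E V) (induced E S) + 1 = d * (int (card S) - 1) \<or>
       sum (wgt d E V) (meeting E (V - S)) = d * int (card (V - S)) + 1"
    \<comment> \<open>If the flat contains both ends of the common edge, its connected complement
      avoids them and stays within one piece. Otherwise removing one end \<open>p\<close> leaves a
      connected set that avoids both ends, so \<open>S\<close> itself lies in one piece.\<close>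
    proof (cases "?c \<subseteq> S")
      case True
      define T where "T = V - S"
      obtain t where "t \<in> T" using S(1) by (auto simp: T_def)
      then obtain i where i: "i \<in> I" "t \<in> F i" by (auto simp: T_def V_def)
      have "closed_in E T (T \<inter> F i)" unfolding closed_in_def
      proof (intro conjI ballI notI)
        fix a b assume "a \<in> T \<inter> F i" "b \<in> T - T \<inter> F i" "{a, b} \<in> E"
        then show False using cl[OF i(1), of b a] True by (auto simp: insert_commute T_def)
      qed simp
      then have "T \<inter> F i = T" using conn_closed S(3) \<open>t \<in> T\<close> i(2) unfolding T_def by blast
      then have T: "T \<subseteq> F i - ?c" using True by (auto simp: T_def)
      have "biconn (insert ?c E) (S \<inter> F i)"
      proof (rule biconn_retract[OF S(2) cF[OF i(1)] xy True])
        show "b = x \<or> b = y" if "a \<in> S - F i" "b \<in> S \<inter> F i" "{a, b} \<in> E" for a b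
          using cl[OF i(1) that(3)] that by auto
      qed
      moreover have "S \<inter> F i = F i - T" using GE(2)[OF i(1)] by (auto simp: T_def)
      ultimately have "biconn (G i) (F i - T)" using tcG[OF i(1), of "F i - T"] insE by simp
      moreover have "conn (G i) T" using connG[OF i(1), of T] S(3) T by (auto simp: T_def)
      ultimately have "sum (wgt d (G i) (F i)) (meeting (G i) T) = d * int (card T) + 1"
        using balanced_dual[OF balanced[OF i(1)], of T] T \<open>t \<in> T\<close> by auto
      moreover have "meeting (G i) T = meeting E T"
      proof -
        have "e \<in> G i" if e: "e \<in> E" "e \<inter> T \<noteq> {}" for e
        proof -
          obtain a b where ab: "e = {a, b}" using simple_on_edge[OF sgV e(1)] by blast
          then have "e \<subseteq> F i" using e T cl[OF i(1), of a b] cl[OF i(1), of b a]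
            by (auto simp: insert_commute)
          then show ?thesis using EG[OF i(1) e(1)] by simp
        qed
        then show ?thesis using GE(1)[OF i(1)] by (auto simp: meeting_def)
      qed
      moreover have "sum (wgt d (G i) (F i)) (meeting (G i) T) = sum (wgt d E V) (meeting (G i) T)"
        by (intro sum.cong refl wgt_eq[OF i(1)]) (use T in \<open>auto simp: meeting_def\<close>)
      ultimately show ?thesis by (simp add: T_def)
    next
      case False
      then obtain p where p: "p \<in> ?c" "S \<inter> ?c \<subseteq> {p}" by auto
      have "S - {p} \<noteq> {}"
      proof
        assume "S - {p} = {}"
        then have "card S \<le> card {p}" by (intro card_mono) auto
        then show False using S(4) by simp
      qed
      then obtain s where s: "s \<in> S - {p}" by auto
      then obtain i where i: "i \<in> I" "s \<in> F i" using S(1) by (auto simp: V_def)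
      have "closed_in E (S - {p}) ((S - {p}) \<inter> F i)" unfolding closed_in_def
      proof (intro conjI ballI notI)
        fix a b assume "a \<in> (S - {p}) \<inter> F i" "b \<in> S - {p} - (S - {p}) \<inter> F i" "{a, b} \<in> E"
        then show False using cl[OF i(1), of b a] p by (auto simp: insert_commute)
      qed simp
      then have "(S - {p}) \<inter> F i = S - {p}" using conn_closed[OF biconn_conn_del[OF S(2)]] s i(2) by blast
      then have SF: "S \<subseteq> F i" using p cF[OF i(1)] by auto
      have "biconn (G i) S" using tcG[OF i(1) SF] S(2) by simp
      moreover have "conn (G i) (F i - S)" using connG[OF i(1), of "F i - S"] part[OF i(1) SF False] S(3) by auto
      moreover have "S \<subset> F i" using SF False cF[OF i(1)] by auto
      ultimately have "sum (wgt d (G i) (F i)) (induced (G i) S) + 1 = d * (int (card S) - 1)"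
        using balanced[OF i(1)] unfolding balanced_def by blast
      moreover have "induced (G i) S = induced E S" using EG[OF i(1)] GE(1)[OF i(1)] SF by (auto simp: induced_def)
      moreover have "sum (wgt d (G i) (F i)) (induced (G i) S) = sum (wgt d E V) (induced (G i) S)"
        by (intro sum.cong refl wgt_eq[OF i(1)]) (use False in \<open>auto simp: induced_def\<close>)
      ultimately show ?thesis by simp
    qed
  qed
  show "exclusive V E" if nd: "\<And>i. i \<in> I \<Longrightarrow> exclusive (F i) (G i)"
    unfolding exclusive_def
  proof (intro ballI impI notI)
    fix e assume e: "e \<in> E" "conn E (V - e)" "biconn (E - {e}) V"
    have ec: "e \<noteq> ?c" using e(2) nc by auto
    obtain i where i: "i \<in> I" "e \<in> G i" using e(1) by (auto simp: E_def)
    have eF: "e \<subseteq> F i" using sgi[OF i(1)] i(2) by (auto simp: simple_on_def)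
    have "conn (G i) (F i - e)"
      using connG[OF i(1), of "F i - e"] part[OF i(1) eF edge_not_superset[OF sgV e(1) xy ec]] e(2) by auto
    then have "\<not> biconn (G i - {e}) (F i)" using nd[OF i(1)] i(2) by (simp add: exclusive_def)
    \<comment> \<open>An edge deletable in the union is deletable in its piece: the other pieces
      retract onto the common edge, which the piece contains.\<close>
    moreover have "biconn (insert ?c (E - {e})) (V \<inter> F i)"
    proof (rule biconn_retract[OF e(3) cF[OF i(1)] xy])
      show "?c \<subseteq> V" using cF[OF i(1)] GE(2)[OF i(1)] by auto
      show "b = x \<or> b = y" if "a \<in> V - F i" "b \<in> V \<inter> F i" "{a, b} \<in> E - {e}" for a b
        using cl[OF i(1), of a b] that by auto
    qed
    then have "biconn (insert ?c (E - {e})) (F i)" using GE(2)[OF i(1)] by (simp add: Int_absorb1)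
    then have "biconn (G i - {e}) (F i)"
      by (rule biconn_cong) (use EG[OF i(1)] c(1)[OF i(1)] ec in auto)
    ultimately show False by simp
  qed
qed

subsection \<open>Subdivision\<close>

lemma path_edges_simps [simp]:
  "path_edges [] = {}" "path_edges [a] = {}"
  "path_edges (a # b # p) = insert {a, b} (path_edges (b # p))"
proof -
  show "path_edges (a # b # p) = insert {a, b} (path_edges (b # p))" (is "?L = ?R")
  proof (intro set_eqI iffI)
    fix e assume "e \<in> ?L"
    then obtain i where "e = {(a # b # p) ! i, (a # b # p) ! Suc i}" "Suc i < length (a # b # p)"
      unfolding path_edges_def by blast
    then show "e \<in> ?R" unfolding path_edges_def by (cases i) auto
  next
    fix e assume "e \<in> ?R"
    then consider "e = {a, b}" | i where "e = {(b # p) ! i, (b # p) ! Suc i}" "Suc i < length (b # p)"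
      unfolding path_edges_def by blast
    then show "e \<in> ?L"
    proof cases
      case 1 then show ?thesis unfolding path_edges_def by (intro CollectI exI[of _ 0]) auto
    next
      case 2 then show ?thesis unfolding path_edges_def by (intro CollectI exI[of _ "Suc i"]) auto
    qed
  qed
qed (auto simp: path_edges_def)

lemma path_edges_append_mono:
  "path_edges p \<union> path_edges q \<subseteq> path_edges (p @ q)"
proof (induction p)
  case Nil then show ?case by simp
next
  case (Cons b p) then show ?case by (cases p; cases q) auto
qed

lemma path_edges_subset: "e \<in> path_edges p \<Longrightarrow> e \<subseteq> set p"
  unfolding path_edges_def by auto

lemma path_edges_split:
  assumes "e \<in> path_edges p"
  obtains q a b r where "p = q @ a # b # r" "e = {a, b}"
proof -
  obtain i where i: "e = {p ! i, p ! Suc i}" "Suc i < length p" using assms unfolding path_edges_def by blast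
  then have "p = take i p @ p ! i # p ! Suc i # drop (Suc (Suc i)) p"
    by (metis Cons_nth_drop_Suc Suc_lessD append_take_drop_id)
  then show thesis using that i by blast
qed

lemma path_edges_nbrs:
  assumes "distinct (p @ k # q)" "{k, n} \<in> path_edges (p @ k # q)"
  shows "(p \<noteq> [] \<and> n = last p) \<or> (q \<noteq> [] \<and> n = hd q)"
proof -
  obtain p' a b r where s: "p @ k # q = p' @ a # b # r" "{k, n} = {a, b}"
    using path_edges_split[OF assms(2)] by blast
  from s(2) consider "k = a" "n = b" | "k = b" "n = a" by (auto simp: doubleton_eq_iff)
  then show ?thesis
  proof cases
    case 1
    then have "p @ k # q = p' @ k # b # r" using s(1) by simp
    then have "p = p' \<and> q = b # r" using assms(1) by (subst (asm) append_Cons_eq_iff) auto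
    then show ?thesis using 1 by simp
  next
    case 2
    have "p @ k # q = (p' @ [a]) @ k # r" using s(1) 2 by simp
    then have "p = p' @ [a] \<and> q = r" using assms(1) by (subst (asm) append_Cons_eq_iff) auto
    then show ?thesis using 2 by simp
  qed
qed

lemma finite_path_edges: "finite (path_edges p)"
  using path_edges_subset by (intro finite_subset[of "path_edges p" "Pow (set p)"]) auto

lemma card_path_edges:
  assumes "distinct p" "p \<noteq> []"
  shows "card (path_edges p) = length p - 1"
  using assms
proof (induction p rule: induct_list012)
  case (3 a b p)
  have "{a, b} \<notin> path_edges (b # p)" using path_edges_subset[of "{a, b}" "b # p"] 3(3) by auto
  then show ?case using 3 finite_path_edges[of "b # p"] by simp
qed auto

lemma conn_path: "conn (path_edges p) (set p)"
proof (induction p rule: induct_list012)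
  case (3 a b p)
  have "conn (path_edges (a # b # p)) (set (b # p))" by (rule conn_mono[OF 3(2)]) auto
  then have "conn (path_edges (a # b # p)) (insert a (set (b # p)))"
    by (rule conn_insert[of _ _ b]) auto
  then show ?case by simp
qed auto

text \<open>If \<open>k\<close> had a single neighbour in \<open>S\<close>, deleting that neighbour
  would isolate \<open>k\<close> from the remaining vertices.\<close>

lemma biconn_two_nbrs:
  assumes "biconn E S" "3 \<le> card S" "k \<in> S"
  obtains a b where "a \<in> S" "b \<in> S" "a \<noteq> b" "{k, a} \<in> E" "{k, b} \<in> E" "a \<noteq> k" "b \<noteq> k"
proof -
  have ne: "S - {k} - {a} \<noteq> {}" for a
  proof
    assume "S - {k} - {a} = {}"
    then have "card S \<le> card {k, a}" by (intro card_mono) auto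
    also have "\<dots> \<le> 2" by (simp add: card_insert_if)
    finally show False using assms(2) by simp
  qed
  have "S - {k} \<noteq> {}" using ne[of k] by simp
  then obtain a where a: "a \<in> S - {k}" "{k, a} \<in> E"
    using connD[OF biconn_conn[OF assms(1)], of "{k}" "S - {k}"] assms(3) by auto
  have "{k} \<union> (S - {k} - {a}) = S - {a}" "{k} \<inter> (S - {k} - {a}) = {}" using assms(3) a(1) by auto
  from connD[OF biconn_conn_del[OF assms(1)] this _ ne] obtain b where b: "b \<in> S - {k} - {a}" "{k, b} \<in> E"
    by auto
  show thesis using that[of a b] a b by auto
qed

text \<open>One configuration serves for subdividing and for undoing it: \<open>E'\<close> has the
  edge \<open>c\<close>, \<open>E\<close> has the path \<open>P\<close> instead, and
  \<open>E0\<close> is what they share. That \<open>E0\<close> is 2-connected and is separated by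
  \<open>u\<close> and \<open>v\<close> means that in \<open>E'\<close> the edge \<open>c\<close>
  can be deleted but not contracted, so that it has weight 1.\<close>

locale subdiv =
  fixes d :: int and V' :: "'a set" and E0 :: "'a set set" and u v :: 'a and xs :: "'a list"
    and q :: "'a list" and K V :: "'a set" and c :: "'a set" and P E E' :: "'a set set"
  defines "q \<equiv> u # xs @ [v]" and "K \<equiv> set xs" and "V \<equiv> V' \<union> K" and "c \<equiv> {u, v}"
    and "P \<equiv> path_edges q" and "E \<equiv> E0 \<union> P" and "E' \<equiv> insert c E0"
  assumes d: "3 \<le> d" and sg0: "simple_on V' E0" and uv: "u \<in> V'" "v \<in> V'" "u \<noteq> v" "{u, v} \<notin> E0"
    and xs: "distinct xs" "set xs \<inter> V' = {}" "int (length xs) = d - 2"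
    and tc0: "biconn E0 V'" and nconn: "\<not> conn E0 (V' - {u, v})"
begin

lemma xs_ne: "xs \<noteq> []" using xs(3) d by auto

lemma K_props: "K \<noteq> {}" "K \<inter> V' = {}" "finite K" "int (card K) = d - 2" "V - V' = K" "V' \<subseteq> V" "V - K = V'"
  using xs xs_ne distinct_card[OF xs(1)] by (auto simp: K_def V_def)

lemma c_props: "c \<subseteq> V'" "c \<inter> K = {}" "card c = 2"
  using uv K_props by (auto simp: c_def)

lemma q_props: "distinct q" "set q = K \<union> c" "int (card P) = d - 1" "finite P"
proof -
  show dq: "distinct q" using xs uv by (auto simp: q_def)
  show "set q = K \<union> c" by (auto simp: q_def K_def c_def)
  show "int (card P) = d - 1" using card_path_edges[OF dq] xs(3) by (simp add: P_def q_def)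
  show "finite P" by (simp add: P_def finite_path_edges)
qed

lemma P_edge: 
  assumes "e \<in> P" shows "e \<subseteq> K \<union> c" "e \<inter> K \<noteq> {}" "card e = 2"
proof -
  show "e \<subseteq> K \<union> c" using path_edges_subset assms q_props(2) by (auto simp: P_def)
  obtain q1 a b q2 where s: "q = q1 @ a # b # q2" "e = {a, b}"
    using path_edges_split assms unfolding P_def by metis
  show "card e = 2" using s q_props(1) by auto
  \<comment> \<open>As \<open>xs\<close> is nonempty, no edge of the path joins \<open>u\<close> to
    \<open>v\<close> directly: such an edge would start at the head of \<open>q\<close> and make
    \<open>v\<close> the head of \<open>xs\<close>.\<close>
  show "e \<inter> K \<noteq> {}"
  proof
    assume no: "e \<inter> K = {}"
    have "a \<in> K \<union> c" "b \<in> K \<union> c" unfolding q_props(2)[symmetric] s(1) by simp_all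
    then have "a \<in> c" "b \<in> c" using no s(2) by simp_all
    moreover have "a \<noteq> v"
    proof
      assume "a = v"
      then have "(u # xs) @ v # [] = q1 @ v # b # q2" using s(1) by (simp add: q_def)
      moreover have "v \<notin> set (u # xs)" using q_props(1) by (auto simp: q_def)
      ultimately show False by (subst (asm) append_Cons_eq_iff) auto
    qed
    moreover have "b \<noteq> u"
    proof
      assume "b = u"
      then have "hd q = b" by (simp add: q_def)
      moreover have "hd q \<in> set (q1 @ [a])" using s(1) by (cases q1) auto
      moreover have "b \<notin> set (q1 @ [a])" using q_props(1) unfolding s(1) by auto
      ultimately show False by simp
    qed
    ultimately have ab: "a = u" "b = v" by (auto simp: c_def)
    have "hd q = u" by (simp add: q_def)
    then have "q1 = []" using q_props(1) unfolding s(1) ab(1) by (cases q1) auto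
    then have "xs @ [v] = v # q2" using s(1) ab by (simp add: q_def)
    then have "hd xs = v" using xs_ne by (metis hd_append2 list.sel(1))
    then show False using xs_ne c_props(2) hd_in_set[of xs] by (auto simp: K_def c_def)
  qed
qed

lemma E0_edge: "e \<in> E0 \<Longrightarrow> e \<subseteq> V' \<and> card e = 2 \<and> e \<inter> K = {}"
  using sg0 K_props(2) by (auto simp: simple_on_def)

lemma disj: "E0 \<inter> P = {}" "c \<notin> E" "c \<notin> P"
proof -
  show "E0 \<inter> P = {}"
  proof (rule equals0I)
    fix e assume "e \<in> E0 \<inter> P"
    then show False using E0_edge[of e] P_edge(2)[of e] by simp
  qed
  show "c \<notin> P" using P_edge(2)[of c] c_props(2) by auto
  then show "c \<notin> E" using uv(4) by (simp add: E_def c_def)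
qed

lemma simples: "simple_on V E" "simple_on V' E'"
proof -
  show "simple_on V E" unfolding simple_on_def
  proof (intro conjI ballI)
    show "finite V" using sg0 K_props(3) by (simp add: V_def simple_on_def)
    fix e assume "e \<in> E"
    then show "e \<subseteq> V" "card e = 2" using E0_edge P_edge[of e] c_props(1) by (auto simp: E_def V_def)
  qed
  show "simple_on V' E'" using sg0 c_props by (auto simp: simple_on_def E'_def)
qed

lemma K_nbrs:
  assumes "k \<in> K"
  obtains a b where "\<And>n. {k, n} \<in> E \<Longrightarrow> n = a \<or> n = b"
proof -
  obtain q1 q2 where s: "q = q1 @ k # q2" using assms q_props(2) by (metis UnCI split_list)
  show thesis
  proof (rule that[of "last q1" "hd q2"])
    fix n assume "{k, n} \<in> E"
    then have "{k, n} \<in> P" using E0_edge[of "{k, n}"] assms by (auto simp: E_def)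
    then show "n = last q1 \<or> n = hd q2" using path_edges_nbrs[of q1 k q2 n] s q_props(1)
      by (auto simp: P_def)
  qed
qed

lemma link: 
  assumes "Z \<subset> {u, v}" shows "conn E (K \<union> (c - Z))"
proof -
  have "Z = {} \<or> Z = {u} \<or> Z = {v}" using assms by auto
  then show ?thesis
  proof (elim disjE)
    assume "Z = {}"
    then show ?thesis using conn_mono[OF conn_path[of q], of E] q_props(2) by (auto simp: E_def P_def)
  next
    assume Z: "Z = {u}"
    have "path_edges (xs @ [v]) \<subseteq> E"
      using path_edges_append_mono[of "[u]" "xs @ [v]"] by (auto simp: E_def P_def q_def)
    from conn_mono[OF conn_path this] show ?thesis using Z uv(3) by (simp add: K_def c_def insert_commute)
  next
    assume Z: "Z = {v}"
    have "path_edges (u # xs) \<subseteq> E"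
      using path_edges_append_mono[of "u # xs" "[v]"] by (auto simp: E_def P_def q_def)
    moreover have "{u, v} - {v} = {u}" using uv(3) by auto
    ultimately show ?thesis using Z conn_mono[OF conn_path, of "u # xs" E] by (simp add: K_def c_def)
  qed
qed

lemma cl: "a \<in> V - V' \<Longrightarrow> b \<in> V' \<Longrightarrow> {a, b} \<in> E \<Longrightarrow> b = u \<or> b = v"
  using E0_edge[of "{a, b}"] P_edge(1)[of "{a, b}"] K_props by (auto simp: E_def c_def)

lemma induced_E: "insert c (induced E V') = E'"
  using E0_edge P_edge(2) K_props(2) by (fastforce simp: induced_def E_def E'_def)

lemma conn_V'_iff: "X \<subseteq> V' \<Longrightarrow> conn (insert c E) X \<longleftrightarrow> conn E' X"
  using conn_induced_iff[of X V' c E] induced_E by simp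

lemma biconn_V'_iff: "X \<subseteq> V' \<Longrightarrow> biconn (insert c E) X \<longleftrightarrow> biconn E' X"
  using biconn_induced_iff[of X V' c E] induced_E by simp

lemma part: 
  assumes "X \<subseteq> V'" "\<not> c \<subseteq> X"
  shows "conn E' (V' - X) \<longleftrightarrow> conn E (V - X)"
proof -
  have "conn (insert {u, v} E) (V' - X) \<longleftrightarrow> conn E (V - X)"
    using link K_props(5) assms by (intro conn_part_iff[OF K_props(6) uv(1,2) cl]) (auto simp: c_def)
  then show ?thesis using conn_V'_iff[of "V' - X"] by (auto simp: c_def)
qed

text \<open>Cutting the block \<open>m\<close> out of the path leaves an initial and a final
  segment. Each of them, unless empty, still contains \<open>u\<close> or \<open>v\<close>
  respectively and is thereby attached to \<open>X\<close>.\<close>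

lemma conn_pieces:
  assumes s: "q = q1 @ m @ q2" and X: "conn E X" "X \<inter> set m = {}" "c - set m \<subseteq> X" "X \<noteq> {}"
  shows "conn E ((X \<union> K) - set m)"
proof -
  have d: "distinct q1" "distinct q2" "set q1 \<inter> set m = {}" "set q2 \<inter> set m = {}"
    using q_props(1) s by auto
  have P: "path_edges q1 \<subseteq> E" "path_edges q2 \<subseteq> E"
    using path_edges_append_mono[of q1 "m @ q2"] path_edges_append_mono[of m q2] s
    by (auto simp: E_def P_def)
  have 1: "q1 = [] \<or> u \<in> set q1 \<inter> X"
  proof (cases q1)
    case (Cons a q1')
    then have "a = u" using s by (simp add: q_def)
    then show ?thesis using Cons X(3) d(3) by (auto simp: c_def)
  qed simp
  have 2: "q2 = [] \<or> v \<in> set q2 \<inter> X"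
  proof (cases "q2 = []")
    case False
    then have "last q2 = last q" using s by simp
    also have "last q = v" by (simp add: q_def)
    finally have "v \<in> set q2" using last_in_set[OF False] by simp
    then show ?thesis using X(3) d(4) by (auto simp: c_def)
  qed simp
  have "conn E (X \<union> set q1)"
    using 1 conn_Un[OF X(1) conn_mono[OF conn_path P(1)]] X(1) by (cases "q1 = []") auto
  then have "conn E (X \<union> set q1 \<union> set q2)"
    using 2 conn_Un[OF _ conn_mono[OF conn_path P(2)], of "X \<union> set q1"] by (cases "q2 = []") auto
  moreover have "X \<union> set q1 \<union> set q2 = (X \<union> K) - set m"
  proof -
    have "set q1 \<union> set m \<union> set q2 = K \<union> c" using q_props(2) s by auto
    then show ?thesis using X(2,3) d(3,4) by blast
  qed
  ultimately show ?thesis by simp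
qed

lemma conn_P:
  assumes "e \<in> P" shows "conn E (V - e)"
proof -
  obtain q1 a b q2 where s: "q = q1 @ a # b # q2" "e = {a, b}"
    using path_edges_split assms unfolding P_def by metis
  have "conn E0 (V' - e)"
  proof (cases "c \<inter> e = {}")
    case True
    then have "V' - e = V'" using P_edge(1)[OF assms] K_props(2) by auto
    then show ?thesis using biconn_conn[OF tc0] by simp
  next
    case False
    then obtain z where z: "z \<in> c" "z \<in> e" by auto
    obtain k where k: "k \<in> e" "k \<in> K" using P_edge(2)[OF assms] by auto
    have "e = {z, k}" using z k s(2) c_props(2) by auto
    then have "V' - e = V' - {z}" using k K_props(2) by auto
    then show ?thesis using biconn_conn_del[OF tc0] by simp
  qed
  then have "conn E (V' - e)" by (rule conn_mono) (simp add: E_def)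
  moreover have "V' - e \<noteq> {}"
  proof
    assume "V' - e = {}"
    then have "c \<subseteq> e" using c_props(1) by auto
    then have "e = c" using s c_props(3) card_subset_eq[of e c] P_edge(3)[OF assms] by simp
    then show False using assms disj by simp
  qed
  ultimately have "conn E ((V' - e) \<union> K - set [a, b])"
    using s c_props(1) by (intro conn_pieces[of q1 "[a, b]" q2]) auto
  moreover have "(V' - e) \<union> K - set [a, b] = V - e" using s(2) by (auto simp: V_def)
  ultimately show ?thesis by simp
qed

text \<open>Deleting an inner vertex breaks the path into segments attached to \<open>S\<close>,
  which therefore has to be connected without \<open>c\<close>. When a vertex of \<open>S\<close> is
  deleted, the path does the work of \<open>c\<close>.\<close>

lemma biconn_add_path:
  assumes "c \<subseteq> S" "S \<subseteq> V'" "biconn E' S" "conn E0 S"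
  shows "biconn E (S \<union> K)"
proof -
  have fin: "finite S" using assms(3) biconn_finite by blast
  have "card (S \<union> K) = card S + card K" using fin K_props assms(2) by (intro card_Un_disjoint) auto
  moreover have "card S \<ge> 2" using assms(3) by (simp add: biconn_def)
  moreover have "card K \<ge> 1" using K_props(1,3) by (simp add: Suc_le_eq card_gt_0_iff)
  ultimately have "3 \<le> card (S \<union> K)" by simp
  moreover have "conn E (S \<union> K - {z})" if z: "z \<in> S \<union> K" for z
  proof (cases "z \<in> K")
    case True
    obtain q1 q2 where s: "q = q1 @ z # q2" using True q_props(2) by (metis UnCI split_list)
    have "conn E S" using assms(4) by (rule conn_mono) (simp add: E_def)
    then have "conn E (S \<union> K - set [z])"
      using s True assms(1,2) K_props(2) uv(1) by (intro conn_pieces[of q1 "[z]" q2]) (auto simp: c_def)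
    then show ?thesis by simp
  next
    case False
    have S: "conn (insert {u, v} E) (S - {z})"
      using biconn_conn_del[OF assms(3)] by (rule conn_mono) (auto simp: E'_def E_def c_def)
    have "{z} \<inter> c \<subset> {u, v}" 
    proof (rule psubsetI)
      show "{z} \<inter> c \<noteq> {u, v}" using uv(3) by (metis Int_lower1 insert_subset singletonD)
    qed (simp add: c_def)
    from link[OF this] have L: "conn E (K \<union> (c - {z}))" by (simp add: Diff_Int c_def)
    have "conn E ((S - {z}) \<union> (K \<union> (c - {z})))"
      by (rule conn_Un_edge[OF S L]) (use assms(1) uv(3) in \<open>auto simp: c_def\<close>)
    moreover have "(S - {z}) \<union> (K \<union> (c - {z})) = S \<union> K - {z}" using False assms(1) by auto
    ultimately show ?thesis by simp
  qed
  ultimately show ?thesis by (rule biconnI)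
qed

lemma biconns: "biconn E' V'" "biconn E V" "3 \<le> card V'" "card V = card V' + card K"
proof -
  show t: "biconn E' V'" using tc0 by (rule biconn_cong) (simp add: E'_def)
  show "biconn E V" using biconn_add_path[OF c_props(1) subset_refl t biconn_conn[OF tc0]] by (simp add: V_def)
  have "V' - {u, v} \<noteq> {}" using nconn conn_empty[of E0] by metis
  then obtain w where "w \<in> V'" "w \<noteq> u" "w \<noteq> v" by auto
  then have "{w, u, v} \<subseteq> V'" "card {w, u, v} = 3" using uv by auto
  then show "3 \<le> card V'" using sg0 card_mono[of V' "{w, u, v}"] by (simp add: simple_on_def)
  show "card V = card V' + card K" unfolding V_def
    using sg0 K_props by (intro card_Un_disjoint) (auto simp: simple_on_def)
qed

lemma wgt_E0: 
  assumes "e \<in> E0" shows "wgt d E V e = wgt d E' V' e"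
proof -
  have "e \<noteq> {u, v}" using assms uv(4) by auto
  then have "\<not> c \<subseteq> e" using edge_not_superset[OF sg0 assms uv(3)] by (simp add: c_def)
  then show ?thesis using part[of e] E0_edge[OF assms] by (simp add: wgt_def)
qed

lemma wgt_P: "e \<in> P \<Longrightarrow> wgt d E V e = d - 1"
  using conn_P by (simp add: wgt_def)

lemma wgt_c: "wgt d E' V' c = 1"
proof -
  have "\<not> conn E' (V' - c)"
  proof
    assume "conn E' (V' - c)"
    then have "conn E0 (V' - c)" by (rule conn_cong) (auto simp: E'_def c_def doubleton_eq_iff)
    then show False using nconn by (simp add: c_def)
  qed
  then show ?thesis by (simp add: wgt_def)
qed

text \<open>An edge of weight 1 is exchanged for \<open>d - 1\<close> edges of weight
  \<open>d - 1\<close>, while \<open>d - 2\<close> vertices are added; the length of the path is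
  explained by \<open>(d - 1)^2 - 1 = d (d - 2)\<close>.\<close>

lemma total_iff: "sum (wgt d E V) E = d * (int (card V) - 1) \<longleftrightarrow> sum (wgt d E' V') E' = d * (int (card V') - 1)"
proof -
  have fin: "finite E0" using simple_on_finite[OF sg0] .
  have "sum (wgt d E V) E = sum (wgt d E V) E0 + sum (wgt d E V) P"
    unfolding E_def using fin q_props(4) disj(1) by (intro sum.union_disjoint)
  also have "sum (wgt d E V) P = (d - 1) * (d - 1)"
    using wgt_P q_props(3) by simp
  also have "sum (wgt d E V) E0 = sum (wgt d E' V') E0" by (intro sum.cong refl wgt_E0)
  finally have 1: "sum (wgt d E V) E = sum (wgt d E' V') E0 + (d - 1) * (d - 1)" .
  have 2: "sum (wgt d E' V') E' = 1 + sum (wgt d E' V') E0"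
    unfolding E'_def using fin uv(4) wgt_c by (simp add: E'_def c_def)
  have cv: "int (card V) = int (card V') + d - 2" using biconns(4) K_props(4) by simp
  have "d * (int (card V) - 1) = d * (int (card V') - 1) + d * d - 2 * d"
    unfolding cv by (simp add: algebra_simps)
  moreover have "(d - 1) * (d - 1) = d * d - 2 * d + 1" by (simp add: algebra_simps)
  ultimately show ?thesis using 1 2 by linarith
qed

lemma induced_flat:
  assumes "S \<subseteq> V'" "\<not> c \<subseteq> S"
  shows "sum (wgt d E V) (induced E S) = sum (wgt d E' V') (induced E' S)" "biconn E S \<longleftrightarrow> biconn E' S"
proof -
  have 1: "induced E S = induced E0 S"
    using assms(1) P_edge(2) K_props(2) by (fastforce simp: induced_def E_def)
  have 2: "induced E' S = induced E0 S" using assms(2) by (auto simp: induced_def E'_def)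
  show "sum (wgt d E V) (induced E S) = sum (wgt d E' V') (induced E' S)"
    unfolding 1 2 by (intro sum.cong refl wgt_E0) (simp add: induced_def)
  have "biconn E' S" if "biconn (insert c E) S" using biconn_V'_iff[OF assms(1)] that by simp
  moreover have "biconn (insert c E) S" if "biconn E S" using that by (rule biconn_cong) simp
  moreover have "biconn E S" if "biconn E' S" using that
    by (rule biconn_cong) (use assms(2) in \<open>auto simp: E'_def E_def c_def doubleton_eq_iff\<close>)
  ultimately show "biconn E S \<longleftrightarrow> biconn E' S" by blast
qed

lemma meeting_flat:
  assumes "T \<subseteq> V'" "T \<inter> c = {}"
  shows "sum (wgt d E V) (meeting E T) = sum (wgt d E' V') (meeting E' T)" "conn E T \<longleftrightarrow> conn E' T"
proof -
  have "e \<inter> T = {}" if "e \<in> P" for e using P_edge(1)[OF that] assms K_props(2) by auto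
  then have 1: "meeting E T = meeting E0 T" by (auto simp: meeting_def E_def)
  have 2: "meeting E' T = meeting E0 T" using assms(2) by (auto simp: meeting_def E'_def)
  show "sum (wgt d E V) (meeting E T) = sum (wgt d E' V') (meeting E' T)"
    unfolding 1 2 by (intro sum.cong refl wgt_E0) (simp add: meeting_def)
  have "conn (insert c E) T \<longleftrightarrow> conn E T"
    by (intro iffI; erule conn_cong) (use assms(2) in \<open>auto simp: c_def doubleton_eq_iff\<close>)
  then show "conn E T \<longleftrightarrow> conn E' T" using conn_V'_iff[OF assms(1)] by simp
qed

text \<open>An inner vertex has at most two neighbours, and a 2-connected set of three or more
  vertices needs both of them; so membership in \<open>S\<close> spreads along the whole path up to
  its ends.\<close>

lemma flat_meets_path:
  assumes "biconn E S" "3 \<le> card S" "S \<subseteq> V" "S \<inter> K \<noteq> {}"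
  shows "K \<union> c \<subseteq> S"
proof -
  have nbs: "n \<in> S" if k: "k \<in> S \<inter> K" "{k, n} \<in> E" for k n
  proof -
    obtain a b where ab: "\<And>n. {k, n} \<in> E \<Longrightarrow> n = a \<or> n = b" using K_nbrs[of k] k(1) by blast
    obtain a' b' where "a' \<in> S" "b' \<in> S" "a' \<noteq> b'" "{k, a'} \<in> E" "{k, b'} \<in> E"
      using biconn_two_nbrs[OF assms(1,2), of k] k(1) by blast
    then have "a \<in> S" "b \<in> S" using ab by metis+
    then show ?thesis using ab[OF k(2)] by auto
  qed
  have "path_edges xs \<subseteq> E"
    using path_edges_append_mono[of xs "[v]"] path_edges_append_mono[of "[u]" "xs @ [v]"]
    by (auto simp: E_def P_def q_def)
  then have cK: "conn E K" unfolding K_def by (rule conn_mono[OF conn_path])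
  have "closed_in E K (S \<inter> K)" using nbs by (auto simp: closed_in_def)
  then have KS: "K \<subseteq> S" using conn_closed[OF cK] assms(4) by blast
  have "z \<in> S" if z: "z \<in> c" for z
  proof -
    have "c - (c - {z}) = {z}" "c - {z} \<subset> {u, v}" using z by (auto simp: c_def)
    then have "conn E (K \<union> {z})" using link[of "c - {z}"] by simp
    moreover have "K \<inter> {z} = {}" using c_props(2) z by auto
    ultimately have "\<exists>k\<in>K. \<exists>n\<in>{z}. {k, n} \<in> E" using connD[of E _ K "{z}"] K_props(1) by blast
    then show ?thesis using nbs KS by auto
  qed
  then show ?thesis using KS by auto
qed

text \<open>The complement of \<open>S\<close> is connected and misses \<open>u\<close> and
  \<open>v\<close>, so it lies within one side of the pair. A side disjoint from it is contained in
  \<open>S\<close> and joins \<open>u\<close> to \<open>v\<close> there without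
  \<open>c\<close>.\<close>

lemma conn_E0_flat:
  assumes "c \<subseteq> S" "S \<subset> V'" "biconn E' S" "conn E' (V' - S)"
  shows "conn E0 S"
proof -
  define T where "T = V' - S"
  have T: "T \<noteq> {}" "T \<subseteq> V' - {u, v}" using assms(1,2) by (auto simp: T_def c_def)
  have "conn E0 T" by (rule conn_cong[OF assms(4)[folded T_def]])
      (use T in \<open>auto simp: E'_def c_def doubleton_eq_iff\<close>)
  obtain A where A: "closed_in E0 (V' - {u, v}) A" "A \<noteq> {}" "A \<noteq> V' - {u, v}"
    using not_conn_closed[OF nconn] by blast
  have A': "A \<subseteq> V' - {u, v}" using A(1) by (simp add: closed_in_def)
  have "T \<subseteq> A \<or> T \<subseteq> V' - {u, v} - A"
    by (rule conn_one_side[OF \<open>conn E0 T\<close>]) (use T A(1) in \<open>auto simp: closed_in_def\<close>)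
  then obtain B where B: "closed_in E0 (V' - {u, v}) B" "B \<noteq> {}" "B \<inter> T = {}"
  proof
    assume "T \<subseteq> A"
    then show ?thesis using that[of "V' - {u, v} - A"] closed_in_compl[OF A(1)] A(3) A' by auto
  next
    assume "T \<subseteq> V' - {u, v} - A"
    then show ?thesis using that[of A] A by auto
  qed
  have c1: "conn E0 (B \<union> {u, v})"
    by (rule conn_mono[OF biconn_bridge[OF tc0 uv(1-3) B(1,2)]]) auto
  have c2: "conn (insert {u, v} E0) S" using biconn_conn[OF assms(3)] by (simp add: E'_def c_def)
  have "conn E0 (S \<union> (B \<union> {u, v}))"
    by (rule conn_Un_edge[OF c2 c1]) (use assms(1) in \<open>auto simp: c_def\<close>)
  moreover have "S \<union> (B \<union> {u, v}) = S"
    using B(1,3) assms(1) by (auto simp: closed_in_def T_def c_def)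
  ultimately show ?thesis by simp
qed

lemma balanced_subdivide: 
  assumes "balanced d V' E'" shows "balanced d V E"
proof (rule balancedI[OF simples(1) biconns(2)])
  show "3 \<le> card V" using biconns by simp
  show "sum (wgt d E V) E = d * (int (card V) - 1)" using assms total_iff by (simp add: balanced_def)
  fix S assume S: "S \<subset> V" "biconn E S" "conn E (V - S)" "3 \<le> card S"
  have SV: "S \<subseteq> V" using S(1) by auto
  show "sum (wgt d E V) (induced E S) + 1 = d * (int (card S) - 1) \<or>
       sum (wgt d E V) (meeting E (V - S)) = d * int (card (V - S)) + 1"
  proof (cases "S \<inter> K = {}")
    case False
    have KS: "K \<union> c \<subseteq> S" using flat_meets_path[OF S(2,4) SV False] .
    define T where "T = V - S"
    have T: "T \<subseteq> V'" "T \<inter> c = {}" "T \<noteq> {}" using KS S(1) by (auto simp: T_def V_def)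
    have S': "V' - T = S \<inter> V'" using KS S(1) by (auto simp: T_def V_def)
    have "biconn (insert {u, v} E) (S \<inter> V')"
      by (rule biconn_retract[OF S(2) uv(1-3)]) (use KS cl SV in \<open>auto simp: c_def\<close>)
    then have "biconn E' (V' - T)" using biconn_V'_iff[of "S \<inter> V'"] S' by (simp add: c_def)
    moreover have "conn E' T" using meeting_flat(2)[OF T(1,2)] S(3) by (simp add: T_def)
    ultimately have "sum (wgt d E' V') (meeting E' T) = d * int (card T) + 1"
      using balanced_dual[OF assms T(1,3)] by simp
    then show ?thesis using meeting_flat(1)[OF T(1,2)] by (simp add: T_def)
  next
    case True
    then have SV': "S \<subseteq> V'" using SV by (auto simp: V_def)
    show ?thesis
    \<comment> \<open>A flat that contains both ends but no inner vertex leaves \<open>K\<close> as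
      a component of its connected complement, hence \<open>V - S = K\<close>; its equation is
      \<open>(d - 1)^2 = d (d - 2) + 1\<close>.\<close>
    proof (cases "c \<subseteq> S")
      case True
      have "closed_in E (V - S) K" unfolding closed_in_def
      proof (intro conjI ballI notI)
        show "K \<subseteq> V - S" using SV' K_props by auto
        fix a b assume ab: "a \<in> K" "b \<in> V - S - K" "{a, b} \<in> E"
        then have "b = u \<or> b = v" using cl[of a b] K_props by auto
        then show False using True ab by (auto simp: c_def)
      qed
      then have "V - S = K" using conn_closed[OF S(3)] K_props(1) by metis
      moreover have "meeting E K = P"
      proof (intro set_eqI iffI)
        show "e \<in> P" if "e \<in> meeting E K" for e
          using that E0_edge[of e] by (auto simp: meeting_def E_def)
        show "e \<in> meeting E K" if "e \<in> P" for e
          using that P_edge(2)[of e] by (auto simp: meeting_def E_def)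
      qed
      moreover have "sum (wgt d E V) P = (d - 1) * (d - 1)" using wgt_P q_props(3) by simp
      moreover have "(d - 1) * (d - 1) = d * (d - 2) + 1" by (simp add: algebra_simps)
      ultimately show ?thesis by (simp only: K_props(4)) simp
    next
      case False
      have "S \<subset> V'" using False SV' c_props by auto
      moreover have "biconn E' S" using induced_flat(2)[OF SV' False] S(2) by simp
      moreover have "conn E' (V' - S)" using part[OF SV' False] S(3) by simp
      ultimately show ?thesis using assms induced_flat(1)[OF SV' False] unfolding balanced_def by metis
    qed
  qed
qed

lemma balanced_unsubdivide: 
  assumes "balanced d V E" shows "balanced d V' E'"
proof (rule balancedI[OF simples(2) biconns(1,3)])
  show "sum (wgt d E' V') E' = d * (int (card V') - 1)" using assms total_iff by (simp add: balanced_def)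
  fix S assume S: "S \<subset> V'" "biconn E' S" "conn E' (V' - S)" "3 \<le> card S"
  have SV: "S \<subseteq> V'" using S(1) by auto
  show "sum (wgt d E' V') (induced E' S) + 1 = d * (int (card S) - 1) \<or>
       sum (wgt d E' V') (meeting E' (V' - S)) = d * int (card (V' - S)) + 1"
  proof (cases "c \<subseteq> S")
    case True
    define T where "T = V' - S"
    have T: "T \<subseteq> V'" "T \<inter> c = {}" "T \<noteq> {}" using True S(1) by (auto simp: T_def)
    have "V - T = S \<union> K" using SV K_props by (auto simp: T_def V_def)
    then have "biconn E (V - T)" using biconn_add_path[OF True SV S(2) conn_E0_flat[OF True S(1-3)]] by simp
    moreover have "conn E T" using meeting_flat(2)[OF T(1,2)] S(3) by (simp add: T_def)
    moreover have "T \<subseteq> V" using T(1) by (auto simp: V_def)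
    ultimately have "sum (wgt d E V) (meeting E T) = d * int (card T) + 1"
      using balanced_dual[OF assms _ T(3)] by simp
    then show ?thesis using meeting_flat(1)[OF T(1,2)] by (simp add: T_def)
  next
    case False
    have "S \<subset> V" using S(1) by (auto simp: V_def)
    moreover have "biconn E S" using induced_flat(2)[OF SV False] S(2) by simp
    moreover have "conn E (V - S)" using part[OF SV False] S(3) by simp
    ultimately show ?thesis using assms induced_flat(1)[OF SV False] unfolding balanced_def by metis
  qed
qed

lemma exclusive_subdivide: 
  assumes "exclusive V' E'" shows "exclusive V E"
  unfolding exclusive_def
proof (intro ballI impI notI)
  fix e assume e: "e \<in> E" "conn E (V - e)" "biconn (E - {e}) V"
  show False
  \<comment> \<open>Deleting an edge of the path would leave its inner vertex \<open>k\<close> with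
    a single neighbour. For the other edges the path retracts onto \<open>c\<close>.\<close>
  proof (cases "e \<in> P")
    case True
    obtain k where k: "k \<in> e" "k \<in> K" using P_edge(2)[OF True] by auto
    obtain w z where "e = {w, z}" using simple_on_edge[OF simples(1) e(1)] by blast
    then obtain n where n: "e = {k, n}" using k by (cases "k = w") (auto simp: insert_commute)
    obtain a b where ab: "\<And>n. {k, n} \<in> E \<Longrightarrow> n = a \<or> n = b" using K_nbrs[of k] k(2) by blast
    have kV: "k \<in> V" "3 \<le> card V" using k(2) biconns by (auto simp: V_def)
    obtain a' b' where n': "a' \<noteq> b'" "{k, a'} \<in> E - {e}" "{k, b'} \<in> E - {e}"
      using biconn_two_nbrs[OF e(3) kV(2,1)] by blast
    then have "a' \<noteq> n" "b' \<noteq> n" using n by auto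
    moreover have "n = a \<or> n = b" "a' = a \<or> a' = b" "b' = a \<or> b' = b" using ab e(1) n n' by auto
    ultimately show False using n'(1) by auto
  next
    case False
    then have e0: "e \<in> E0" using e(1) by (simp add: E_def)
    then have ne: "e \<noteq> {u, v}" "e \<subseteq> V'" using uv(4) E0_edge by auto
    then have "\<not> c \<subseteq> e" using edge_not_superset[OF sg0 e0 uv(3)] by (simp add: c_def)
    then have "conn E' (V' - e)" using part[OF ne(2)] e(2) by simp
    then have "\<not> biconn (E' - {e}) V'" using assms e0 by (simp add: exclusive_def E'_def)
    moreover have "biconn (insert {u, v} (E - {e})) (V \<inter> V')"
      by (rule biconn_retract[OF e(3) uv(1-3)]) (use uv cl in \<open>auto simp: V_def\<close>)
    then have "biconn (insert {u, v} (E - {e})) V'" by (simp add: V_def Int_absorb1)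
    then have "biconn (E' - {e}) V'"
    proof (rule biconn_cong)
      fix a b assume ab: "a \<in> V'" "b \<in> V'" "{a, b} \<in> insert {u, v} (E - {e})"
      then have "{a, b} \<in> insert c (induced E V')" by (auto simp: induced_def c_def)
      moreover have "{a, b} \<noteq> e" using ab(3) ne(1) by auto
      ultimately show "{a, b} \<in> E' - {e}" unfolding induced_E by simp
    qed
    ultimately show False by simp
  qed
qed

end

subsection \<open>Balanced graphs with all edges contractible\<close>

definition nbs :: "'a set set \<Rightarrow> 'a \<Rightarrow> 'a set" where
  "nbs E v = {n. {v, n} \<in> E}"

lemma finite_nbs: "simple_on V E \<Longrightarrow> finite (nbs E v)"
  by (rule finite_subset[of _ V]) (auto simp: nbs_def simple_on_def)

lemma meeting_edge:
  assumes "simple_on V E" "e \<in> E" "k \<in> e"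
  obtains n where "e = {k, n}" "n \<in> nbs E k" "n \<noteq> k"
proof -
  obtain a b where ab: "e = {a, b}" "a \<noteq> b" using simple_on_edge[OF assms(1,2)] by blast
  show thesis
  proof (cases "k = a")
    case True then show thesis using that[of b] ab assms(2) by (auto simp: nbs_def)
  next
    case False
    then have "e = {k, a}" using ab(1) assms(3) by auto
    then show thesis using that[of a] False assms(2) by (auto simp: nbs_def)
  qed
qed

text \<open>The vertex \<open>k\<close> through which \<open>K\<close> is entered is peeled off and
  becomes the entry point for the rest of \<open>K\<close>. The end \<open>y\<close> may coincide
  with \<open>x\<close>; that the ends differ is a matter of 2-connectedness, settled in
  \<open>path_comp\<close>.\<close>

lemma path_of_degree_two:
  assumes "simple_on V E" "finite K" "conn E K" "x \<notin> K" "k \<in> K" "{x, k} \<in> E"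
    "\<And>v. v \<in> K \<Longrightarrow> card (nbs E v) = 2"
  shows "\<exists>xs y. set xs = K \<and> distinct xs \<and> y \<notin> K \<and> meeting E K = path_edges (x # xs @ [y])"
  using assms(2-)
proof (induction "card K" arbitrary: K x k rule: less_induct)
  case (less K x k)
  have kx: "{k, x} \<in> E" using less.prems by (simp add: insert_commute)
  then have "x \<in> nbs E k" by (simp add: nbs_def)
  moreover obtain p q where "nbs E k = {p, q}" "p \<noteq> q"
    using less.prems(6)[OF less.prems(4)] by (auto simp: card_2_iff)
  ultimately have "\<exists>m. nbs E k = {x, m} \<and> m \<noteq> x" by (cases "x = p") (auto simp: insert_commute)
  then obtain m where m: "nbs E k = {x, m}" "m \<noteq> x" by blast
  have mE: "{k, m} \<in> E" using m by (auto simp: nbs_def)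
  have mk: "m \<noteq> k" using simple_on_neq[OF assms(1) mE] by auto
  have edges_k: "e = {x, k} \<or> e = {k, m}" if e: "e \<in> E" "k \<in> e" for e
  proof -
    obtain n where "e = {k, n}" "n \<in> nbs E k" using meeting_edge[OF assms(1) e] by blast
    then show ?thesis using m(1) by (auto simp: insert_commute)
  qed
  show ?case
  proof (cases "m \<in> K")
    case False
    have "closed_in E K {k}" unfolding closed_in_def
    proof (intro conjI ballI notI)
      fix a b assume "a \<in> {k}" "b \<in> K - {k}" "{a, b} \<in> E"
      then have "b \<in> nbs E k" "b \<in> K" by (auto simp: nbs_def)
      then show False using m(1) False less.prems(3) by auto
    qed (use less.prems in auto)
    then have K: "K = {k}" using conn_closed[OF less.prems(2)] by auto
    have "meeting E K = {{x, k}, {k, m}}"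
      using edges_k kx mE K by (auto simp: meeting_def insert_commute)
    then have "meeting E K = path_edges (x # [k] @ [m])" by simp
    then show ?thesis using K mk by (intro exI[of _ "[k]"] exI[of _ m]) auto
  next
    case True
    let ?K = "K - {k}"
    \<comment> \<open>Within \<open>K\<close> the vertex \<open>k\<close> is adjacent to
      \<open>m\<close> only, so sending \<open>k\<close> to \<open>m\<close> retracts
      \<open>K\<close> onto \<open>K - {k}\<close>.\<close>
    have c: "conn E ?K"
    proof (rule conn_image[OF less.prems(2), of "\<lambda>a. if a = k then m else a"])
      show "(\<lambda>a. if a = k then m else a) ` K = ?K" using True mk by auto
      fix a b assume ab: "a \<in> K" "b \<in> K" "{a, b} \<in> E"
      have *: "b' = m" if "b' \<in> K" "{k, b'} \<in> E" for b'
        using that m(1) less.prems(3) by (auto simp: nbs_def)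
      show "(if a = k then m else a) = (if b = k then m else b) \<or>
         {if a = k then m else a, if b = k then m else b} \<in> E"
        using ab *[of a] *[of b] by (auto simp: insert_commute)
    qed
    have "card ?K < card K" using less.prems(1,4) by (meson card_Diff1_less)
    then have "\<exists>xs y. set xs = ?K \<and> distinct xs \<and> y \<notin> ?K \<and> meeting E ?K = path_edges (k # xs @ [y])"
      by (rule less.hyps[OF _ _ c, of k m]) (use less.prems(1,6) True mk mE in simp_all)
    then obtain xs y where
      xs: "set xs = ?K" "distinct xs" "y \<notin> ?K" "meeting E ?K = path_edges (k # xs @ [y])" by blast
    have "m \<in> set xs" unfolding xs(1) using True mk by simp
    then have xs_ne: "xs \<noteq> []" by auto
    have pathE: "path_edges (k # xs @ [y]) \<subseteq> E" using xs(4) by (auto simp: meeting_def)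
    \<comment> \<open>A path returning to \<open>k\<close> would start and end at \<open>m\<close>,
      the only neighbour of \<open>k\<close> in \<open>K\<close>; without repetitions it would
      consist of \<open>m\<close> alone, which would then have just one neighbour.\<close>
    have "y \<noteq> k"
    proof
      assume y: "y = k"
      obtain h xs' where xh: "xs = h # xs'" using xs_ne by (cases xs) auto
      obtain l xs'' where xl: "xs = xs'' @ [l]" using xs_ne by (cases xs rule: rev_cases) auto
      have "{k, h} \<in> E" using pathE xh by auto
      then have "h \<in> nbs E k" by (simp add: nbs_def)
      have "h \<in> set xs" using xh by simp
      then have "h \<in> K" unfolding xs(1) by simp
      then have h: "h = m" using \<open>h \<in> nbs E k\<close> m(1) less.prems(3) by auto
      have "{l, k} \<in> path_edges (k # xs'' @ [l, k])"
        using path_edges_append_mono[of "k # xs''" "[l, k]"] by auto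
      then have "{l, k} \<in> E" using pathE xl y by auto
      then have "l \<in> nbs E k" by (simp add: nbs_def insert_commute)
      have "l \<in> set xs" using xl by simp
      then have "l \<in> K" unfolding xs(1) by simp
      then have l: "l = m" using \<open>l \<in> nbs E k\<close> m(1) less.prems(3) by auto
      have xsm: "xs = [m]" using xs(2) xh xl h l by (cases xs'') auto
      have "nbs E m \<subseteq> {k}"
      proof
        fix n assume "n \<in> nbs E m"
        then have "{m, n} \<in> meeting E ?K" using True mk by (auto simp: nbs_def meeting_def)
        then have "{m, n} \<in> {{k, m}, {m, k}}" using xs(4) xsm y by simp
        then show "n \<in> {k}" by (auto simp: doubleton_eq_iff)
      qed
      then have "card (nbs E m) \<le> 1" using card_mono[of "{k}" "nbs E m"] by simp
      then show False using less.prems(6)[OF True] by simp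
    qed
    moreover have "meeting E K = insert {x, k} (meeting E ?K)"
    proof (intro set_eqI iffI)
      fix e assume "e \<in> meeting E K"
      then show "e \<in> insert {x, k} (meeting E ?K)"
        using edges_k[of e] True mk by (auto simp: meeting_def)
    next
      fix e assume "e \<in> insert {x, k} (meeting E ?K)"
      then show "e \<in> meeting E K" using kx less.prems(4) by (auto simp: meeting_def insert_commute)
    qed
    moreover have "set (k # xs) = K" using xs(1) less.prems(4) by auto
    moreover have "distinct (k # xs)" using xs(1,2) by simp
    moreover have "y \<notin> K" using xs(3) \<open>y \<noteq> k\<close> by simp
    moreover have "path_edges (x # (k # xs) @ [y]) = insert {x, k} (path_edges (k # xs @ [y]))" by simp
    ultimately show ?thesis using xs(4) by metis
  qed
qed

lemma path_ends:
  assumes "distinct (a # xs @ [b])" "xs \<noteq> []" "meeting E (set xs) = path_edges (a # xs @ [b])"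
  shows "\<And>k n. k \<in> set xs \<Longrightarrow> n \<notin> set xs \<Longrightarrow> {k, n} \<in> E \<Longrightarrow> n = a \<or> n = b"
    and "\<exists>k\<in>set xs. {a, k} \<in> E \<and> (\<forall>n\<in>set xs. {a, n} \<in> E \<longrightarrow> n = k)"
    and "\<exists>k\<in>set xs. {b, k} \<in> E \<and> (\<forall>n\<in>set xs. {b, n} \<in> E \<longrightarrow> n = k)"
proof -
  show "n = a \<or> n = b" if "k \<in> set xs" "n \<notin> set xs" "{k, n} \<in> E" for k n
  proof -
    have "{k, n} \<in> meeting E (set xs)" using that by (auto simp: meeting_def)
    then have "{k, n} \<subseteq> set (a # xs @ [b])" unfolding assms(3) by (rule path_edges_subset)
    then show ?thesis using that by auto
  qed
  have in_path: "{c, n} \<in> path_edges (a # xs @ [b])" if "n \<in> set xs" "{c, n} \<in> E" for c n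
    using that assms(3) by (auto simp: meeting_def)
  show "\<exists>k\<in>set xs. {a, k} \<in> E \<and> (\<forall>n\<in>set xs. {a, n} \<in> E \<longrightarrow> n = k)"
  proof (intro bexI conjI ballI impI)
    show "hd xs \<in> set xs" using assms(2) by simp
    have "{a, hd xs} \<in> path_edges (a # xs @ [b])" using assms(2) by (cases xs) auto
    then show "{a, hd xs} \<in> E" using assms(3) by (auto simp: meeting_def)
    fix n assume "n \<in> set xs" "{a, n} \<in> E"
    then show "n = hd xs" using path_edges_nbrs[of "[]" a "xs @ [b]" n] in_path assms(1,2) by auto
  qed
  show "\<exists>k\<in>set xs. {b, k} \<in> E \<and> (\<forall>n\<in>set xs. {b, n} \<in> E \<longrightarrow> n = k)"
  proof (intro bexI conjI ballI impI)
    show "last xs \<in> set xs" using assms(2) by simp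
    have "{last xs, b} \<in> path_edges (a # xs @ [b])"
    proof -
      have *: "a # xs @ [b] = (a # butlast xs) @ [last xs, b]" using assms(2) by simp
      have "{last xs, b} \<in> path_edges [last xs, b]" by simp
      then show ?thesis unfolding * using path_edges_append_mono[of "a # butlast xs" "[last xs, b]"] by blast
    qed
    then show "{b, last xs} \<in> E" using assms(3) by (auto simp: meeting_def insert_commute)
    fix n assume "n \<in> set xs" "{b, n} \<in> E"
    then show "n = last xs" using path_edges_nbrs[of "a # xs" b "[]" n] in_path assms(1,2) by auto
  qed
qed

lemma handshake:
  assumes "simple_on V E"
  shows "(\<Sum>v\<in>V. card (nbs E v)) = 2 * card E"
proof -
  have finE: "finite E" using simple_on_finite[OF assms] .
  have finV: "finite V" using assms by (simp add: simple_on_def)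
  have "card (nbs E v) = (\<Sum>e\<in>E. if v \<in> e then 1 else 0)" if "v \<in> V" for v
  proof -
    have "bij_betw (\<lambda>n. {v, n}) (nbs E v) {e \<in> E. v \<in> e}"
    proof (rule bij_betw_imageI)
      show "inj_on (\<lambda>n. {v, n}) (nbs E v)" by (auto simp: inj_on_def doubleton_eq_iff)
      show "(\<lambda>n. {v, n}) ` nbs E v = {e \<in> E. v \<in> e}"
      proof (intro equalityI subsetI)
        fix e assume "e \<in> {e \<in> E. v \<in> e}"
        then obtain n where "e = {v, n}" "n \<in> nbs E v" using meeting_edge[OF assms, of e v] by blast
        then show "e \<in> (\<lambda>n. {v, n}) ` nbs E v" by blast
      qed (auto simp: nbs_def)
    qed
    then have "card (nbs E v) = card {e \<in> E. v \<in> e}" by (rule bij_betw_same_card)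
    then show ?thesis using finE by (simp add: sum.If_cases Int_def)
  qed
  then have "(\<Sum>v\<in>V. card (nbs E v)) = (\<Sum>v\<in>V. \<Sum>e\<in>E. if v \<in> e then 1 else 0)" by (rule sum.cong[OF refl])
  also have "\<dots> = (\<Sum>e\<in>E. \<Sum>v\<in>V. if v \<in> e then 1 else 0)" by (rule sum.swap)
  also have "\<dots> = (\<Sum>e\<in>E. 2)"
  proof (rule sum.cong[OF refl])
    fix e assume "e \<in> E"
    then have "e \<subseteq> V" "card e = 2" using assms by (auto simp: simple_on_def)
    moreover then have "V \<inter> {v. v \<in> e} = e" by auto
    ultimately show "(\<Sum>v\<in>V. if v \<in> e then 1 else 0) = (2::nat)" using finV by (simp add: sum.If_cases)
  qed
  finally show ?thesis by simp
qed

section \<open>Counting edges when every edge is contractible\<close>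

locale crit =
  fixes d :: int and V :: "'a set" and E :: "'a set set"
  assumes d: "3 \<le> d" and balanced: "balanced d V E"
    and contr: "\<And>e. e \<in> E \<Longrightarrow> conn E (V - e)"
begin

definition hub :: "'a \<Rightarrow> bool" where
  "hub v \<longleftrightarrow> v \<in> V \<and> 3 \<le> card (nbs E v)"

text \<open>The whole of \<open>V - {x, y}\<close> counts as a side only if \<open>{x, y}\<close> is an edge.\<close>

definition side :: "'a \<Rightarrow> 'a \<Rightarrow> 'a set \<Rightarrow> bool" where
  "side x y D \<longleftrightarrow> x \<in> V \<and> y \<in> V \<and> x \<noteq> y \<and> D \<noteq> {} \<and> conn E D \<and> closed_in E (V - {x, y}) D \<and>
     (D \<noteq> V - {x, y} \<or> {x, y} \<in> E)"

text \<open>Normalized so that the complement of a good flat has gap 1.\<close>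

definition gap :: "'a set \<Rightarrow> int" where
  "gap T = (d - 1) * int (card (meeting E T)) - d * int (card T)"

lemma basics: "simple_on V E" "biconn E V" "3 \<le> card V" "finite V" "finite E"
  using balanced simple_on_finite[of V E] by (auto simp: balanced_def simple_on_def)

lemma edge_in: "{a, b} \<in> E \<Longrightarrow> a \<noteq> b \<and> a \<in> V \<and> b \<in> V"
  using simple_on_neq[OF basics(1)] by blast

lemma edge_sym: "{a, b} \<in> E \<Longrightarrow> {b, a} \<in> E"
  by (simp add: insert_commute)

lemma wgt_E: "e \<in> E \<Longrightarrow> wgt d E V e = d - 1"
  using contr by (simp add: wgt_def)

lemma sum_wgt: "A \<subseteq> E \<Longrightarrow> sum (wgt d E V) A = (d - 1) * int (card A)"
proof -
  assume "A \<subseteq> E"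
  then have "sum (wgt d E V) A = sum (\<lambda>_. d - 1) A" using wgt_E by (intro sum.cong) auto
  then show ?thesis by simp
qed

lemma total: "(d - 1) * int (card E) = d * (int (card V) - 1)"
  using balanced sum_wgt[of E] by (simp add: balanced_def)

lemma gap_removable:
  assumes "T \<subseteq> V" "T \<noteq> {}" "conn E T" "biconn E (V - T)"
  shows "gap T = 1"
  using balanced_dual[OF balanced assms] sum_wgt[of "meeting E T"] by (simp add: gap_def meeting_def)

lemma nbs_ge2: 
  assumes "v \<in> V" shows "2 \<le> card (nbs E v)"
proof -
  obtain a b where "a \<noteq> b" "{v, a} \<in> E" "{v, b} \<in> E"
    using biconn_two_nbrs[OF basics(2,3) assms] by blast
  then have "{a, b} \<subseteq> nbs E v" "card {a, b} = 2" by (auto simp: nbs_def)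
  then show ?thesis using card_mono[OF finite_nbs[OF basics(1)]] by metis
qed

lemma nonhub: "v \<in> V \<Longrightarrow> \<not> hub v \<Longrightarrow> card (nbs E v) = 2"
  using nbs_ge2[of v] by (simp add: hub_def)

lemma hub_V: "hub v \<Longrightarrow> v \<in> V" by (simp add: hub_def)

lemma hub_card: 
  assumes "hub v" "nbs E v \<subseteq> {a, b}" shows False
proof -
  have "card (nbs E v) \<le> card {a, b}" using assms(2) by (intro card_mono) auto
  also have "\<dots> \<le> 2" by (simp add: card_insert_if)
  finally show False using assms(1) by (simp add: hub_def)
qed

lemma closed_comp:
  assumes "closed_in E X M" "a \<in> M" "M \<subseteq> V"
  obtains C where "a \<in> C" "C \<subseteq> M" "conn E C" "closed_in E X C"
proof -
  have "finite M" using assms(3) basics(4) by (rule finite_subset)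
  then obtain C where C: "a \<in> C" "C \<subseteq> M" "conn E C" "closed_in E M C"
    using conn_component[of M a E] assms(2) by blast
  have "closed_in E X C" unfolding closed_in_def
  proof (intro conjI ballI notI)
    show "C \<subseteq> X" using C(2) assms(1) by (auto simp: closed_in_def)
    fix p q assume pq: "p \<in> C" "q \<in> X - C" "{p, q} \<in> E"
    then have "q \<in> M" using closed_inD[OF assms(1), of p q] C(2) by auto
    then show False using closed_inD[OF C(4) pq(1) _ pq(3)] pq(2) by simp
  qed
  then show thesis using that C by blast
qed

lemma closed_no_cut:
  assumes "closed_in E (V - {c}) A" "w \<in> V - {c}" "w \<notin> A"
  shows "A = {}"
  using conn_closed[OF biconn_conn_del[OF basics(2)] assms(1)] assms(2,3) by blast

text \<open>If the two ends of the path coincided, that vertex would cut \<open>K\<close> off from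
  another vertex outside \<open>K\<close>, which the bound on \<open>V - K\<close> supplies.\<close>

lemma path_comp:
  assumes "K \<noteq> {}" "conn E K" "K \<subseteq> V" "\<And>k. k \<in> K \<Longrightarrow> \<not> hub k" "2 \<le> card (V - K)"
  obtains a b xs where "a \<noteq> b" "a \<in> V - K" "b \<in> V - K" "set xs = K" "distinct (a # xs @ [b])"
    "xs \<noteq> []" "meeting E K = path_edges (a # xs @ [b])"
proof -
  have fK: "finite K" using assms(3) basics(4) by (rule finite_subset)
  have ne: "V - K \<noteq> {}" using assms(5) by (metis card.empty not_numeral_le_zero)
  have "K \<union> (V - K) = V" "K \<inter> (V - K) = {}" using assms(3) by auto
  from connD[OF biconn_conn[OF basics(2)] this assms(1) ne]
  obtain k a where ka: "k \<in> K" "a \<in> V - K" "{k, a} \<in> E" by blast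
  have deg: "card (nbs E v) = 2" if "v \<in> K" for v using nonhub that assms(3,4) by auto
  have aK: "a \<notin> K" using ka(2) by simp
  obtain xs b where xs: "set xs = K" "distinct xs" "b \<notin> K" "meeting E K = path_edges (a # xs @ [b])"
    using path_of_degree_two[OF basics(1) fK assms(2) aK ka(1) edge_sym[OF ka(3)] deg] by blast
  have xs_ne: "xs \<noteq> []" using xs(1) assms(1) by (metis set_empty)
  have "{last xs, b} \<in> path_edges (a # xs @ [b])"
  proof -
    have *: "a # xs @ [b] = (a # butlast xs) @ [last xs, b]" using xs_ne by simp
    have "{last xs, b} \<in> path_edges [last xs, b]" by simp
    then show ?thesis unfolding * using path_edges_append_mono[of "a # butlast xs" "[last xs, b]"] by blast
  qed
  then have "{last xs, b} \<in> E" using xs(4) by (auto simp: meeting_def)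
  then have bV: "b \<in> V" using edge_in by blast
  have "a \<noteq> b"
  proof
    assume ab: "a = b"
    have "closed_in E (V - {a}) K" unfolding closed_in_def
    proof (intro conjI ballI notI)
      show "K \<subseteq> V - {a}" using assms(3) aK by auto
      fix p q assume pq: "p \<in> K" "q \<in> V - {a} - K" "{p, q} \<in> E"
      then have "{p, q} \<in> meeting E K" by (auto simp: meeting_def)
      then have "{p, q} \<subseteq> set (a # xs @ [b])" unfolding xs(4) by (rule path_edges_subset)
      then show False using pq(2) ab xs(1) by auto
    qed
    then have "K = V - {a}" using conn_closed[OF biconn_conn_del[OF basics(2)] _ assms(1)] by blast
    then have "V - K \<subseteq> {a}" by auto
    then have "card (V - K) \<le> card {a}" by (intro card_mono) auto
    then show False using assms(5) by simp
  qed
  then show thesis using that[of a b xs] xs ka(2) bV xs_ne by auto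
qed

text \<open>If all degrees are 2, there are as many edges as vertices, and
  \<open>(d - 1) n = d (n - 1)\<close> gives \<open>n = d\<close>.\<close>

lemma deg2_total:
  assumes "\<And>v. v \<in> V \<Longrightarrow> \<not> hub v"
  shows "int (card V) = d"
proof -
  have "(\<Sum>v\<in>V. card (nbs E v)) = (\<Sum>v\<in>V. 2)" by (intro sum.cong refl nonhub assms)
  then have "card E = card V" using handshake[OF basics(1)] by simp
  then show ?thesis using total by (simp add: algebra_simps)
qed

text \<open>Minimum degree 3 would give \<open>3 n \<le> 2 |E|\<close>, whereas
  \<open>(d - 1) |E| = d (n - 1)\<close>; for \<open>d \<ge> 3\<close> the two are
  incompatible.\<close>

lemma ex_nonhub:
  obtains v where "v \<in> V" "\<not> hub v"
proof -
  have "\<exists>v\<in>V. \<not> hub v"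
  proof (rule ccontr)
    assume "\<not> ?thesis"
    then have "(\<Sum>v\<in>V. 3) \<le> (\<Sum>v\<in>V. card (nbs E v))" by (intro sum_mono) (simp add: hub_def)
    then have "3 * card V \<le> 2 * card E" using handshake[OF basics(1)] by simp
    then have "(d - 1) * (3 * int (card V)) \<le> (d - 1) * (2 * int (card E))"
      using d by (intro mult_left_mono) linarith+
    also have "\<dots> = 2 * (d * (int (card V) - 1))" using total by simp
    finally have "d * int (card V) - 3 * int (card V) + 2 * d \<le> 0" by (simp add: algebra_simps)
    moreover have "0 \<le> (d - 3) * int (card V)" using d by simp
    ultimately show False using d by (simp add: algebra_simps)
  qed
  then show thesis using that by blast
qed

end

text \<open>Of the two hypotheses, the first says that no subdivision can be undone, the second that
  the balanced graphs on fewer vertices are exclusive.\<close>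

locale prime_crit = crit +
  assumes par: "\<And>x y K. x \<in> V \<Longrightarrow> y \<in> V \<Longrightarrow> x \<noteq> y \<Longrightarrow> K \<noteq> {} \<Longrightarrow> conn E K \<Longrightarrow>
      closed_in E (V - {x, y}) K \<Longrightarrow> (\<And>k. k \<in> K \<Longrightarrow> \<not> hub k) \<Longrightarrow> conn E (V - {x, y} - K)"
    and ih: "\<And>x y D. x \<in> V \<Longrightarrow> y \<in> V \<Longrightarrow> x \<noteq> y \<Longrightarrow> D \<noteq> {} \<Longrightarrow> conn E D \<Longrightarrow>
      closed_in E (V - {x, y}) D \<Longrightarrow> D \<noteq> V - {x, y} \<Longrightarrow> biconn E (D \<union> {x, y}) \<Longrightarrow>
      conn E (V - {x, y} - D)"
begin

lemma sep_not_edge: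
  assumes "closed_in E (V - {p, q}) M" "M \<noteq> {}" "M \<noteq> V - {p, q}"
  shows "{p, q} \<notin> E"
  using conn_closed[OF contr assms(1,2)] assms(3) by blast

text \<open>By \<open>par\<close> a nonempty hub-free \<open>M\<close> is a single component, hence
  the inside of a path, and \<open>p\<close> is one of the two ends; moreover \<open>{p, q}\<close>
  separates the graph and so is not an edge. If \<open>M\<close> is empty, only \<open>q\<close>
  itself can be adjacent to \<open>p\<close>.\<close>

lemma one_link:
  assumes "p \<in> V" "q \<in> V" "p \<noteq> q" "closed_in E (V - {p, q}) M" "M \<noteq> V - {p, q}"
    "\<And>k. k \<in> M \<Longrightarrow> \<not> hub k"
  obtains w where "\<And>n. n \<in> M \<union> {q} \<Longrightarrow> {p, n} \<in> E \<Longrightarrow> n = w"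
proof (cases "M = {}")
  case True then show thesis using that[of q] by simp
next
  case False
  have MV: "M \<subseteq> V - {p, q}" using assms(4) by (simp add: closed_in_def)
  have cM: "conn E M"
  proof -
    obtain a where "a \<in> M" using False by blast
    then obtain C where C: "a \<in> C" "C \<subseteq> M" "conn E C" "closed_in E (V - {p, q}) C"
      using closed_comp[OF assms(4)] MV by blast
    have "conn E (V - {p, q} - C)" using par[OF assms(1-3) _ C(3,4)] C(1,2) assms(6) by blast
    moreover have "closed_in E (V - {p, q} - C) (M - C)"
      using assms(4) unfolding closed_in_def by auto
    ultimately have "M - C = {} \<or> M - C = V - {p, q} - C" using conn_closed by metis
    then have "M = C" using C(2) MV assms(5) by auto
    then show ?thesis using C(3) by simp
  qed
  have "2 \<le> card (V - M)"
  proof -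
    have "{p, q} \<subseteq> V - M" using MV assms(1,2) by auto
    then have "card {p, q} \<le> card (V - M)" using basics(4) by (intro card_mono) auto
    then show ?thesis using assms(3) by simp
  qed
  then obtain a b xs where P: "a \<noteq> b" "a \<in> V - M" "b \<in> V - M" "set xs = M" "distinct (a # xs @ [b])"
    "xs \<noteq> []" "meeting E M = path_edges (a # xs @ [b])"
    using path_comp[OF False cM _ assms(6)] MV by (metis Diff_subset subset_trans)
  note ends = path_ends[OF P(5,6), unfolded P(4), OF P(7)]
  obtain ka kb where ka: "ka \<in> M" "{a, ka} \<in> E" "\<And>n. n \<in> M \<Longrightarrow> {a, n} \<in> E \<Longrightarrow> n = ka"
    and kb: "kb \<in> M" "{b, kb} \<in> E" "\<And>n. n \<in> M \<Longrightarrow> {b, n} \<in> E \<Longrightarrow> n = kb"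
    using ends(2,3) by blast
  have out: "z = p \<or> z = q" if "z \<in> V - M" "k \<in> M" "{z, k} \<in> E" for z k
    using closed_in_nbr[OF basics(1) assms(4) that(2) edge_sym[OF that(3)]] that(1) by auto
  have "a = p \<or> a = q" "b = p \<or> b = q" using out[OF P(2) ka(1,2)] out[OF P(3) kb(1,2)] by auto
  then have "p = a \<or> p = b" using P(1) by auto
  moreover have "{p, q} \<notin> E" using sep_not_edge[OF assms(4) False assms(5)] .
  ultimately show thesis using that[of ka] that[of kb] ka(3) kb(3) by blast
qed

end

section \<open>A smallest side containing a branch vertex\<close>

locale min_side = prime_crit +
  fixes x y :: 'a and D :: "'a set"
  assumes sd: "side x y D" and hubD: "\<exists>z\<in>D. hub z"
    and minD: "\<And>x' y' D'. side x' y' D' \<Longrightarrow> \<exists>z\<in>D'. hub z \<Longrightarrow> card D \<le> card D'"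
begin

lemma D: "x \<in> V" "y \<in> V" "x \<noteq> y" "D \<noteq> {}" "conn E D" "closed_in E (V - {x, y}) D" "D \<subseteq> V - {x, y}"
  "finite D"
  using sd basics(4) finite_subset[of D V] by (auto simp: side_def closed_in_def)

lemma D_nbr: "a \<in> D \<Longrightarrow> {a, b} \<in> E \<Longrightarrow> b \<in> D \<union> {x, y}"
  using closed_in_nbr[OF basics(1) D(6)] by blast

lemma card_D: "card D + 2 \<le> card V"
proof -
  have "card (D \<union> {x, y}) \<le> card V" using D(1,2,7) basics(4) by (intro card_mono) auto
  moreover have "card (D \<union> {x, y}) = card D + 2"
    using D(3,7,8) by (subst card_Un_disjoint) auto
  ultimately show ?thesis by simp
qed

text \<open>The component of a hub in \<open>X\<close> would be a smaller side with a hub. It is a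
  proper side, since it has fewer than \<open>card V - 2\<close> vertices.\<close>

lemma hubfree_inside:
  assumes "p \<in> V" "q \<in> V" "p \<noteq> q" "X \<subset> D" "closed_in E (V - {p, q}) X" "z \<in> X"
  shows "\<not> hub z"
proof
  assume "hub z"
  have "X \<subseteq> V" using assms(4) D(7) by auto
  then obtain C where C: "z \<in> C" "C \<subseteq> X" "conn E C" "closed_in E (V - {p, q}) C"
    using closed_comp[OF assms(5,6)] by blast
  have "card C < card D" using C(2) assms(4) D(8) by (meson psubset_card_mono subset_psubset_trans)
  moreover have "C \<noteq> V - {p, q}"
  proof
    assume "C = V - {p, q}"
    then have "card C = card V - 2" using assms(1-3) by (simp add: card_Diff_subset)
    then show False using \<open>card C < card D\<close> card_D by simp
  qed
  ultimately show False
    using minD[of p q C] C \<open>hub z\<close> assms(1-3) unfolding side_def by fastforce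
qed

text \<open>Otherwise the other vertex of the pair would cut \<open>D\<close> off from the rest of
  the graph.\<close>

lemma xD: "\<exists>n\<in>D. {x, n} \<in> E" and yD: "\<exists>n\<in>D. {y, n} \<in> E"
proof -
  have *: "\<exists>n\<in>D. {z, n} \<in> E" if z: "z \<in> V" "w \<in> V" "z \<noteq> w" "{z, w} = {x, y}" for z w
  proof (rule ccontr)
    assume no: "\<not> ?thesis"
    have zw: "z = x \<and> w = y \<or> z = y \<and> w = x" using z(4) by (auto simp: doubleton_eq_iff)
    have "closed_in E (V - {w}) D" unfolding closed_in_def
    proof (intro conjI ballI notI)
      show "D \<subseteq> V - {w}" using D(7) zw by auto
      fix a b assume ab: "a \<in> D" "b \<in> V - {w} - D" "{a, b} \<in> E"
      then have "b = z" using D_nbr[of a b] zw by auto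
      then show False using no ab edge_sym by blast
    qed
    then have "D = {}" by (rule closed_no_cut[of _ _ z]) (use z zw D(7) in auto)
    then show False using D(4) by simp
  qed
  show "\<exists>n\<in>D. {x, n} \<in> E" using *[of x y] D(1-3) by simp
  show "\<exists>n\<in>D. {y, n} \<in> E" using *[of y x] D(1-3) by (simp add: insert_commute)
qed

text \<open>Suppose that \<open>c\<close> cuts. If \<open>x\<close> and \<open>y\<close> fall into
  the same part, \<open>c\<close> is a cut vertex of the whole graph. If they are separated, the
  parts behind \<open>{x, c}\<close> and \<open>{y, c}\<close> are smaller than \<open>D\<close>,
  hence hub-free, and by \<open>one_link\<close> each gives \<open>c\<close> at most one neighbour;
  so \<open>c\<close> is not a hub either, and \<open>D\<close> contains no hub at all.\<close>

lemma no_cut_inside: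
  assumes c: "c \<in> D" and A: "closed_in (E - {{x, y}}) (D \<union> {x, y} - {c}) A" "x \<in> A"
  shows "A = D \<union> {x, y} - {c}"
proof -
  define B where "B = D \<union> {x, y} - {c} - A"
  have AF: "A \<subseteq> D \<union> {x, y} - {c}" using A(1) by (simp add: closed_in_def)
  have no: "{a, b} \<notin> E" if "a \<in> A" "b \<in> B" "{a, b} \<noteq> {x, y}" for a b
    using A(1) that unfolding closed_in_def B_def by auto
  have cxy: "c \<noteq> x" "c \<noteq> y" "c \<in> V" using c D(7) by auto
  have clB: "closed_in E (V - {w, c}) M" if M: "M \<subseteq> D - {c}" "w = x \<or> w = y"
      "\<And>a b. a \<in> M \<Longrightarrow> b \<in> D \<union> {x, y} - {c, w} - M \<Longrightarrow> {a, b} \<notin> E" for M w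
    unfolding closed_in_def
  proof (intro conjI ballI notI)
    show "M \<subseteq> V - {w, c}" using M(1,2) D(7) by auto
    fix a b assume ab: "a \<in> M" "b \<in> V - {w, c} - M" "{a, b} \<in> E"
    then have "b \<in> D \<union> {x, y}" using D_nbr[of a b] M(1) by auto
    then show False using M(3)[of a b] ab by auto
  qed
  show ?thesis
  proof (cases "y \<in> A")
    case True
    have "closed_in E (V - {c}) B" unfolding closed_in_def
    proof (intro conjI ballI notI)
      show "B \<subseteq> V - {c}" using D(1,2,7) by (auto simp: B_def)
      fix a b assume ab: "a \<in> B" "b \<in> V - {c} - B" "{a, b} \<in> E"
      have aD: "a \<in> D" using ab(1) A(2) True by (auto simp: B_def)
      then have "b \<in> A" using D_nbr[OF aD ab(3)] ab(2) by (auto simp: B_def)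
      moreover have "{b, a} \<noteq> {x, y}" using aD D(7) by (auto simp: doubleton_eq_iff)
      ultimately show False using no[of b a] ab edge_sym by blast
    qed
    then have "B = {}" by (rule closed_no_cut[of _ _ x]) (use D(1) cxy A(2) in \<open>auto simp: B_def\<close>)
    then show ?thesis using True AF by (auto simp: B_def)
  next
    case False
    have M1: "closed_in E (V - {x, c}) (A - {x})"
    proof (rule clB)
      show "A - {x} \<subseteq> D - {c}" using AF False by auto
      fix a b assume ab: "a \<in> A - {x}" "b \<in> D \<union> {x, y} - {c, x} - (A - {x})"
      then have "b \<in> B" "{a, b} \<noteq> {x, y}" using False by (auto simp: B_def doubleton_eq_iff)
      then show "{a, b} \<notin> E" using no[of a b] ab by simp
    qed simp
    have M2: "closed_in E (V - {y, c}) (B - {y})"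
    proof (rule clB)
      show "B - {y} \<subseteq> D - {c}" using A(2) by (auto simp: B_def)
      fix a b assume ab: "a \<in> B - {y}" "b \<in> D \<union> {x, y} - {c, y} - (B - {y})"
      then have "b \<in> A" "{b, a} \<noteq> {x, y}" using A(2) by (auto simp: B_def doubleton_eq_iff)
      then show "{a, b} \<notin> E" using no[of b a] ab edge_sym by blast
    qed simp
    have sub: "A - {x} \<subset> D" "B - {y} \<subset> D" using AF A(2) False c by (auto simp: B_def)
    have h1: "\<not> hub k" if "k \<in> A - {x}" for k
      using hubfree_inside[OF D(1) cxy(3) cxy(1)[symmetric] sub(1) M1 that] .
    have h2: "\<not> hub k" if "k \<in> B - {y}" for k
      using hubfree_inside[OF D(2) cxy(3) cxy(2)[symmetric] sub(2) M2 that] .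
    have "y \<in> V - {x, c} - (A - {x})" using D(2,3) cxy False by auto
    then obtain w where w: "\<And>n. n \<in> (A - {x}) \<union> {x} \<Longrightarrow> {c, n} \<in> E \<Longrightarrow> n = w"
      using one_link[OF cxy(3) D(1) cxy(1), of "A - {x}"] M1 h1 by (auto simp: insert_commute)
    have "x \<in> V - {y, c} - (B - {y})" using D(1,3) cxy A(2) by (auto simp: B_def)
    then obtain w' where w': "\<And>n. n \<in> (B - {y}) \<union> {y} \<Longrightarrow> {c, n} \<in> E \<Longrightarrow> n = w'"
      using one_link[OF cxy(3) D(2) cxy(2), of "B - {y}"] M2 h2 by (auto simp: insert_commute)
    have "nbs E c \<subseteq> {w, w'}"
    proof
      fix n assume "n \<in> nbs E c"
      then have n: "{c, n} \<in> E" by (simp add: nbs_def)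
      then have "n \<in> A \<or> n \<in> B" using D_nbr[OF c n] edge_in[OF n] by (auto simp: B_def)
      then show "n \<in> {w, w'}" using w[of n] w'[of n] n by auto
    qed
    then have "\<not> hub c" using hub_card by blast
    moreover obtain z where z: "z \<in> D" "hub z" using hubD by blast
    moreover have "z = c \<or> z \<in> A - {x} \<or> z \<in> B - {y}" using z(1) D(7) by (auto simp: B_def)
    ultimately show ?thesis using h1 h2 by blast
  qed
qed

text \<open>The edge \<open>{x, y}\<close> is removed for the sake of the degenerate side
  \<open>V - {x, y}\<close>, where it is present. On a proper side it is absent anyway.\<close>

lemma biconn_F: "biconn (E - {{x, y}}) (D \<union> {x, y})"
proof (rule biconnI)
  have "card D \<ge> 1" using D(4,8) by (simp add: Suc_le_eq card_gt_0_iff)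
  moreover have "card (D \<union> {x, y}) = card D + 2"
    using D(3,7,8) by (subst card_Un_disjoint) auto
  ultimately show "3 \<le> card (D \<union> {x, y})" by simp
next
  fix c assume c: "c \<in> D \<union> {x, y}"
  have cD: "conn (E - {{x, y}}) D"
    by (rule conn_cong[OF D(5)]) (use D(7) in \<open>auto simp: doubleton_eq_iff\<close>)
  have ins: "conn (E - {{x, y}}) (insert z D)" if z: "z = x \<or> z = y" for z
  proof -
    obtain n where n: "n \<in> D" "{z, n} \<in> E" using z xD yD by blast
    then have "{z, n} \<noteq> {x, y}" using D(7) by (auto simp: doubleton_eq_iff)
    then show ?thesis using conn_insert[OF cD n(1), of z] n by simp
  qed
  consider "c = x" | "c = y" | "c \<in> D" using c by auto
  then show "conn (E - {{x, y}}) (D \<union> {x, y} - {c})"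
  proof cases
    case 1
    then have "D \<union> {x, y} - {c} = insert y D" using D(3,7) by auto
    then show ?thesis using ins[of y] by simp
  next
    case 2
    then have "D \<union> {x, y} - {c} = insert x D" using D(3,7) by auto
    then show ?thesis using ins[of x] by simp
  next
    case 3
    show ?thesis
    proof (rule ccontr)
      assume "\<not> ?thesis"
      then obtain A where A: "closed_in (E - {{x, y}}) (D \<union> {x, y} - {c}) A" "A \<noteq> {}"
        "A \<noteq> D \<union> {x, y} - {c}" using not_conn_closed by blast
      define A' where "A' = (if x \<in> A then A else D \<union> {x, y} - {c} - A)"
      have A': "closed_in (E - {{x, y}}) (D \<union> {x, y} - {c}) A'"
        using A(1) closed_in_compl[OF A(1)] by (simp add: A'_def)
      moreover have "x \<in> A'" using 3 D(7) by (auto simp: A'_def)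
      ultimately have "A' = D \<union> {x, y} - {c}" using no_cut_inside[OF 3] by blast
      moreover have "A \<subseteq> D \<union> {x, y} - {c}" using A(1) by (simp add: closed_in_def)
      ultimately show False using A(2,3) unfolding A'_def by (auto split: if_splits)
    qed
  qed
qed

end

section \<open>The gap of a proper side and of its threads\<close>

locale proper_side = min_side +
  assumes proper: "D \<noteq> V - {x, y}"
begin

definition O' :: "'a set" where "O' = V - {x, y} - D"

definition F :: "'a set" where "F = D \<union> {x, y}"

lemma xyE: "{x, y} \<notin> E"
  using sep_not_edge[OF D(6,4) proper] .

lemma tcF: "biconn E F" "3 \<le> card F" "card F = card D + 2" "F \<subseteq> V"
proof -
  show "biconn E F" using biconn_F xyE by (simp add: F_def)
  have "card (D \<union> {x, y}) = card D + 2"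
    using D(3,7,8) by (subst card_Un_disjoint) auto
  then show "card F = card D + 2" by (simp add: F_def)
  moreover have "card D \<ge> 1" using D(4,8) by (simp add: Suc_le_eq card_gt_0_iff)
  ultimately show "3 \<le> card F" by simp
  show "F \<subseteq> V" using D(1,2,7) by (auto simp: F_def)
qed

lemma O'_ne: "O' \<noteq> {}" using proper D(7) by (auto simp: O'_def)

lemma V_parts: "V = F \<union> O'" "F \<inter> O' = {}" "V - D = O' \<union> {x, y}" "V - F = O'"
  using D(1,2,7) by (auto simp: F_def O'_def)

lemma conn_O': "conn E O'"
  using ih[OF D(1-3) D(4) D(5,6) proper] tcF(1) by (simp add: F_def O'_def)

lemma O'_nbr: "a \<in> O' \<Longrightarrow> {a, b} \<in> E \<Longrightarrow> b \<in> O' \<union> {x, y}"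
  using edge_in[of a b] D_nbr[of b a] edge_sym[of a b] by (auto simp: O'_def)

lemma xy_O': "\<exists>n\<in>O'. {x, n} \<in> E" "\<exists>n\<in>O'. {y, n} \<in> E"
proof -
  have *: "\<exists>n\<in>O'. {z, n} \<in> E" if z: "z \<in> V" "z \<noteq> w" "{z, w} = {x, y}" for z w
  proof (rule ccontr)
    assume no: "\<not> ?thesis"
    have zw: "z = x \<and> w = y \<or> z = y \<and> w = x" using z(3) by (auto simp: doubleton_eq_iff)
    have "closed_in E (V - {w}) O'" unfolding closed_in_def
    proof (intro conjI ballI notI)
      show "O' \<subseteq> V - {w}" using zw by (auto simp: O'_def)
      fix a b assume ab: "a \<in> O'" "b \<in> V - {w} - O'" "{a, b} \<in> E"
      then have "b = z" using O'_nbr[of a b] zw by auto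
      then show False using no ab edge_sym by blast
    qed
    then have "O' = {}" by (rule closed_no_cut[of _ _ z]) (use z zw in \<open>auto simp: O'_def\<close>)
    then show False using O'_ne by simp
  qed
  show "\<exists>n\<in>O'. {x, n} \<in> E" using *[of x y] D(1-3) by simp
  show "\<exists>n\<in>O'. {y, n} \<in> E" using *[of y x] D(1-3) by (simp add: insert_commute)
qed

text \<open>\<open>V - D\<close> may have cut vertices, but all of them lie in \<open>O'\<close>.
  This is what divides the arguments on threads and stars into the cases \<open>c \<in> O'\<close>
  and \<open>c \<notin> O'\<close>.\<close>

lemma conn_outside: "c \<notin> O' \<Longrightarrow> conn E (V - D - {c})"
proof -
  assume c: "c \<notin> O'"
  have x: "conn E (insert x O')" and y: "conn E (insert y O')"
    using conn_insert[OF conn_O'] xy_O' by blast+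
  obtain n where "n \<in> O'" "{x, n} \<in> E" using xy_O' by blast
  then have xy: "conn E (insert x (insert y O'))" using conn_insert[OF y, of n x] by blast
  have xyO: "x \<notin> O'" "y \<notin> O'" by (auto simp: O'_def)
  consider "c = x" | "c = y" | "c \<noteq> x" "c \<noteq> y" by blast
  then show ?thesis
  proof cases
    case 1
    then have "V - D - {c} = insert y O'" using V_parts(3) xyO D(3) by auto
    then show ?thesis using y by simp
  next
    case 2
    then have "V - D - {c} = insert x O'" using V_parts(3) xyO D(3) by auto
    then show ?thesis using x by simp
  next
    case 3
    then have "V - D - {c} = insert x (insert y O')" using V_parts(3) c by auto
    then show ?thesis using xy by simp
  qed
qed

text \<open>As \<open>{x, y}\<close> is not an edge, the edges inside \<open>F\<close> are the edges
  meeting \<open>D\<close>. If \<open>m\<close> is their number, the equation of the flat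
  \<open>F\<close> reads \<open>(d - 1) m + 1 = d (|D| + 1)\<close>, because \<open>F\<close> has
  two vertices more than \<open>D\<close>.\<close>

lemma gap_D: "gap D = d - 1"
proof -
  have "conn E (V - F)" "F \<subset> V" using conn_O' V_parts(4) O'_ne tcF(4) by auto
  then have "sum (wgt d E V) (induced E F) + 1 = d * (int (card F) - 1)"
    using balanced tcF(1) unfolding balanced_def by blast
  then have "(d - 1) * int (card (induced E F)) + 1 = d * (int (card F) - 1)"
    using sum_wgt[of "induced E F"] by (simp add: induced_def)
  moreover have "induced E F = meeting E D"
  proof (intro set_eqI iffI)
    fix e assume "e \<in> induced E F"
    then have e: "e \<in> E" "e \<subseteq> F" by (auto simp: induced_def)
    obtain a b where ab: "e = {a, b}" "a \<noteq> b" using simple_on_edge[OF basics(1) e(1)] by blast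
    have "e \<noteq> {x, y}" using e xyE by auto
    then have "a \<in> D \<or> b \<in> D" using ab e(2) by (auto simp: F_def)
    then show "e \<in> meeting E D" using e(1) ab by (auto simp: meeting_def)
  next
    fix e assume "e \<in> meeting E D"
    then obtain k where e: "e \<in> E" "k \<in> e" "k \<in> D" by (auto simp: meeting_def)
    obtain n where n: "e = {k, n}" using meeting_edge[OF basics(1) e(1,2)] by blast
    then show "e \<in> induced E F" using D_nbr[OF e(3), of n] e by (auto simp: induced_def F_def)
  qed
  ultimately show ?thesis using tcF(3) by (simp add: gap_def algebra_simps)
qed

text \<open>A component of \<open>D\<close> minus the hubs.\<close>

definition thread :: "'a set \<Rightarrow> bool" where
  "thread K \<longleftrightarrow> K \<noteq> {} \<and> K \<subseteq> D \<and> conn E K \<and> (\<forall>k\<in>K. \<not> hub k) \<and>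
     (\<forall>k\<in>K. \<forall>n. {k, n} \<in> E \<longrightarrow> n \<notin> K \<longrightarrow> hub n \<and> n \<in> D \<or> n = x \<or> n = y)"

lemma thread_ex:
  assumes "k \<in> D" "\<not> hub k"
  obtains K where "thread K" "k \<in> K"
proof -
  let ?X = "{k \<in> D. \<not> hub k}"
  have "finite ?X" "k \<in> ?X" using D(8) assms by auto
  then obtain K where K: "k \<in> K" "K \<subseteq> ?X" "conn E K" "closed_in E ?X K"
    by (rule conn_component)
  have "thread K" unfolding thread_def
  proof (intro conjI ballI allI impI)
    fix k' n assume kn: "k' \<in> K" "{k', n} \<in> E" "n \<notin> K"
    then have "n \<in> D \<union> {x, y}" using K(2) D_nbr by blast
    moreover have "\<not> (n \<in> D \<and> \<not> hub n)" using closed_inD[OF K(4) kn(1) _ kn(2)] kn(3) by auto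
    ultimately show "hub n \<and> n \<in> D \<or> n = x \<or> n = y" by auto
  qed (use K in auto)
  then show thesis using that K(1) by blast
qed

lemma threadD:
  assumes "thread K"
  shows "K \<noteq> {}" "K \<subseteq> D" "conn E K" "k \<in> K \<Longrightarrow> \<not> hub k"
    "k \<in> K \<Longrightarrow> {k, n} \<in> E \<Longrightarrow> n \<notin> K \<Longrightarrow> hub n \<and> n \<in> D \<or> n = x \<or> n = y"
  using assms unfolding thread_def by blast+

text \<open>A thread can be left only through a hub, \<open>x\<close> or \<open>y\<close>, and none
  of these belongs to any thread.\<close>

lemma thread_eq:
  assumes "thread K" "thread K'" "k \<in> K" "k \<in> K'"
  shows "K = K'"
proof -
  have *: "K \<subseteq> K'" if K: "thread K" "thread K'" "k \<in> K" "k \<in> K'" for K K'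
  proof -
    have "closed_in E K (K \<inter> K')" unfolding closed_in_def
    proof (intro conjI ballI notI)
      fix a b assume ab: "a \<in> K \<inter> K'" "b \<in> K - K \<inter> K'" "{a, b} \<in> E"
      then have "hub b \<and> b \<in> D \<or> b = x \<or> b = y" using threadD(5)[OF K(2), of a b] by auto
      then show False using ab(2) threadD(2,4)[OF K(1)] D(7) by auto
    qed simp
    then have "K \<inter> K' = K" using conn_closed[OF threadD(3)[OF K(1)]] K(3,4) by blast
    then show ?thesis by blast
  qed
  show ?thesis using *[OF assms] *[OF assms(2,1,4,3)] by simp
qed

lemma thread_ends:
  assumes "thread K"
  obtains a b ka kb where "a \<noteq> b" "a \<in> F - K" "b \<in> F - K"
    "\<forall>k\<in>K. \<forall>n. n \<notin> K \<longrightarrow> {k, n} \<in> E \<longrightarrow> n = a \<or> n = b"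
    "ka \<in> K" "{a, ka} \<in> E" "\<forall>n\<in>K. {a, n} \<in> E \<longrightarrow> n = ka"
    "kb \<in> K" "{b, kb} \<in> E" "\<forall>n\<in>K. {b, n} \<in> E \<longrightarrow> n = kb"
    "hub a \<and> a \<in> D \<or> a = x \<or> a = y" "hub b \<and> b \<in> D \<or> b = x \<or> b = y"
proof -
  note K = threadD[OF assms]
  have KV: "K \<subseteq> V" using K(2) D(7) by auto
  have "card {x, y} \<le> card (V - K)" using basics(4) D(1,2,7) K(2) by (intro card_mono) auto
  then have "2 \<le> card (V - K)" using D(3) by simp
  then obtain a b xs where P: "a \<noteq> b" "a \<in> V - K" "b \<in> V - K" "set xs = K" "distinct (a # xs @ [b])"
    "xs \<noteq> []" "meeting E K = path_edges (a # xs @ [b])"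
    using path_comp[OF K(1,3) KV K(4)] by metis
  note ends = path_ends[OF P(5,6), unfolded P(4), OF P(7)]
  obtain ka kb where ka: "ka \<in> K" "{a, ka} \<in> E" "\<forall>n\<in>K. {a, n} \<in> E \<longrightarrow> n = ka"
    and kb: "kb \<in> K" "{b, kb} \<in> E" "\<forall>n\<in>K. {b, n} \<in> E \<longrightarrow> n = kb"
    using ends(2,3) by blast
  have ea: "hub a \<and> a \<in> D \<or> a = x \<or> a = y" using K(5)[OF ka(1) edge_sym[OF ka(2)]] P(2) by simp
  have eb: "hub b \<and> b \<in> D \<or> b = x \<or> b = y" using K(5)[OF kb(1) edge_sym[OF kb(2)]] P(3) by simp
  have "a \<in> F - K" "b \<in> F - K" using ea eb P(2,3) by (auto simp: F_def)
  then show thesis using that[of a b ka kb] P(1) ends(1) ka kb ea eb by blast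
qed

text \<open>\<open>B\<close> together with \<open>K\<close> is a union of components behind
  \<open>{c, a}\<close>. If it is smaller than \<open>D\<close>, minimality makes it hub-free,
  although the end \<open>b\<close> of the thread lies in \<open>D\<close> and so is a hub. If it is
  all of \<open>D\<close>, then \<open>a\<close> and \<open>c\<close> are \<open>x\<close> and
  \<open>y\<close>, and \<open>a\<close> has no neighbour but \<open>ka\<close> in the 2-connected
  set \<open>F\<close>.\<close>

lemma thread_no_split_inside:
  assumes K: "thread K" and ab: "a \<noteq> b" "a \<in> F - K" "b \<in> F - K"
    and nbr: "\<forall>k\<in>K. \<forall>n. n \<notin> K \<longrightarrow> {k, n} \<in> E \<longrightarrow> n = a \<or> n = b"
    and ka: "\<forall>n\<in>K. {a, n} \<in> E \<longrightarrow> n = ka"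
    and ends: "hub a \<and> a \<in> D \<or> a = x \<or> a = y" "hub b \<and> b \<in> D \<or> b = x \<or> b = y"
    and c: "c \<notin> O'" "c \<in> V - K"
    and B: "B \<subseteq> V - K - {c}" "b \<in> B" "a \<notin> B" "a \<noteq> c" "B \<subseteq> D"
    and no: "\<forall>p\<in>B. \<forall>q\<in>V - K - {c} - B. {p, q} \<notin> E"
  shows False
proof -
  have KD: "K \<subseteq> D" using threadD[OF K] by simp
  define X where "X = B \<union> K"
  have XD: "X \<subseteq> D" using B(5) KD by (simp add: X_def)
  have aV: "a \<in> V" using ab(2) tcF(4) by auto
  have clX: "closed_in E (V - {c, a}) X" unfolding closed_in_def
  proof (intro conjI ballI notI)
    show "X \<subseteq> V - {c, a}" using B(1,3) c(2) ab(2) XD D(7) by (auto simp: X_def)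
    fix p q assume pq: "p \<in> X" "q \<in> V - {c, a} - X" "{p, q} \<in> E"
    show False
    proof (cases "p \<in> B")
      case True then show ?thesis using no pq by (auto simp: X_def)
    next
      case False
      then have "p \<in> K" using pq(1) by (simp add: X_def)
      then have "q = a \<or> q = b" using nbr pq by (auto simp: X_def)
      then show ?thesis using pq(2) B(2) by (auto simp: X_def)
    qed
  qed
  show False
  proof (cases "X = D")
    case False
    then have "X \<subset> D" using XD by auto
    then have "\<not> hub b" using hubfree_inside[OF _ aV _ _ clX, of b] c(2) B(2,4) by (auto simp: X_def)
    moreover have "b \<in> D" using B(2,5) by auto
    ultimately show False using ends(2) D(7) by auto
  next
    case True
    have aD: "a \<notin> D" using clX True by (auto simp: closed_in_def)
    have cD: "c \<notin> D" using clX True by (auto simp: closed_in_def)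
    have axy: "a = x \<or> a = y" using ends(1) aD by auto
    have cxy: "c = x \<or> c = y" using c cD V_parts(1) by (auto simp: F_def)
    obtain n m where nm: "n \<in> F" "m \<in> F" "n \<noteq> m" "{a, n} \<in> E" "{a, m} \<in> E"
      using biconn_two_nbrs[OF tcF(1,2), of a] ab(2) by blast
    have "n = ka" if n: "n \<in> F" "{a, n} \<in> E" for n
    proof -
      have "n \<noteq> a" using edge_in[OF n(2)] by auto
      have "{a, c} = {x, y}" using axy cxy B(4) by auto
      then have "n \<noteq> c" using n(2) xyE by metis
      have "n \<in> D" using n(1) \<open>n \<noteq> a\<close> \<open>n \<noteq> c\<close> axy cxy B(4) by (auto simp: F_def)
      moreover have "n \<notin> B"
        using no edge_sym[OF n(2)] aV ab(2) B(3,4) by auto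
      ultimately have "n \<in> K" using True by (auto simp: X_def)
      then show ?thesis using ka n(2) by simp
    qed
    then show False using nm by metis
  qed
qed

text \<open>Since \<open>c\<close> is outside \<open>F\<close>, the set
  \<open>B \<inter> F - {b}\<close> can be left within \<open>F - {b}\<close> only through
  \<open>K\<close>, hence only from \<open>a\<close>, which is not in \<open>B\<close>. As
  \<open>F - {b}\<close> is connected and contains \<open>a\<close>, the set is empty.\<close>

lemma thread_no_split_outside:
  assumes K: "thread K" and ab: "a \<noteq> b" "a \<in> F - K" "b \<in> F - K"
    and nbr: "\<forall>k\<in>K. \<forall>n. n \<notin> K \<longrightarrow> {k, n} \<in> E \<longrightarrow> n = a \<or> n = b"
    and c: "c \<in> O'"
    and B: "B \<subseteq> V - K - {c}" "b \<in> B" "a \<notin> B"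
    and no: "\<forall>p\<in>B. \<forall>q\<in>V - K - {c} - B. {p, q} \<notin> E"
  shows "B \<inter> F = {b}"
proof -
  have cF: "c \<notin> F" using c V_parts(2) by auto
  have "closed_in E (F - {b}) (B \<inter> F - {b})" unfolding closed_in_def
  proof (intro conjI ballI notI)
    fix p q assume pq: "p \<in> B \<inter> F - {b}" "q \<in> F - {b} - (B \<inter> F - {b})" "{p, q} \<in> E"
    show False
    proof (cases "q \<in> K")
      case True
      have "p \<notin> K" using pq(1) B(1) by auto
      then have "p = a \<or> p = b" using nbr True edge_sym[OF pq(3)] by simp
      then show ?thesis using pq(1) B(3) by auto
    next
      case False
      have "q \<in> V - K - {c} - B" using pq(2) False cF tcF(4) by auto
      then show ?thesis using no pq by auto
    qed
  qed auto
  moreover have "a \<in> F - {b}" "a \<notin> B \<inter> F - {b}" using ab B(3) by auto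
  ultimately have "B \<inter> F - {b} = {}"
    using conn_closed[OF biconn_conn_del[OF tcF(1)], of b "B \<inter> F - {b}"] by metis
  then show ?thesis using B(2) ab(3) by auto
qed

text \<open>It suffices that \<open>V - K\<close> is 2-connected. A cut vertex \<open>c\<close> must
  separate the ends \<open>a\<close> and \<open>b\<close> of the thread, since otherwise it would
  cut \<open>V\<close>. If \<open>c \<notin> O'\<close>, one part lies inside \<open>D\<close>. If
  \<open>c \<in> O'\<close>, each part meets \<open>F\<close> in a single end, so \<open>F\<close>
  would be the bare path, in which \<open>a\<close> has only one neighbour.\<close>

lemma gap_thread:
  assumes K: "thread K"
  shows "gap K = 1"
proof -
  note KD = threadD[OF K]
  have KV: "K \<subseteq> V" "K \<subseteq> F" using KD(2) D(7) by (auto simp: F_def)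
  obtain a b ka kb where ab: "a \<noteq> b" "a \<in> F - K" "b \<in> F - K"
    and nbr: "\<forall>k\<in>K. \<forall>n. n \<notin> K \<longrightarrow> {k, n} \<in> E \<longrightarrow> n = a \<or> n = b"
    and ka: "ka \<in> K" "{a, ka} \<in> E" "\<forall>n\<in>K. {a, n} \<in> E \<longrightarrow> n = ka"
    and kb: "kb \<in> K" "{b, kb} \<in> E" "\<forall>n\<in>K. {b, n} \<in> E \<longrightarrow> n = kb"
    and ends: "hub a \<and> a \<in> D \<or> a = x \<or> a = y" "hub b \<and> b \<in> D \<or> b = x \<or> b = y"
    using thread_ends[OF K] by blast
  have nbr': "\<forall>k\<in>K. \<forall>n. n \<notin> K \<longrightarrow> {k, n} \<in> E \<longrightarrow> n = b \<or> n = a" using nbr by blast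
  obtain w where w: "w \<in> O'" using O'_ne by blast
  have "3 \<le> card (V - K)"
  proof -
    have "{w, x, y} \<subseteq> V - K" using w D(1,2,7) KD(2) by (auto simp: O'_def)
    then have "card {w, x, y} \<le> card (V - K)" using basics(4) by (intro card_mono) auto
    moreover have "card {w, x, y} = 3" using w D(3) by (auto simp: O'_def)
    ultimately show ?thesis by simp
  qed
  then have "biconn E (V - K)"
  proof (rule biconnI)
    fix c assume c: "c \<in> V - K"
    show "conn E (V - K - {c})"
    proof (rule ccontr)
      assume "\<not> ?thesis"
      then obtain A where A: "closed_in E (V - K - {c}) A" "A \<noteq> {}" "A \<noteq> V - K - {c}"
        using not_conn_closed by blast
      define B where "B = V - K - {c} - A"
      have AV: "A \<subseteq> V - K - {c}" using A(1) by (simp add: closed_in_def)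
      have B: "closed_in E (V - K - {c}) B" "B \<noteq> {}" "A = V - K - {c} - B" "B \<subseteq> V - K - {c}"
        using closed_in_compl[OF A(1)] A(3) AV by (auto simp: B_def)
      have meets: "a \<in> C \<or> b \<in> C" if C: "closed_in E (V - K - {c}) C" "C \<noteq> {}" for C
      proof (rule ccontr)
        assume n: "\<not> ?thesis"
        have CV: "C \<subseteq> V - K - {c}" using C(1) by (simp add: closed_in_def)
        have "closed_in E (V - {c}) C" unfolding closed_in_def
        proof (intro conjI ballI notI)
          show "C \<subseteq> V - {c}" using CV by auto
          fix p q assume pq: "p \<in> C" "q \<in> V - {c} - C" "{p, q} \<in> E"
          have "q \<notin> K"
          proof
            assume "q \<in> K"
            then have "p = a \<or> p = b" using nbr edge_sym[OF pq(3)] pq(1) CV by auto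
            then show False using n pq(1) by auto
          qed
          then show False using closed_inD[OF C(1) pq(1) _ pq(3)] pq(2) by auto
        qed
        then have "C = {}" by (rule closed_no_cut[of _ _ ka]) (use ka(1) KV c CV in auto)
        then show False using C(2) by simp
      qed
      have noA: "\<forall>p\<in>A. \<forall>q\<in>V - K - {c} - A. {p, q} \<notin> E"
        and noB: "\<forall>p\<in>B. \<forall>q\<in>V - K - {c} - B. {p, q} \<notin> E"
        using A(1) B(1) unfolding closed_in_def by blast+
      have AB: "A \<inter> B = {}" "A \<union> B = V - K - {c}" using AV by (auto simp: B_def)
      have cases: "(a \<in> A \<and> b \<in> B) \<or> (b \<in> A \<and> a \<in> B)"
        using meets[OF A(1,2)] meets[OF B(1,2)] AB(1) by auto
      then have abc: "a \<noteq> c" "b \<noteq> c" using AV B(4) by auto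
      show False
      proof (cases "c \<in> O'")
        case False
        have sub: "V - D - {c} \<subseteq> A \<union> B" using AB(2) KD(2) by auto
        have "V - D - {c} \<subseteq> A \<or> V - D - {c} \<subseteq> B"
          by (rule conn_one_side[OF conn_outside[OF False] sub AB(1)]) (use noA AB in auto)
        then consider "B \<subseteq> D" | "A \<subseteq> D" using AB B(4) AV by blast
        then show False
        proof cases
          case 1
          show False using cases
          proof
            assume "a \<in> A \<and> b \<in> B"
            then show False
              using thread_no_split_inside[OF K ab nbr ka(3) ends False c B(4) _ _ abc(1) 1 noB] AB(1) by auto
          next
            assume "b \<in> A \<and> a \<in> B"
            then show False
              using thread_no_split_inside[OF K ab(1)[symmetric] ab(3,2) nbr' kb(3) ends(2,1) False c
                  B(4) _ _ abc(2) 1 noB] AB(1) by auto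
          qed
        next
          case 2
          show False using cases
          proof
            assume "b \<in> A \<and> a \<in> B"
            then show False
              using thread_no_split_inside[OF K ab nbr ka(3) ends False c AV _ _ abc(1) 2 noA] AB(1) by auto
          next
            assume "a \<in> A \<and> b \<in> B"
            then show False
              using thread_no_split_inside[OF K ab(1)[symmetric] ab(3,2) nbr' kb(3) ends(2,1) False c
                  AV _ _ abc(2) 2 noA] AB(1) by auto
          qed
        qed
      next
        case True
        have cF: "c \<notin> F" using True V_parts(2) by auto
        have "(A \<union> B) \<inter> F = {a, b}" using cases
        proof
          assume 1: "a \<in> A \<and> b \<in> B"
          then have "B \<inter> F = {b}" using thread_no_split_outside[OF K ab nbr True B(4) _ _ noB] AB(1) by auto
          moreover have "A \<inter> F = {a}"
            using thread_no_split_outside[OF K ab(1)[symmetric] ab(3,2) nbr' True AV _ _ noA] 1 AB(1) by auto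
          ultimately show ?thesis by auto
        next
          assume 1: "b \<in> A \<and> a \<in> B"
          then have "A \<inter> F = {b}" using thread_no_split_outside[OF K ab nbr True AV _ _ noA] AB(1) by auto
          moreover have "B \<inter> F = {a}"
            using thread_no_split_outside[OF K ab(1)[symmetric] ab(3,2) nbr' True B(4) _ _ noB] 1 AB(1) by auto
          ultimately show ?thesis by auto
        qed
        then have FK: "F \<subseteq> K \<union> {a, b}" using AB(2) cF tcF(4) by blast
        have "{a, b} \<notin> E" using cases
        proof
          assume "a \<in> A \<and> b \<in> B" then show ?thesis using noA AB by auto
        next
          assume "b \<in> A \<and> a \<in> B" then show ?thesis using noB AB by auto
        qed
        then have one: "n = ka" if "n \<in> F" "{a, n} \<in> E" for n
          using that FK ka(3) edge_in[OF that(2)] by auto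
        obtain n m where "n \<in> F" "m \<in> F" "n \<noteq> m" "{a, n} \<in> E" "{a, m} \<in> E"
          using biconn_two_nbrs[OF tcF(1,2), of a] ab(2) by blast
        then show False using one by metis
      qed
    qed
  qed
  then show ?thesis using gap_removable[OF KV(1) KD(1,3)] by simp
qed

end

section \<open>Stars around branch vertices, and the bound on the gap\<close>

context proper_side begin

definition star :: "'a \<Rightarrow> 'a set" where
  "star z = insert z (\<Union>{K. thread K \<and> (\<exists>k\<in>K. {z, k} \<in> E)})"

lemma in_starE:
  assumes "t \<in> star z" "t \<noteq> z"
  obtains K k where "thread K" "t \<in> K" "k \<in> K" "{z, k} \<in> E"
  using assms unfolding star_def by blast

lemma thread_in_star: "thread K \<Longrightarrow> k \<in> K \<Longrightarrow> {z, k} \<in> E \<Longrightarrow> K \<subseteq> star z"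
  unfolding star_def by blast

lemma star_D: "z \<in> D \<Longrightarrow> star z \<subseteq> D"
  using threadD(2) unfolding star_def by blast

lemma hub_in_star: "t \<in> star z \<Longrightarrow> hub t \<Longrightarrow> t = z"
  using threadD(4) by (metis in_starE)

lemma thread_disjoint_star:
  assumes "thread K" "hub z"
  shows "K \<subseteq> star z \<or> K \<inter> star z = {}"
proof (cases "K \<inter> star z = {}")
  case False
  then obtain t where t: "t \<in> K" "t \<in> star z" by blast
  then have "t \<noteq> z" using threadD(4)[OF assms(1)] assms(2) by blast
  then obtain K' k where K': "thread K'" "t \<in> K'" "k \<in> K'" "{z, k} \<in> E" using in_starE[OF t(2)] by blast
  then have "K = K'" using thread_eq[OF assms(1)] t(1) by blast
  then show ?thesis using thread_in_star K' by blast
qed simp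

lemma conn_star: "conn E (star z)"
proof -
  let ?K = "{K. thread K \<and> (\<exists>k\<in>K. {z, k} \<in> E)}"
  have "conn E (\<Union>K\<in>insert {} ?K. insert z K)"
  proof (rule conn_UN[where p = z])
    fix K assume "K \<in> insert {} ?K"
    then consider "K = {}" | k where "thread K" "k \<in> K" "{z, k} \<in> E" by blast
    then show "conn E (insert z K)"
    proof cases
      case 2 then show ?thesis using conn_insert[OF threadD(3)] by blast
    qed simp
  qed simp
  moreover have "(\<Union>K\<in>insert {} ?K. insert z K) = star z" by (auto simp: star_def)
  ultimately show ?thesis by simp
qed

text \<open>A thread hanging off \<open>z\<close> has only one other end, so it may be moved to the part of that end.\<close>

lemma thread_other_end:
  assumes "thread K" "k \<in> K" "{z, k} \<in> E" "z \<notin> K" "k' \<in> K" "{w, k'} \<in> E" "w \<notin> K" "w \<noteq> z"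
    "t \<in> K" "{t, n} \<in> E" "n \<notin> K"
  shows "n = z \<or> n = w"
proof -
  obtain a b where e: "\<forall>k\<in>K. \<forall>n. n \<notin> K \<longrightarrow> {k, n} \<in> E \<longrightarrow> n = a \<or> n = b"
    using thread_ends[OF assms(1)] by metis
  have "z = a \<or> z = b" using e assms(2,4) edge_sym[OF assms(3)] by blast
  moreover have "w = a \<or> w = b" using e assms(5,7) edge_sym[OF assms(6)] by blast
  moreover have "n = a \<or> n = b" using e assms(9-11) by blast
  ultimately show ?thesis using assms(8) by auto
qed

text \<open>A hub-free \<open>B\<close> would be cut off by \<open>c\<close> alone, since a vertex
  of degree 2 next to the star lies on a thread of the star. If \<open>B\<close> contains a hub,
  adding the threads that link \<open>B\<close> to \<open>z\<close> gives a union of components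
  behind \<open>{z, c}\<close> that misses \<open>z\<close>, contrary to the minimality of
  \<open>D\<close>.\<close>

lemma star_no_part_inside:
  assumes z: "z \<in> D" "hub z" and c: "c \<in> V - star z"
    and B: "B \<subseteq> D" "B \<subseteq> V - star z - {c}" "B \<noteq> {}" and no: "closed_in E (V - star z - {c}) B"
  shows False
proof -
  have zs: "z \<in> star z" by (simp add: star_def)
  have zc: "z \<noteq> c" "z \<notin> B" using c B(2) zs by auto
  have "\<exists>h\<in>B. hub h"
  proof (rule ccontr)
    assume nh: "\<not> ?thesis"
    have "closed_in E (V - {c}) B" unfolding closed_in_def
    proof (intro conjI ballI notI)
      show "B \<subseteq> V - {c}" using B(2) by auto
      fix t n assume tn: "t \<in> B" "n \<in> V - {c} - B" "{t, n} \<in> E"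
      have ns: "n \<in> star z"
        using closed_inD[OF no tn(1) _ tn(3)] tn(2) by blast
      have tD: "t \<in> D" "\<not> hub t" using tn(1) B(1) nh by auto
      obtain K where K: "thread K" "t \<in> K" using thread_ex[OF tD] by blast
      have "K \<subseteq> star z"
      proof (cases "n = z")
        case True
        then show ?thesis using thread_in_star[OF K] edge_sym[OF tn(3)] by blast
      next
        case False
        then obtain K' k where K': "thread K'" "n \<in> K'" "k \<in> K'" "{z, k} \<in> E" using in_starE[OF ns] by blast
        have "t \<in> K'"
        proof (rule ccontr)
          assume "t \<notin> K'"
          then have "hub t \<and> t \<in> D \<or> t = x \<or> t = y"
            using threadD(5)[OF K'(1,2) edge_sym[OF tn(3)]] by simp
          then show False using tD D(7) by auto
        qed
        then show ?thesis using thread_eq[OF K'(1) K(1) _ K(2)] thread_in_star[OF K'(1,3,4)] by blast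
      qed
      then show False using K(2) tn(1) B(2) by blast
    qed
    then have "B = {}" by (rule closed_no_cut[of _ _ z]) (use zc z D(7) in auto)
    then show False using B(3) by simp
  qed
  then obtain h where h: "h \<in> B" "hub h" by blast
  define X where "X = B \<union> \<Union>{K. thread K \<and> (\<exists>k\<in>K. {z, k} \<in> E) \<and> (\<exists>k\<in>K. \<exists>w\<in>B. {w, k} \<in> E)}"
  have zK: "z \<notin> K" if "thread K" for K using threadD(4)[OF that] z(2) by blast
  have XD: "X \<subseteq> D - {z}" using B(1) zc(2) threadD(2) zK by (fastforce simp: X_def)
  have cX: "c \<notin> X"
  proof
    assume "c \<in> X"
    then obtain K k where "thread K" "c \<in> K" "k \<in> K" "{z, k} \<in> E" using B(2) by (auto simp: X_def)
    then have "c \<in> star z" using thread_in_star by blast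
    then show False using c by simp
  qed
  have "closed_in E (V - {z, c}) X" unfolding closed_in_def
  proof (intro conjI ballI notI)
    show "X \<subseteq> V - {z, c}" using XD cX D(7) by auto
    fix t n assume tn: "t \<in> X" "n \<in> V - {z, c} - X" "{t, n} \<in> E"
    show False
    proof (cases "t \<in> B")
      case True
      have "n \<in> star z"
        using closed_inD[OF no True _ tn(3)] tn(2) by (auto simp: X_def)
      then obtain K k where K: "thread K" "n \<in> K" "k \<in> K" "{z, k} \<in> E"
        using in_starE[of n z] tn(2) by blast
      then have "n \<in> X" using True tn(3) unfolding X_def by blast
      then show False using tn(2) by simp
    next
      case False
      then obtain K k k' w where K: "thread K" "t \<in> K" "k \<in> K" "{z, k} \<in> E" "k' \<in> K" "w \<in> B" "{w, k'} \<in> E"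
        using tn(1) unfolding X_def by blast
      have KX: "K \<subseteq> X" using K unfolding X_def by blast
      have "K \<inter> B = {}" using thread_in_star[OF K(1,3,4)] B(2) by blast
      then have "n = z \<or> n = w"
        using thread_other_end[OF K(1,3,4) zK[OF K(1)] K(5,7) _ _ K(2) tn(3)] K(6) KX tn(2) zc(2) by blast
      then show False using tn(2) K(6) by (auto simp: X_def)
    qed
  qed
  moreover have "X \<subset> D" using XD z(1) by auto
  moreover have "h \<in> X" using h(1) by (simp add: X_def)
  ultimately show False
    using hubfree_inside[of z c X h] z(1) D(7) c zc(1) h(2) by blast
qed

text \<open>A union of components of \<open>F - star z\<close>, enlarged by the threads that link it
  to \<open>z\<close>, is closed in the connected set \<open>F - {z}\<close> and therefore exhausts
  it.\<close>

lemma conn_F_star: 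
  assumes z: "z \<in> D" "hub z" shows "conn E (F - star z)"
proof (rule ccontr)
  assume "\<not> ?thesis"
  then obtain P where P: "closed_in E (F - star z) P" "P \<noteq> {}" "P \<noteq> F - star z"
    using not_conn_closed by blast
  have zs: "z \<in> star z" by (simp add: star_def)
  have PF: "P \<subseteq> F - star z" using P(1) by (simp add: closed_in_def)
  define X where "X = P \<union> \<Union>{K. thread K \<and> (\<exists>k\<in>K. {z, k} \<in> E) \<and> (\<exists>k\<in>K. \<exists>w\<in>P. {w, k} \<in> E)}"
  have zK: "z \<notin> K" if "thread K" for K using threadD(4)[OF that] z(2) by blast
  have "closed_in E (F - {z}) X" unfolding closed_in_def
  proof (intro conjI ballI notI)
    show "X \<subseteq> F - {z}" using PF zs zK threadD(2) by (fastforce simp: X_def F_def)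
    fix t n assume tn: "t \<in> X" "n \<in> F - {z} - X" "{t, n} \<in> E"
    show False
    proof (cases "t \<in> P")
      case True
      have "n \<in> star z"
        using closed_inD[OF P(1) True _ tn(3)] tn(2) by (auto simp: X_def)
      then obtain K k where K: "thread K" "n \<in> K" "k \<in> K" "{z, k} \<in> E"
        using in_starE[of n z] tn(2) by blast
      then have "n \<in> X" using True tn(3) unfolding X_def by blast
      then show False using tn(2) by simp
    next
      case False
      then obtain K k k' w where K: "thread K" "t \<in> K" "k \<in> K" "{z, k} \<in> E" "k' \<in> K" "w \<in> P" "{w, k'} \<in> E"
        using tn(1) unfolding X_def by blast
      have KX: "K \<subseteq> X" using K unfolding X_def by blast
      have "K \<inter> P = {}" using thread_in_star[OF K(1,3,4)] PF by blast
      then have "n = z \<or> n = w"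
        using thread_other_end[OF K(1,3,4) zK[OF K(1)] K(5,7) _ _ K(2) tn(3)] K(6) KX tn(2) PF zs by blast
      then show False using tn(2) K(6) by (auto simp: X_def)
    qed
  qed
  moreover have "X \<noteq> {}" using P(2) by (auto simp: X_def)
  ultimately have X: "X = F - {z}" using conn_closed[OF biconn_conn_del[OF tcF(1)]] by blast
  obtain q where q: "q \<in> F - star z" "q \<notin> P" using P(3) PF by blast
  then have "q \<in> X" using X zs by auto
  then obtain K k where "thread K" "q \<in> K" "k \<in> K" "{z, k} \<in> E" using q(2) unfolding X_def by blast
  then have "q \<in> star z" using thread_in_star by blast
  then show False using q(1) by simp
qed

text \<open>The case distinction is that of \<open>gap_thread\<close>. If
  \<open>c \<notin> O'\<close>, one part lies inside \<open>D\<close>. If \<open>c \<in> O'\<close>,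
  the connected set \<open>F - star z\<close> lies in one part, and the other part is cut off in
  \<open>V\<close> by \<open>c\<close> alone.\<close>

lemma gap_star: 
  assumes z: "z \<in> D" "hub z" shows "gap (star z) = 1"
proof -
  have sD: "star z \<subseteq> D" using star_D z(1) .
  have zs: "z \<in> star z" by (simp add: star_def)
  obtain w where w: "w \<in> O'" using O'_ne by blast
  have "3 \<le> card (V - star z)"
  proof -
    have "{w, x, y} \<subseteq> V - star z" using w D(1,2,7) sD by (auto simp: O'_def)
    then have "card {w, x, y} \<le> card (V - star z)" using basics(4) by (intro card_mono) auto
    moreover have "card {w, x, y} = 3" using w D(3) by (auto simp: O'_def)
    ultimately show ?thesis by simp
  qed
  then have "biconn E (V - star z)"
  proof (rule biconnI)
    fix c assume c: "c \<in> V - star z"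
    show "conn E (V - star z - {c})"
    proof (rule ccontr)
      assume "\<not> ?thesis"
      then obtain A where A: "closed_in E (V - star z - {c}) A" "A \<noteq> {}" "A \<noteq> V - star z - {c}"
        using not_conn_closed by blast
      define B where "B = V - star z - {c} - A"
      have AV: "A \<subseteq> V - star z - {c}" using A(1) by (simp add: closed_in_def)
      have B: "closed_in E (V - star z - {c}) B" "B \<noteq> {}" "B \<subseteq> V - star z - {c}"
        using closed_in_compl[OF A(1)] A(3) AV by (auto simp: B_def)
      have AB: "A \<inter> B = {}" "A \<union> B = V - star z - {c}" using AV by (auto simp: B_def)
      have noAB: "\<And>a b. a \<in> A \<Longrightarrow> b \<in> B \<Longrightarrow> {a, b} \<notin> E"
        using A(1) unfolding closed_in_def B_def by blast
      show False
      proof (cases "c \<in> O'")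
        case False
        have sub: "V - D - {c} \<subseteq> A \<union> B" using AB(2) sD by auto
        have "V - D - {c} \<subseteq> A \<or> V - D - {c} \<subseteq> B"
          by (rule conn_one_side[OF conn_outside[OF False] sub AB(1)]) (rule noAB)
        then have "B \<subseteq> D \<or> A \<subseteq> D" using AB B(3) AV by blast
        then show False
          using star_no_part_inside[OF z c _ B(3,2,1)] star_no_part_inside[OF z c _ AV A(2,1)] by blast
      next
        case True
        have cF: "c \<notin> F" using True V_parts(2) by auto
        have sub: "F - star z \<subseteq> A \<union> B" using AB(2) cF tcF(4) by auto
        have "F - star z \<subseteq> A \<or> F - star z \<subseteq> B"
          by (rule conn_one_side[OF conn_F_star[OF z] sub AB(1)]) (rule noAB)
        moreover have False if C: "closed_in E (V - star z - {c}) C" "C \<noteq> {}" "C \<inter> F = {}" for C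
        proof -
          have CV: "C \<subseteq> V - star z - {c}" using C(1) by (simp add: closed_in_def)
          have "closed_in E (V - {c}) C" unfolding closed_in_def
          proof (intro conjI ballI notI)
            show "C \<subseteq> V - {c}" using CV by auto
            fix p q assume pq: "p \<in> C" "q \<in> V - {c} - C" "{p, q} \<in> E"
            have "q \<notin> D" using D_nbr[of q p] edge_sym[OF pq(3)] C(3) pq(1) by (auto simp: F_def)
            then have "q \<notin> star z" using sD by auto
            then show False using closed_inD[OF C(1) pq(1) _ pq(3)] pq(2) by auto
          qed
          then have "C = {}" by (rule closed_no_cut[of _ _ z]) (use zs c CV z D(7) in auto)
          then show False using C(2) by simp
        qed
        ultimately show False using A(1,2) B(1,2,3) AV AB(1) by blast
      qed
    qed
  qed
  moreover have "star z \<subseteq> V" "star z \<noteq> {}" using sD D(7) zs by auto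
  ultimately show ?thesis using gap_removable conn_star by blast
qed

text \<open>The correction term counts the edges that meet both sets. Such an edge may join
  \<open>T\<close> to \<open>S\<close> without meeting \<open>T \<inter> S\<close>, so the term can
  exceed \<open>gap (T \<inter> S)\<close>.\<close>

lemma gap_Un:
  assumes "finite T" "finite S"
  shows "gap (T \<union> S) = gap T + gap S -
    ((d - 1) * int (card (meeting E T \<inter> meeting E S)) - d * int (card (T \<inter> S)))"
proof -
  have m: "meeting E (T \<union> S) = meeting E T \<union> meeting E S" by (auto simp: meeting_def)
  have fin: "finite (meeting E T)" "finite (meeting E S)" using basics(5) by (auto simp: meeting_def)
  have "int (card (meeting E T)) + int (card (meeting E S)) =
     int (card (meeting E (T \<union> S))) + int (card (meeting E T \<inter> meeting E S))"
    unfolding m using card_Un_Int[OF fin] by simp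
  then have 1: "int (card (meeting E (T \<union> S))) =
     int (card (meeting E T)) + int (card (meeting E S)) - int (card (meeting E T \<inter> meeting E S))" by simp
  have 2: "int (card (T \<union> S)) = int (card T) + int (card S) - int (card (T \<inter> S))"
    using card_Un_Int[OF assms] by simp
  show ?thesis unfolding gap_def 1 2 by (simp add: algebra_simps)
qed

text \<open>Distinct threads are disjoint and no edge joins them, so the correction term of
  \<open>gap_Un\<close> vanishes and the gaps add up.\<close>

lemma gap_threads:
  assumes "finite \<K>" "\<And>K. K \<in> \<K> \<Longrightarrow> thread K"
  shows "gap (\<Union>\<K>) = int (card \<K>)"
  using assms
proof (induction \<K> rule: finite_induct)
  case empty then show ?case by (simp add: gap_def meeting_def)
next
  case (insert K \<K>)
  have "\<Union>\<K> \<subseteq> D" "K \<subseteq> D" using insert.prems threadD(2) by auto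
  then have fin: "finite K" "finite (\<Union>\<K>)" using finite_subset[OF _ D(8)] by simp_all
  have K: "thread K" and \<K>: "\<And>K'. K' \<in> \<K> \<Longrightarrow> thread K'" using insert by auto
  have disj: "K \<inter> K' = {}" if "K' \<in> \<K>" for K'
    using thread_eq[OF K \<K>[OF that]] that insert.hyps(2) by blast
  have "meeting E K \<inter> meeting E (\<Union>\<K>) = {}"
  proof (rule equals0I)
    fix e assume e: "e \<in> meeting E K \<inter> meeting E (\<Union>\<K>)"
    then obtain k where k: "e \<in> E" "k \<in> e" "k \<in> K" by (auto simp: meeting_def)
    obtain n where n: "e = {k, n}" using meeting_edge[OF basics(1) k(1,2)] by blast
    obtain K' k' where k': "K' \<in> \<K>" "k' \<in> K'" "k' \<in> e" using e by (auto simp: meeting_def)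
    have "k' \<notin> K" using disj[OF k'(1)] k'(2) by blast
    then have "k' = n" using k'(3) n k(3) by auto
    then have "hub k' \<and> k' \<in> D \<or> k' = x \<or> k' = y"
      using threadD(5)[OF K k(3), of n] k(1) n \<open>k' \<notin> K\<close> by simp
    then show False using threadD(2,4)[OF \<K>[OF k'(1)]] k'(2) D(7) by auto
  qed
  moreover have "K \<inter> \<Union>\<K> = {}" using disj by blast
  ultimately have "gap (K \<union> \<Union>\<K>) = gap K + gap (\<Union>\<K>)" using gap_Un[OF fin] by simp
  then show ?case using gap_thread[OF K] insert by simp
qed

lemma contradiction: False
proof -
  \<comment> \<open>Sets saturated with respect to threads and stars. A largest one turns out to be
    \<open>D\<close>, which gives \<open>gap D \<le> 1\<close> against the value
    \<open>d - 1 \<ge> 2\<close>.\<close>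
  define good where "good T \<longleftrightarrow> T \<noteq> {} \<and> T \<subseteq> D \<and> (\<forall>K. thread K \<longrightarrow> K \<subseteq> T \<or> K \<inter> T = {}) \<and>
    (\<forall>z\<in>T. hub z \<longrightarrow> star z \<subseteq> T) \<and> gap T \<le> 1" for T
  obtain z where z: "z \<in> D" "hub z" using hubD by blast
  have "good (star z)" unfolding good_def
  proof (intro conjI ballI allI impI)
    show "star z \<noteq> {}" by (simp add: star_def)
    show "star z' \<subseteq> star z" if "z' \<in> star z" "hub z'" for z' using hub_in_star[OF that] by simp
  qed (use star_D[OF z(1)] thread_disjoint_star[OF _ z(2)] gap_star[OF z] in simp_all)
  moreover have "\<And>T. good T \<Longrightarrow> card T < Suc (card D)"
    using D(8) by (simp add: good_def card_mono less_Suc_eq_le)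
  ultimately have "\<exists>T. good T \<and> (\<forall>T'. good T' \<longrightarrow> card T' \<le> card T)"
    by (intro ex_has_greatest_nat) auto
  then obtain T where T: "good T" and max: "\<And>T'. good T' \<Longrightarrow> card T' \<le> card T" by blast
  have TD: "T \<noteq> {}" "T \<subseteq> D" "finite T" using T D(8) finite_subset by (auto simp: good_def)
  have sat: "\<And>K. thread K \<Longrightarrow> K \<subseteq> T \<or> K \<inter> T = {}" "\<And>z. z \<in> T \<Longrightarrow> hub z \<Longrightarrow> star z \<subseteq> T"
    and gT: "gap T \<le> 1" using T by (auto simp: good_def)
  have "T = D"
  proof (rule ccontr)
    assume "T \<noteq> D"
    then have "T \<union> (D - T) = D" "T \<inter> (D - T) = {}" "D - T \<noteq> {}" using TD by auto
    then obtain t n where tn: "t \<in> T" "n \<in> D" "n \<notin> T" "{t, n} \<in> E"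
      using connD[OF D(5), of T "D - T"] TD(1) by blast
    \<comment> \<open>A vertex of degree 2 just outside \<open>T\<close> would lie on the thread of
      \<open>t\<close> or, if \<open>t\<close> is a hub, in the star of \<open>t\<close>; either is
      contained in \<open>T\<close>.\<close>
    have hn: "hub n"
    proof (rule ccontr)
      assume nh: "\<not> hub n"
      obtain K where K: "thread K" "n \<in> K" using thread_ex[OF tn(2) nh] by blast
      show False
      proof (cases "hub t")
        case True
        then show False using thread_in_star[OF K tn(4)] sat(2)[OF tn(1)] K(2) tn(3) by blast
      next
        case False
        have "t \<in> K"
        proof (rule ccontr)
          assume "t \<notin> K"
          then have "hub t \<and> t \<in> D \<or> t = x \<or> t = y" using threadD(5)[OF K edge_sym[OF tn(4)]] by simp
          then show False using False tn(1) TD(2) D(7) by auto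
        qed
        then show False using sat(1)[OF K(1)] K(2) tn(1,3) by blast
      qed
    qed
    define S where "S = star n"
    have S: "S \<subseteq> D" "finite S" "n \<in> S" using star_D[OF tn(2)] D(8) finite_subset
      by (auto simp: S_def star_def)
    define \<K> where "\<K> = {K. thread K \<and> (\<exists>k\<in>K. {n, k} \<in> E) \<and> K \<subseteq> T}"
    have \<K>: "finite \<K>" "\<And>K. K \<in> \<K> \<Longrightarrow> thread K"
      using TD(3) finite_subset[of \<K> "Pow T"] by (auto simp: \<K>_def)
    have TS: "T \<inter> S = \<Union>\<K>"
    proof (intro equalityI subsetI)
      fix s assume s: "s \<in> T \<inter> S"
      then have "s \<in> star n" "s \<noteq> n" using tn(3) by (auto simp: S_def)
      then obtain K k where K: "thread K" "s \<in> K" "k \<in> K" "{n, k} \<in> E" using in_starE by blast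
      then have "K \<in> \<K>" using sat(1)[OF K(1)] s unfolding \<K>_def by blast
      then show "s \<in> \<Union>\<K>" using K(2) by blast
    next
      fix s assume "s \<in> \<Union>\<K>"
      then show "s \<in> T \<inter> S" using thread_in_star unfolding \<K>_def S_def by blast
    qed
    \<comment> \<open>The overlap of \<open>T\<close> with the new star is a union of threads, whose
      gap is at least 1 unless it is empty. If it is empty, the edge \<open>{t, n}\<close> meets
      both sets and contributes \<open>d - 1\<close>.\<close>
    have "1 \<le> (d - 1) * int (card (meeting E T \<inter> meeting E S)) - d * int (card (T \<inter> S))"
    proof (cases "\<K> = {}")
      case False
      have "meeting E (T \<inter> S) \<subseteq> meeting E T \<inter> meeting E S" by (auto simp: meeting_def)
      then have "card (meeting E (T \<inter> S)) \<le> card (meeting E T \<inter> meeting E S)"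
        using basics(5) by (intro card_mono) (auto simp: meeting_def)
      then have "(d - 1) * int (card (meeting E (T \<inter> S))) \<le> (d - 1) * int (card (meeting E T \<inter> meeting E S))"
        using d by (intro mult_left_mono) auto
      moreover have "gap (T \<inter> S) = int (card \<K>)" unfolding TS using gap_threads[OF \<K>] .
      moreover have "1 \<le> card \<K>" using False \<K>(1) by (simp add: Suc_le_eq card_gt_0_iff)
      ultimately show ?thesis by (simp add: gap_def)
    next
      case True
      have "hub t"
      proof (rule ccontr)
        assume nh: "\<not> hub t"
        obtain K where K: "thread K" "t \<in> K" using thread_ex[OF _ nh] tn(1) TD(2) by blast
        then have "K \<in> \<K>" using sat(1)[OF K(1)] tn(1) edge_sym[OF tn(4)] unfolding \<K>_def by blast
        then show False using True by simp
      qed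
      have "{t, n} \<in> meeting E T \<inter> meeting E S" using tn S(3) by (auto simp: meeting_def)
      then have "1 \<le> card (meeting E T \<inter> meeting E S)"
        using basics(5) by (simp add: Suc_le_eq card_gt_0_iff meeting_def) blast
      then have "(d - 1) * 1 \<le> (d - 1) * int (card (meeting E T \<inter> meeting E S))"
        using d by (intro mult_left_mono) auto
      moreover have "1 \<le> (d - 1) * 1" using d by simp
      ultimately have "1 \<le> (d - 1) * int (card (meeting E T \<inter> meeting E S))" by (rule order_trans[rotated])
      moreover have "d * int (card (T \<inter> S)) = 0" using TS True by simp
      ultimately show ?thesis by (simp only: diff_zero)
    qed
    then have "gap (T \<union> S) \<le> 1"
      using gap_Un[OF TD(3) S(2)] gT gap_star[OF tn(2) hn] by (simp add: S_def)
    moreover have "K \<subseteq> T \<union> S \<or> K \<inter> (T \<union> S) = {}" if "thread K" for K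
      using sat(1)[OF that] thread_disjoint_star[OF that hn] unfolding S_def by blast
    moreover have "star z \<subseteq> T \<union> S" if "z \<in> T \<union> S" "hub z" for z
      using that sat(2)[of z] hub_in_star[of z n] unfolding S_def by blast
    ultimately have "good (T \<union> S)" using TD S unfolding good_def by blast
    moreover have "T \<subset> T \<union> S" using S(3) tn(3) by blast
    then have "card T < card (T \<union> S)" using TD(3) S(2) by (intro psubset_card_mono) auto
    ultimately show False using max by (simp add: leD)
  qed
  then show False using gT gap_D d by simp
qed

end

text \<open>An edge \<open>{a, b}\<close> at a vertex \<open>a\<close> of degree 2 makes
  \<open>V - {a, b}\<close> a side, so a smallest side with a hub exists. If it is proper,
  \<open>contradiction\<close> applies. If not, \<open>V - {a, b}\<close> has the same size and is
  smallest too; then \<open>V\<close> is 2-connected without the edge \<open>{a, b}\<close>, which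
  gives \<open>a\<close> a third neighbour.\<close>

lemma (in prime_crit) no_hub: "\<not> hub z"
proof
  assume z: "hub z"
  obtain a where a: "a \<in> V" "\<not> hub a" by (rule ex_nonhub)
  obtain b where b: "{a, b} \<in> E" "b \<noteq> z"
    using biconn_two_nbrs[OF basics(2,3) a(1)] by metis
  have abV: "a \<noteq> b" "b \<in> V" using edge_in[OF b(1)] by auto
  have zab: "z \<in> V - {a, b}" using z a(2) b(2) hub_V by auto
  have s0: "side a b (V - {a, b})"
    unfolding side_def closed_in_def using a(1) abV b(1) zab contr[OF b(1)] by auto
  define P where "P t \<longleftrightarrow> (case t of (x, y, D) \<Rightarrow> side x y D \<and> (\<exists>z\<in>D. hub z))" for t
  have "P (a, b, V - {a, b})" using s0 zab z unfolding P_def by auto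
  then obtain t where t: "P t" "\<And>t'. P t' \<Longrightarrow> card (snd (snd t)) \<le> card (snd (snd t'))"
    using ex_has_least_nat[of P _ "\<lambda>t. card (snd (snd t))"] by blast
  obtain x y D where xyD: "t = (x, y, D)" by (cases t)
  have sd: "side x y D" "\<exists>z\<in>D. hub z" using t(1) by (auto simp: P_def xyD)
  have minD: "card D \<le> card D'" if "side x' y' D'" "\<exists>z\<in>D'. hub z" for x' y' D'
    using t(2)[of "(x', y', D')"] that by (simp add: P_def xyD)
  interpret min_side d V E x y D
    using sd minD by unfold_locales auto
  show False
  proof (cases "D = V - {x, y}")
    case True
    have "card D = card V - 2" unfolding True using D(1-3) by (simp add: card_Diff_subset)
    moreover have "card (V - {a, b}) = card V - 2" using a(1) abV by (simp add: card_Diff_subset)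
    ultimately have min0: "card (V - {a, b}) \<le> card D'" if "side x' y' D'" "\<exists>z\<in>D'. hub z" for x' y' D'
      using minD[OF that] by simp
    interpret m0: min_side d V E a b "V - {a, b}"
      using s0 zab z min0 by unfold_locales auto
    have "V - {a, b} \<union> {a, b} = V" using a(1) abV by auto
    then have "biconn (E - {{a, b}}) V" using m0.biconn_F by simp
    obtain n m where nm: "n \<noteq> m" "{a, n} \<in> E - {{a, b}}" "{a, m} \<in> E - {{a, b}}"
      using biconn_two_nbrs[OF \<open>biconn (E - {{a, b}}) V\<close> basics(3) a(1)] by metis
    then have "{b, n, m} \<subseteq> nbs E a" "b \<noteq> n" "b \<noteq> m" using b(1) by (auto simp: nbs_def)
    moreover then have "card {b, n, m} = 3" using nm(1) by simp
    ultimately have "{b, n, m} \<subseteq> nbs E a" "card {b, n, m} = 3" by simp_all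
    then have "3 \<le> card (nbs E a)" using card_mono[OF finite_nbs[OF basics(1)]] by metis
    then show False using a by (simp add: hub_def)
  next
    case False
    interpret proper_side d V E x y D using False by unfold_locales
    show False by (rule contradiction)
  qed
qed

lemma (in crit) good_side:
  assumes ih: "\<And>x y D. x \<in> V \<Longrightarrow> y \<in> V \<Longrightarrow> x \<noteq> y \<Longrightarrow> D \<noteq> {} \<Longrightarrow> conn E D \<Longrightarrow>
      closed_in E (V - {x, y}) D \<Longrightarrow> D \<noteq> V - {x, y} \<Longrightarrow> biconn E (D \<union> {x, y}) \<Longrightarrow>
      conn E (V - {x, y} - D)"
    and "hub z"
  obtains x y K where "x \<in> V" "y \<in> V" "x \<noteq> y" "K \<noteq> {}" "conn E K"
      "closed_in E (V - {x, y}) K" "\<And>k. k \<in> K \<Longrightarrow> \<not> hub k" "\<not> conn E (V - {x, y} - K)"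
proof (rule ccontr)
  assume no: "\<not> thesis"
  interpret prime_crit d V E
  proof unfold_locales
    fix x y K
    assume K: "x \<in> V" "y \<in> V" "x \<noteq> y" "K \<noteq> {}" "conn E K" "closed_in E (V - {x, y}) K"
      "\<And>k. k \<in> K \<Longrightarrow> \<not> hub k"
    show "conn E (V - {x, y} - K)"
    proof (rule ccontr)
      assume "\<not> conn E (V - {x, y} - K)"
      then have thesis by (intro that[of x y K] K)
      then show False using no by simp
    qed
  qed (rule ih)
  show False using no_hub assms(2) by blast
qed

text \<open>\<open>V - K\<close> is 2-connected because the remainder behind \<open>{x, y}\<close>
  is disconnected, so \<open>gap K = 1\<close>. This determines the length of the path:
  \<open>n\<close> inner vertices meet \<open>n + 1\<close> edges, and
  \<open>(d - 1) (n + 1) - d n = 1\<close> means \<open>n = d - 2\<close>.\<close>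

lemma (in crit) unsubdivide:
  assumes xy: "x \<in> V" "y \<in> V" "x \<noteq> y" and K: "K \<noteq> {}" "conn E K" "closed_in E (V - {x, y}) K"
    "\<And>k. k \<in> K \<Longrightarrow> \<not> hub k" and nc: "\<not> conn E (V - {x, y} - K)"
  obtains u v xs where "subdiv d (V - K) (induced E (V - K)) u v xs" "set xs = K"
    "E = induced E (V - K) \<union> path_edges (u # xs @ [v])"
proof -
  have KV: "K \<subseteq> V - {x, y}" using K(3) by (simp add: closed_in_def)
  have "card {x, y} \<le> card (V - K)" using basics(4) xy KV by (intro card_mono) auto
  then have c2: "2 \<le> card (V - K)" using xy(3) by simp
  obtain u v xs where P: "u \<noteq> v" "u \<in> V - K" "v \<in> V - K" "set xs = K" "distinct (u # xs @ [v])"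
    "xs \<noteq> []" "meeting E K = path_edges (u # xs @ [v])"
    using path_comp[OF K(1,2) _ K(4) c2] KV by (metis Diff_subset subset_trans)
  note ends = path_ends[OF P(5,6), unfolded P(4), OF P(7)]
  have uv: "{u, v} = {x, y}"
  proof -
    have out: "z = x \<or> z = y" if "z \<in> V - K" "k \<in> K" "{z, k} \<in> E" for z k
      using closed_in_nbr[OF basics(1) K(3) that(2) edge_sym[OF that(3)]] that(1) by auto
    obtain ku kv where "ku \<in> K" "{u, ku} \<in> E" "kv \<in> K" "{v, kv} \<in> E" using ends(2,3) by blast
    then have "u = x \<or> u = y" "v = x \<or> v = y" using out P(2,3) by blast+
    then show ?thesis using P(1) by auto
  qed
  have VK: "K \<noteq> V - {x, y}"
  proof
    assume "K = V - {x, y}"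
    then have "V - {x, y} - K = {}" by simp
    then show False using nc conn_empty by metis
  qed
  have E: "E = induced E (V - K) \<union> meeting E K"
    using basics(1) by (auto simp: induced_def meeting_def simple_on_def)
  have "{x, y} \<notin> E" using conn_closed[OF contr K(3,1)] VK by blast
  have tcK: "biconn E (V - K)" using biconn_side[OF basics(1,2) xy K(3) VK] nc by blast
  have "biconn (induced E (V - K)) (V - K)" using tcK by (rule biconn_cong) (auto simp: induced_def)
  moreover have "gap K = 1" using gap_removable[OF _ K(1,2) tcK] KV by blast
  then have "int (length xs) = d - 2"
  proof -
    have "card (meeting E K) = length xs + 1" using card_path_edges[OF P(5)] P(7) by simp
    moreover have "card K = length xs" using distinct_card[of xs] P(4,5) by simp
    ultimately show ?thesis using \<open>gap K = 1\<close> by (simp add: gap_def algebra_simps)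
  qed
  moreover have "\<not> conn (induced E (V - K)) (V - K - {u, v})"
  proof
    assume "conn (induced E (V - K)) (V - K - {u, v})"
    then have "conn E (V - K - {u, v})" by (rule conn_mono) (simp add: induced_def)
    moreover have "V - K - {u, v} = V - {x, y} - K" using uv by auto
    ultimately show False using nc by simp
  qed
  moreover have "simple_on (V - K) (induced E (V - K))" using basics(1) by (auto simp: simple_on_def induced_def)
  moreover have "{u, v} \<notin> induced E (V - K)" using uv \<open>{x, y} \<notin> E\<close> by (simp add: induced_def)
  ultimately have "subdiv d (V - K) (induced E (V - K)) u v xs"
    using P d by unfold_locales auto
  then show thesis using that P(4,7) E by metis
qed

section \<open>Cycles\<close>

lemma cycle_edges:
  assumes "p \<noteq> []"
  shows "{{p ! i, p ! (Suc i mod length p)} | i. i < length p} = insert {last p, hd p} (path_edges p)"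
    (is "?L = ?R")
proof (intro set_eqI iffI)
  fix e assume "e \<in> ?L"
  then obtain i where i: "i < length p" "e = {p ! i, p ! (Suc i mod length p)}" by blast
  show "e \<in> ?R"
  proof (cases "Suc i = length p")
    case True
    then have "i = length p - 1" by simp
    then have "e = {last p, hd p}" using i True assms by (simp add: last_conv_nth hd_conv_nth)
    then show ?thesis by simp
  next
    case False
    then have "Suc i < length p" using i(1) by simp
    then show ?thesis using i(2) unfolding path_edges_def by auto
  qed
next
  fix e assume "e \<in> ?R"
  then consider "e = {last p, hd p}" | i where "Suc i < length p" "e = {p ! i, p ! Suc i}"
    unfolding path_edges_def by blast
  then show "e \<in> ?L"
  proof cases
    case 1
    have n: "length p - 1 < length p" "Suc (length p - 1) mod length p = 0" using assms by simp_all
    then have "e = {p ! (length p - 1), p ! (Suc (length p - 1) mod length p)}"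
      using 1 assms by (simp add: last_conv_nth hd_conv_nth)
    then show ?thesis using n(1) by blast
  next
    case 2
    then have "e = {p ! i, p ! (Suc i mod length p)}" by simp
    then show ?thesis using 2(1) Suc_lessD by blast
  qed
qed

text \<open>Removing the ends of an edge leaves a connected set of vertices of degree 2. It is the
  inside of a path between these ends, which the edge closes to a cycle.\<close>

lemma (in crit) hubfree_cycle:
  assumes "\<And>v. v \<in> V \<Longrightarrow> \<not> hub v"
  obtains p where "distinct p" "int (length p) = d" "set p = V" "p \<noteq> []"
    "E = insert {last p, hd p} (path_edges p)"
proof -
  have "E \<noteq> {}"
  proof
    assume "E = {}"
    then show False using total d basics(3) by simp
  qed
  then obtain a b where ab: "{a, b} \<in> E" "a \<noteq> b" "a \<in> V" "b \<in> V" using simple_on_edge[OF basics(1)] by blast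
  define K where "K = V - {a, b}"
  have VK: "V - K = {a, b}" using ab by (auto simp: K_def)
  have "card K = card V - 2" unfolding K_def using ab by (simp add: card_Diff_subset)
  then have Kne: "K \<noteq> {}" using basics(3) by auto
  have cK: "conn E K" using contr[OF ab(1)] by (simp add: K_def)
  have KV: "K \<subseteq> V" by (auto simp: K_def)
  have hf: "\<And>k. k \<in> K \<Longrightarrow> \<not> hub k" using assms KV by blast
  have c2: "2 \<le> card (V - K)" using VK ab(2) by simp
  then obtain u v xs where P: "u \<noteq> v" "u \<in> V - K" "v \<in> V - K" "set xs = K" "distinct (u # xs @ [v])"
    "xs \<noteq> []" "meeting E K = path_edges (u # xs @ [v])"
    using path_comp[OF Kne cK KV hf c2] by metis
  have uv: "{u, v} = {a, b}" using P(1-3) VK by auto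
  define p where "p = u # xs @ [v]"
  have "set p = K \<union> {u, v}" unfolding P(4)[symmetric] by (auto simp: p_def)
  also have "\<dots> = V" unfolding uv using ab(3,4) by (auto simp: K_def)
  finally have sp: "set p = V" .
  have ends: "{last p, hd p} = {a, b}" unfolding uv[symmetric] by (simp add: p_def insert_commute)
  have "E = insert {last p, hd p} (path_edges p)"
  proof (intro set_eqI iffI)
    fix e assume e: "e \<in> E"
    show "e \<in> insert {last p, hd p} (path_edges p)"
    proof (cases "e \<inter> K = {}")
      case True
      obtain s t where st: "e = {s, t}" "s \<noteq> t" "s \<in> V" "t \<in> V" using simple_on_edge[OF basics(1) e] by blast
      then have "s \<in> V - K" "t \<in> V - K" using True by auto
      then have "{s, t} = {a, b}" unfolding VK using st(2) by auto
      then show ?thesis using st(1) ends by simp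
    next
      case False
      then have "e \<in> meeting E K" using e by (simp add: meeting_def)
      then show ?thesis using P(7) by (simp add: p_def)
    qed
  next
    fix e assume "e \<in> insert {last p, hd p} (path_edges p)"
    then have "e = {a, b} \<or> e \<in> meeting E K" using P(7) ends by (simp add: p_def)
    then show "e \<in> E" using ab(1) by (auto simp: meeting_def)
  qed
  moreover have "card V = length p" unfolding sp[symmetric] using P(5) by (intro distinct_card) (simp add: p_def)
  then have "int (length p) = d" using deg2_total[OF assms] by simp
  ultimately show thesis using that[of p] sp P(5) by (simp add: p_def)
qed

text \<open>No equation arises from flats with three or more vertices: a 2-connected set of that
  size contains both neighbours of each of its vertices and so is everything. No edge can be
  deleted, since its ends would keep only one neighbour each.\<close>

lemma cycle_bal:
  assumes p: "distinct p" "int (length p) = d" "3 \<le> d"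
  defines "V \<equiv> set p" and "E \<equiv> insert {last p, hd p} (path_edges p)"
  shows "balanced d V E" "exclusive V E"
proof -
  have pne: "p \<noteq> []" using p by auto
  have len: "3 \<le> length p" using p by simp
  have cV: "card V = length p" using p(1) by (simp add: V_def distinct_card)
  obtain h mid l where hl: "p = h # mid @ [l]"
  proof -
    obtain h p' where "p = h # p'" using pne by (cases p) auto
    moreover have "p' \<noteq> []" using len calculation by auto
    then obtain mid l where "p' = mid @ [l]" by (cases p' rule: rev_cases) auto
    ultimately show thesis using that by blast
  qed
  have mid: "mid \<noteq> []" using len hl by auto
  have pE: "path_edges p \<subseteq> E" by (auto simp: E_def)
  have lh: "{l, h} \<in> E" by (simp add: E_def hl)
  have sg: "simple_on V E" unfolding simple_on_def
  proof (intro conjI ballI)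
    show "finite V" by (simp add: V_def)
    fix e assume "e \<in> E"
    then consider "e = {l, h}" | "e \<in> path_edges p" by (auto simp: E_def hl)
    then have "e \<subseteq> V \<and> card e = 2"
    proof cases
      case 1 then show ?thesis using p(1) by (auto simp: V_def hl)
    next
      case 2
      obtain q a b r where "p = q @ a # b # r" "e = {a, b}" using path_edges_split[OF 2] by blast
      then show ?thesis using p(1) by (auto simp: V_def)
    qed
    then show "e \<subseteq> V" "card e = 2" by simp_all
  qed
  \<comment> \<open>The segments before and after the removed block contain \<open>h\<close> and
    \<open>l\<close> respectively and are joined by the closing edge.\<close>
  have pieces: "conn E (V - set m)" if s: "p = q1 @ m @ q2" for q1 m q2
  proof -
    have P: "path_edges q1 \<subseteq> E" "path_edges q2 \<subseteq> E"
      using path_edges_append_mono[of q1 "m @ q2"] path_edges_append_mono[of m q2] s pE by auto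
    note c = conn_mono[OF conn_path P(1)] conn_mono[OF conn_path P(2)]
    have "conn E (set q1 \<union> set q2)"
    proof (cases "q1 = [] \<or> q2 = []")
      case False
      have "hd q1 = h" using False s hl by (cases q1) auto
      moreover have "last q2 = l"
      proof -
        have "last p = last q2" using False s by simp
        then show ?thesis by (simp add: hl)
      qed
      ultimately have "h \<in> set q1" "l \<in> set q2" using False hd_in_set last_in_set by metis+
      moreover have "{h, l} \<in> E" using lh by (simp add: insert_commute)
      ultimately show ?thesis using conn_Un_adj[OF c] by blast
    qed (use c in auto)
    moreover have "V - set m = set q1 \<union> set q2" using s p(1) by (auto simp: V_def)
    ultimately show ?thesis by simp
  qed
  have del: "conn E (V - {z})" if "z \<in> V" for z
  proof -
    obtain q1 q2 where "p = q1 @ [z] @ q2" using \<open>z \<in> V\<close> by (auto simp: V_def dest: split_list)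
    then show ?thesis using pieces[of q1 "[z]" q2] by simp
  qed
  have tcV: "biconn E V" using del cV len by (intro biconnI) auto
  have contr: "conn E (V - e)" if e: "e \<in> E" for e
  proof -
    consider "e = {l, h}" | "e \<in> path_edges p" using e by (auto simp: E_def hl)
    then show ?thesis
    proof cases
      case 1
      have "V - e = set mid" using 1 p(1) by (auto simp: V_def hl)
      moreover have "path_edges mid \<subseteq> E"
        using path_edges_append_mono[of "[h]" "mid @ [l]"] path_edges_append_mono[of mid "[l]"] pE hl by auto
      ultimately show ?thesis using conn_mono[OF conn_path] by metis
    next
      case 2
      obtain q a b r where "p = q @ a # b # r" "e = {a, b}" using path_edges_split[OF 2] by blast
      then show ?thesis using pieces[of q "[a, b]" r] by simp
    qed
  qed
  have nbrs: "\<exists>a b. \<forall>n. {k, n} \<in> E \<longrightarrow> n = a \<or> n = b" if "k \<in> V" for k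
  proof -
    obtain q1 q2 where s: "p = q1 @ k # q2" using \<open>k \<in> V\<close> by (auto simp: V_def dest: split_list)
    have d: "distinct (q1 @ k # q2)" using p(1) s by simp
    let ?a = "if q1 = [] then l else last q1" and ?b = "if q2 = [] then h else hd q2"
    have "n = ?a \<or> n = ?b" if "{k, n} \<in> E" for n
    proof -
      have "{k, n} = {l, h} \<or> {k, n} \<in> path_edges p" using that by (auto simp: E_def hl)
      then show ?thesis
      proof
        assume "{k, n} = {l, h}"
        then consider "k = l" "n = h" | "k = h" "n = l" by (auto simp: doubleton_eq_iff)
        then show ?thesis
        proof cases
          case 1
          have "q2 = []"
          proof (rule ccontr)
            assume "q2 \<noteq> []"
            then have "last q2 = last p" using s by simp
            then have "l \<in> set q2" using last_in_set[OF \<open>q2 \<noteq> []\<close>] by (simp add: hl)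
            then show False using d 1 by auto
          qed
          then show ?thesis using 1 by simp
        next
          case 2
          have "q1 = []"
          proof (rule ccontr)
            assume "q1 \<noteq> []"
            then have "hd q1 = hd p" using s by simp
            then have "h \<in> set q1" using hd_in_set[OF \<open>q1 \<noteq> []\<close>] by (simp add: hl)
            then show False using d 2 by auto
          qed
          then show ?thesis using 2 by simp
        qed
      next
        assume "{k, n} \<in> path_edges p"
        then show ?thesis using path_edges_nbrs[OF d] s by auto
      qed
    qed
    then show ?thesis by blast
  qed
  have cE: "card E = length p"
  proof -
    have "{last p, hd p} \<notin> path_edges p"
    proof
      assume "{last p, hd p} \<in> path_edges p"
      then have "{h, l} \<in> path_edges ([] @ h # mid @ [l])" by (simp add: hl insert_commute)
      then have "l = hd (mid @ [l])" using path_edges_nbrs[of "[]" h "mid @ [l]" l] p(1) hl by auto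
      then have "l \<in> set mid" using mid by (cases mid) auto
      then show False using p(1) hl by auto
    qed
    then show ?thesis using card_path_edges[OF p(1) pne] finite_path_edges[of p] pne
      by (simp add: E_def)
  qed
  show "balanced d V E"
  proof (rule balancedI[OF sg tcV])
    show "3 \<le> card V" using cV len by simp
    have "sum (wgt d E V) E = sum (\<lambda>_. d - 1) E" using contr by (intro sum.cong) (auto simp: wgt_def)
    then show "sum (wgt d E V) E = d * (int (card V) - 1)"
      using cE cV p(2) by simp
    fix S assume S: "S \<subset> V" "biconn E S" "3 \<le> card S"
    have "closed_in E V S" unfolding closed_in_def
    proof (intro conjI ballI notI)
      show "S \<subseteq> V" using S(1) by auto
      fix k n assume kn: "k \<in> S" "n \<in> V - S" "{k, n} \<in> E"
      obtain a b where ab: "\<forall>n. {k, n} \<in> E \<longrightarrow> n = a \<or> n = b" using nbrs[of k] kn(1) S(1) by blast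
      obtain s t where "s \<in> S" "t \<in> S" "s \<noteq> t" "{k, s} \<in> E" "{k, t} \<in> E"
        using biconn_two_nbrs[OF S(2,3) kn(1)] by blast
      then have "n = s \<or> n = t" using ab kn(3) by metis
      then show False using kn(2) \<open>s \<in> S\<close> \<open>t \<in> S\<close> by blast
    qed
    moreover have "S \<noteq> {}" using S(3) by auto
    ultimately have "S = V" using conn_closed[OF biconn_conn[OF tcV]] by blast
    then show "sum (wgt d E V) (induced E S) + 1 = d * (int (card S) - 1) \<or>
       sum (wgt d E V) (meeting E (V - S)) = d * int (card (V - S)) + 1" using S(1) by simp
  qed
  show "exclusive V E" unfolding exclusive_def
  proof (intro ballI impI notI)
    fix e assume e: "e \<in> E" "biconn (E - {e}) V"
    have c3: "3 \<le> card V" using cV len by simp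
    obtain k n where kn: "e = {k, n}" "k \<in> V" using simple_on_edge[OF sg e(1)] by metis
    obtain a b where ab: "\<forall>n. {k, n} \<in> E \<longrightarrow> n = a \<or> n = b" using nbrs[OF kn(2)] by blast
    obtain s t where "s \<noteq> t" "{k, s} \<in> E - {e}" "{k, t} \<in> E - {e}"
      using biconn_two_nbrs[OF e(2) c3 kn(2)] by metis
    moreover then have "n \<noteq> s" "n \<noteq> t" using kn(1) by auto
    ultimately show False using ab e(1) kn(1) by (metis DiffD1)
  qed
qed

subsection \<open>Connectivity by cuts and by paths\<close>

lemma conn_reach:
  assumes "conn E X" "u \<in> X" "v \<in> X"
  shows "(u, v) \<in> (adj (induced E X))\<^sup>*"
proof -
  define R where "R = {w \<in> X. (u, w) \<in> (adj (induced E X))\<^sup>*}"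
  have "closed_in E X R" unfolding closed_in_def
  proof (intro conjI ballI notI)
    show "R \<subseteq> X" by (auto simp: R_def)
    fix a b assume ab: "a \<in> R" "b \<in> X - R" "{a, b} \<in> E"
    then have "(a, b) \<in> adj (induced E X)" by (auto simp: adj_def induced_def R_def)
    then have "b \<in> R" using ab by (auto simp: R_def intro: rtrancl_into_rtrancl)
    then show False using ab(2) by simp
  qed
  moreover have "u \<in> R" using assms(2) by (simp add: R_def)
  ultimately have "R = X" using conn_closed[OF assms(1)] by blast
  then show ?thesis using assms(3) by (auto simp: R_def)
qed

lemma reach_closed:
  assumes "(u, v) \<in> (adj F)\<^sup>*" "u \<in> A" "\<And>a b. a \<in> A \<Longrightarrow> {a, b} \<in> F \<Longrightarrow> b \<in> A"
  shows "v \<in> A"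
  using assms(1) by induction (use assms(2,3) in \<open>auto simp: adj_def\<close>)

lemma conn_iff_reach:
  "conn E X \<longleftrightarrow> (\<forall>u\<in>X. \<forall>v\<in>X. (u, v) \<in> (adj (induced E X))\<^sup>*)"
proof
  assume r: "\<forall>u\<in>X. \<forall>v\<in>X. (u, v) \<in> (adj (induced E X))\<^sup>*"
  show "conn E X"
  proof (rule ccontr)
    assume "\<not> conn E X"
    then obtain A where A: "closed_in E X A" "A \<noteq> {}" "A \<noteq> X" using not_conn_closed by blast
    have AX: "A \<subseteq> X" using A(1) by (simp add: closed_in_def)
    obtain u where u: "u \<in> A" using A(2) by blast
    obtain v where v: "v \<in> X" "v \<notin> A" using A(3) AX by blast
    have "v \<in> A"
    proof (rule reach_closed[OF _ u])
      show "(u, v) \<in> (adj (induced E X))\<^sup>*" using r u v(1) AX by blast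
      show "b \<in> A" if "a \<in> A" "{a, b} \<in> induced E X" for a b
        using closed_inD[OF A(1) that(1), of b] that(2) by (auto simp: induced_def)
    qed
    then show False using v(2) by simp
  qed
next
  assume "conn E X"
  then show "\<forall>u\<in>X. \<forall>v\<in>X. (u, v) \<in> (adj (induced E X))\<^sup>*" by (intro ballI conn_reach)
qed

lemma two_connected_iff:
  assumes "\<And>e. e \<in> edges H \<Longrightarrow> e \<subseteq> verts H"
  shows "two_connected H \<longleftrightarrow> biconn (edges H) (verts H)"
proof -
  have induced: "induced (edges H) (verts H) = edges H" using assms by (auto simp: induced_def)
  have del: "edges (delete_vertex H v) = induced (edges H) (verts H - {v})" for v
    using assms by (auto simp: delete_vertex_def induced_def)
  have c: "connected_graph H \<longleftrightarrow> verts H \<noteq> {} \<and> conn (edges H) (verts H)"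
    by (simp add: connected_graph_def conn_iff_reach induced)
  have cut: "\<not> cut_vertex H v \<longleftrightarrow> conn (edges H) (verts H - {v})"
    if "conn (edges H) (verts H)" "v \<in> verts H" for v
  proof -
    have "(x, y) \<in> (adj (edges H))\<^sup>*" if "x \<in> verts H" "y \<in> verts H" for x y
      using conn_reach[OF \<open>conn (edges H) (verts H)\<close> that] by (simp add: induced)
    then show ?thesis using that(2) by (auto simp: cut_vertex_def conn_iff_reach del)
  qed
  have ne: "2 \<le> card (verts H) \<Longrightarrow> verts H \<noteq> {}" by auto
  show ?thesis
  proof
    assume t: "two_connected H"
    then have "conn (edges H) (verts H)" using c by (simp add: two_connected_def)
    then show "biconn (edges H) (verts H)" using t cut by (simp add: two_connected_def biconn_def)
  next
    assume t: "biconn (edges H) (verts H)"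
    then have "\<not> cut_vertex H v" for v
      using cut[of v] by (cases "v \<in> verts H") (auto simp: biconn_def cut_vertex_def)
    then show "two_connected H" using t c ne by (simp add: two_connected_def biconn_def)
  qed
qed

text \<open>Deleting the contracted vertex leaves \<open>V - S\<close>, and this is the only
  deletion that can disconnect the quotient: the quotient itself and its other deletions are images
  of \<open>V\<close> and of \<open>V\<close> minus one vertex. The condition
  \<open>S \<noteq> verts H\<close> says that the quotient has at least two vertices.\<close>

lemma contract_ind_iff:
  assumes sg: "simple_on (verts H) (edges H)" and tcH: "biconn (edges H) (verts H)"
    and S: "S \<subseteq> verts H" "conn (edges H) S" "2 \<le> card S"
  shows "two_connected (contract H (induced (edges H) S)) \<longleftrightarrow>
    S \<noteq> verts H \<and> conn (edges H) (verts H - S)"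
proof -
  define V where "V = verts H"
  define E where "E = edges H"
  \<comment> \<open>The class of \<open>x\<close> in the contraction. As \<open>S\<close> has at
    least two elements, it differs from all singleton classes.\<close>
  define c where "c x = (if x \<in> S then S else {x})" for x
  define CV where "CV = c ` V"
  define CE where "CE = {{c x, c y} | x y. {x, y} \<in> E - induced E S \<and> c x \<noteq> c y}"
  note defs = V_def[symmetric] E_def[symmetric]
  note sg = sg[unfolded defs] and tcH = tcH[unfolded defs] and S = S[unfolded defs]
  have fin: "finite V" using sg by (simp add: simple_on_def)
  have S1: "S \<noteq> {x}" for x using S(3) by auto
  have Sne: "S \<noteq> {}" using S(3) by auto
  have cls: "{y \<in> V. (x, y) \<in> (adj (induced E S))\<^sup>*} = c x" if x: "x \<in> V" for x
  proof (cases "x \<in> S")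
    case True
    have "y \<in> S" if "(x, y) \<in> (adj (induced E S))\<^sup>*" for y
      by (rule reach_closed[OF that True]) (auto simp: induced_def)
    then show ?thesis using True conn_reach[OF S(2) True] S(1) by (auto simp: c_def)
  next
    case False
    have "y \<in> {x}" if "(x, y) \<in> (adj (induced E S))\<^sup>*" for y
      by (rule reach_closed[OF that]) (use False in \<open>auto simp: induced_def\<close>)
    then show ?thesis using False x by (auto simp: c_def)
  qed
  have cv: "verts (contract H (induced E S)) = CV"
    using cls by (simp add: contract_def Let_def CV_def defs)
  have ce: "edges (contract H (induced E S)) = CE"
  proof -
    let ?r = "\<lambda>x. {y \<in> V. (x, y) \<in> (adj (induced E S))\<^sup>*}"
    have "(u = {?r x, ?r y} \<and> {x, y} \<in> E - induced E S \<and> ?r x \<noteq> ?r y) \<longleftrightarrow>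
        (u = {c x, c y} \<and> {x, y} \<in> E - induced E S \<and> c x \<noteq> c y)" for u x y
    proof (cases "{x, y} \<in> E - induced E S")
      case True
      then have "x \<in> V" "y \<in> V" using simple_on_neq[OF sg, of x y] by auto
      then show ?thesis by (simp only: cls)
    next
      case False then show ?thesis by (simp only: simp_thms)
    qed
    then show ?thesis unfolding contract_def Let_def CE_def defs graph.simps by (simp only:)
  qed
  have "e \<subseteq> CV" if "e \<in> CE" for e
    using that simple_on_neq[OF sg] unfolding CE_def CV_def by blast
  then have "two_connected (contract H (induced E S)) \<longleftrightarrow> biconn CE CV"
    using two_connected_iff[of "contract H (induced E S)"] by (simp add: cv ce)
  also have "\<dots> \<longleftrightarrow> S \<noteq> V \<and> conn E (V - S)"
  proof
    assume t: "biconn CE CV"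
    have "S \<noteq> V"
    proof
      assume "S = V"
      then have "CV \<subseteq> {S}" by (auto simp: CV_def c_def)
      then have "card CV \<le> 1" using card_mono[of "{S}" CV] by simp
      then show False using t by (simp add: biconn_def)
    qed
    \<comment> \<open>Apart from \<open>S\<close> all classes are singletons, and
      \<open>the_elem\<close> undoes \<open>x \<mapsto> {x}\<close>.\<close>
    moreover have "conn E (V - S)"
    proof (rule conn_image[OF biconn_conn_del[OF t, of S], of the_elem])
      show "the_elem ` (CV - {S}) = V - S"
      proof (intro equalityI subsetI)
        fix x assume "x \<in> the_elem ` (CV - {S})"
        then show "x \<in> V - S" by (auto simp: CV_def c_def split: if_splits)
      next
        fix x assume x: "x \<in> V - S"
        then have "{x} \<in> CV - {S}" using S1[of x] by (auto simp: CV_def c_def)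
        then show "x \<in> the_elem ` (CV - {S})" by (intro image_eqI[of _ _ "{x}"]) auto
      qed
      fix A B assume AB: "A \<in> CV - {S}" "B \<in> CV - {S}" "{A, B} \<in> CE"
      obtain x y where xy: "{A, B} = {c x, c y}" "{x, y} \<in> E" using AB(3) unfolding CE_def by blast
      have "x \<notin> S" "y \<notin> S" using AB(1,2) xy(1) by (auto simp: c_def doubleton_eq_iff split: if_splits)
      then have "A = {x} \<and> B = {y} \<or> A = {y} \<and> B = {x}"
        using xy(1) by (auto simp: c_def doubleton_eq_iff)
      then show "the_elem A = the_elem B \<or> {the_elem A, the_elem B} \<in> E"
        using xy(2) by (auto simp: insert_commute)
    qed
    ultimately show "S \<noteq> V \<and> conn E (V - S)" by simp
  next
    assume r: "S \<noteq> V \<and> conn E (V - S)"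
    have img: "conn CE Y" if "conn E X" "c ` X = Y" "X \<subseteq> V" for X Y
    proof (rule conn_image[OF that(1,2)])
      fix a b assume "a \<in> X" "b \<in> X" "{a, b} \<in> E"
      moreover have "{a, b} \<notin> induced E S" if "c a \<noteq> c b" using that by (auto simp: induced_def c_def)
      ultimately show "c a = c b \<or> {c a, c b} \<in> CE" unfolding CE_def by blast
    qed
    obtain w where w: "w \<in> V" "w \<notin> S" using r S(1) by blast
    obtain s where s: "s \<in> S" using Sne by blast
    have "card {S, {w}} \<le> card CV"
    proof (rule card_mono)
      show "finite CV" using fin by (simp add: CV_def)
      have "S = c s" "{w} = c w" using s w by (auto simp: c_def)
      then show "{S, {w}} \<subseteq> CV" using s w S(1) unfolding CV_def by blast
    qed
    then have c2: "2 \<le> card CV" using S1[of w] by simp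
    have del: "conn CE (CV - {A})" if A: "A \<in> CV" for A
    proof (cases "A = S")
      case True
      have "c ` (V - S) = CV - {S}" using S1 by (auto simp: CV_def c_def split: if_splits)
      then show ?thesis using img[of "V - S"] r True by blast
    next
      case False
      then obtain x where x: "x \<in> V" "x \<notin> S" "A = {x}"
        using A by (auto simp: CV_def c_def split: if_splits)
      have "c ` (V - {x}) = CV - {A}" using x S1[of x] by (auto simp: CV_def c_def split: if_splits)
      then show ?thesis using img[OF biconn_conn_del[OF tcH]] by blast
    qed
    have "conn CE CV" using img[OF biconn_conn[OF tcH]] by (simp add: CV_def)
    then show "biconn CE CV" unfolding biconn_def using c2 del by blast
  qed
  finally show ?thesis unfolding defs .
qed

lemma simple_graph_iff: "simple_graph H \<longleftrightarrow> simple_on (verts H) (edges H)"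
  by (auto simp: simple_graph_def simple_on_def)

lemma induced_edges_eq: "induced_edges H S = induced (edges H) S"
  by (simp add: induced_edges_def induced_def)

lemma induced_single:
  assumes "simple_on V E" "e \<in> E"
  shows "induced E e = {e}"
proof -
  have "e' = e" if "e' \<in> E" "e' \<subseteq> e" for e'
  proof -
    have "card e' = 2" "card e = 2" using assms that by (auto simp: simple_on_def)
    then show ?thesis using card_subset_eq[of e e'] card.infinite[of e] that(2) by fastforce
  qed
  then show ?thesis using assms(2) by (auto simp: induced_def)
qed

section \<open>Weights and good flats in terms of connectivity\<close>

context
  fixes H :: "'a graph" and \<delta> :: nat and V E
  assumes delta: "2 < \<delta>" and sg: "simple_on (verts H) (edges H)" and tcH: "biconn (edges H) (verts H)"
  defines "V \<equiv> verts H" and "E \<equiv> edges H"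
begin

lemma deletion_iff: "two_connected (delete_edge H e) \<longleftrightarrow> biconn (E - {e}) V"
  using two_connected_iff[of "delete_edge H e"] sg
  by (auto simp: delete_edge_def E_def V_def simple_on_def)

lemma contraction_iff:
  assumes "e \<in> E" shows "two_connected (contract H {e}) \<longleftrightarrow> V \<noteq> e \<and> conn E (V - e)"
proof -
  obtain a b where ab: "e = {a, b}" "a \<noteq> b" using simple_on_edge[OF sg assms[unfolded E_def]] by blast
  have "conn (edges H) e" using ab assms conn_edge by (auto simp: E_def)
  moreover have "e \<subseteq> verts H" "2 \<le> card e" using sg assms by (auto simp: simple_on_def E_def)
  ultimately show ?thesis
    using contract_ind_iff[OF sg tcH, of e] induced_single[OF sg, of e] assms by (auto simp: E_def V_def)
qed

lemma good_flat_iff: "good_flat H S \<longleftrightarrow> S \<subset> V \<and> biconn E S \<and> conn E (V - S)"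
proof -
  have "two_connected (restrict H S) \<longleftrightarrow> biconn (induced E S) S"
    using two_connected_iff[of "restrict H S"] by (auto simp: restrict_def induced_edges_eq induced_def E_def)
  also have "\<dots> \<longleftrightarrow> biconn E S" by (intro iffI; erule biconn_cong) (auto simp: induced_def)
  finally have r: "two_connected (restrict H S) \<longleftrightarrow> biconn E S" .
  have "two_connected (contract H (induced E S)) \<longleftrightarrow> S \<noteq> V \<and> conn E (V - S)"
    if "S \<subseteq> V" "biconn E S"
    using contract_ind_iff[OF sg tcH, of S] that biconn_conn[OF that(2)] by (simp add: biconn_def E_def V_def)
  then show ?thesis using r by (auto simp: good_flat_def induced_edges_eq E_def V_def)
qed

lemma is_weight_iff:
  assumes "3 \<le> card V" "e \<in> E"
  shows "is_weight \<delta> H e k \<longleftrightarrow> biconn (E - {e}) V \<and> k = 1 \<or> conn E (V - e) \<and> k = \<delta> - 1"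
    and "biconn (E - {e}) V \<or> conn E (V - e)"
proof -
  have "card e = 2" using sg assms(2) by (simp add: simple_on_def E_def)
  then have "V \<noteq> e" using assms(1) by auto
  then show "is_weight \<delta> H e k \<longleftrightarrow> biconn (E - {e}) V \<and> k = 1 \<or> conn E (V - e) \<and> k = \<delta> - 1"
    using deletion_iff contraction_iff[OF assms(2)] by (auto simp: is_weight_def)
  obtain a b where "e = {a, b}" "a \<noteq> b" "a \<in> V" "b \<in> V"
    using simple_on_edge[OF sg assms(2)[unfolded E_def]] unfolding V_def by blast
  then show "biconn (E - {e}) V \<or> conn E (V - e)" using biconn_del[OF tcH, of a b] by (auto simp: E_def V_def)
qed

text \<open>Some value is always admissible, and two are only if the edge can be both deleted and
  contracted, since \<open>\<delta> - 1 \<noteq> 1\<close>.\<close>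

lemma weight_well_defined_iff:
  assumes "3 \<le> card V"
  shows "weight_well_defined \<delta> H \<longleftrightarrow> exclusive V E"
proof -
  have "(\<exists>!k. is_weight \<delta> H e k) \<longleftrightarrow> (conn E (V - e) \<longrightarrow> \<not> biconn (E - {e}) V)" if e: "e \<in> E" for e
  proof -
    have "\<delta> - 1 \<noteq> 1" using delta by simp
    then show ?thesis unfolding is_weight_iff(1)[OF assms e] using is_weight_iff(2)[OF assms e] by metis
  qed
  then show ?thesis unfolding weight_well_defined_def exclusive_def E_def[symmetric] by simp
qed

lemma weight_eq:
  assumes "3 \<le> card V" "exclusive V E" "e \<in> E"
  shows "weight \<delta> H e = (if conn E (V - e) then \<delta> - 1 else 1)" "int (weight \<delta> H e) = wgt (int \<delta>) E V e"
proof -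
  show w: "weight \<delta> H e = (if conn E (V - e) then \<delta> - 1 else 1)"
    unfolding weight_def is_weight_iff(1)[OF assms(1,3)]
    using is_weight_iff(2)[OF assms(1,3)] assms(2,3) by (auto simp: exclusive_def)
  show "int (weight \<delta> H e) = wgt (int \<delta>) E V e" using w delta by (simp add: wgt_def)
qed

lemma spade_iff_aux:
  assumes V3: "3 \<le> card V"
  shows "spade \<delta> H \<longleftrightarrow> balanced (int \<delta>) V E \<and> exclusive V E"
proof (cases "exclusive V E")
  case True
  have sum_eq: "int (\<Sum>e\<in>A. weight \<delta> H e) = sum (wgt (int \<delta>) E V) A" if "A \<subseteq> E" for A
    using that weight_eq(2)[OF V3 True] by (simp add: subset_iff)
  have t: "(\<Sum>e\<in>E. weight \<delta> H e) = \<delta> * (card V - 1) \<longleftrightarrow> 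
      sum (wgt (int \<delta>) E V) E = int \<delta> * (int (card V) - 1)"
  proof -
    have "(\<Sum>e\<in>E. weight \<delta> H e) = \<delta> * (card V - 1) \<longleftrightarrow>
      int (\<Sum>e\<in>E. weight \<delta> H e) = int (\<delta> * (card V - 1))" by (simp only: of_nat_eq_iff)
    also have "int (\<delta> * (card V - 1)) = int \<delta> * (int (card V) - 1)" using V3 by (simp add: of_nat_diff)
    finally show ?thesis unfolding sum_eq[OF subset_refl] .
  qed
  have f: "(\<Sum>e\<in>induced_edges H S. weight \<delta> H e) + 1 = \<delta> * (card S - 1) \<longleftrightarrow> 
      sum (wgt (int \<delta>) E V) (induced E S) + 1 = int \<delta> * (int (card S) - 1)" if "biconn E S" for S
  proof -
    have "(\<Sum>e\<in>induced E S. weight \<delta> H e) + 1 = \<delta> * (card S - 1) \<longleftrightarrow>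
      int ((\<Sum>e\<in>induced E S. weight \<delta> H e) + 1) = int (\<delta> * (card S - 1))" by (simp only: of_nat_eq_iff)
    also have "int (\<delta> * (card S - 1)) = int \<delta> * (int (card S) - 1)"
      using that by (simp add: of_nat_diff biconn_def)
    also have "int ((\<Sum>e\<in>induced E S. weight \<delta> H e) + 1) = sum (wgt (int \<delta>) E V) (induced E S) + 1"
      using sum_eq[of "induced E S"] by (simp add: induced_def)
    finally show ?thesis by (simp add: induced_edges_eq E_def)
  qed
  have "spade \<delta> H \<longleftrightarrow> (\<Sum>e\<in>E. weight \<delta> H e) = \<delta> * (card V - 1) \<and>
     (\<forall>S. good_flat H S \<longrightarrow> (\<Sum>e\<in>induced_edges H S. weight \<delta> H e) + 1 = \<delta> * (card S - 1))"
    using sg tcH two_connected_iff[of H] weight_well_defined_iff[OF V3] True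
    by (auto simp: spade_def simple_graph_iff simple_on_def E_def V_def)
  also have "\<dots> \<longleftrightarrow> balanced (int \<delta>) V E"
    using t f good_flat_iff sg tcH V3 unfolding balanced_def E_def V_def by blast
  finally show ?thesis using True by simp
next
  case False
  then show ?thesis using weight_well_defined_iff[OF V3] by (simp add: spade_def)
qed

end

text \<open>The single edge is treated separately. Contracting it leaves one vertex and deleting it
  disconnects its ends, so it has no weight and fails \<open>spade\<close>; it is not
  \<open>balanced\<close> either.\<close>

lemma spade_iff:
  assumes "2 < \<delta>"
  shows "spade \<delta> H \<longleftrightarrow> balanced (int \<delta>) (verts H) (edges H) \<and> exclusive (verts H) (edges H)"
proof (cases "simple_on (verts H) (edges H) \<and> biconn (edges H) (verts H) \<and> 3 \<le> card (verts H)")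
  case True then show ?thesis using spade_iff_aux assms by blast
next
  case False
  have "\<not> spade \<delta> H"
  proof
    assume sp: "spade \<delta> H"
    then have sg: "simple_on (verts H) (edges H)" by (simp add: spade_def simple_graph_iff)
    then have t: "biconn (edges H) (verts H)"
      using sp two_connected_iff[of H] by (auto simp: spade_def simple_on_def)
    then have "card (verts H) = 2" using False sg by (auto simp: biconn_def)
    then obtain u v where uv: "verts H = {u, v}" "u \<noteq> v" by (auto simp: card_2_iff)
    have "\<exists>a\<in>{u}. \<exists>b\<in>{v}. {a, b} \<in> edges H"
      using connD[OF biconn_conn[OF t], of "{u}" "{v}"] uv by auto
    then have e: "verts H \<in> edges H" using uv by simp
    then obtain k where k: "is_weight \<delta> H (verts H) k"
      using sp by (auto simp: spade_def weight_well_defined_def)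
    have "\<not> two_connected (contract H {verts H})" using contraction_iff[OF assms sg t e] by simp
    moreover have "\<not> biconn (edges H - {verts H}) (verts H)"
    proof
      assume "biconn (edges H - {verts H}) (verts H)"
      then have "\<exists>a\<in>{u}. \<exists>b\<in>{v}. {a, b} \<in> edges H - {verts H}"
        using connD[OF biconn_conn, of "edges H - {verts H}" "verts H" "{u}" "{v}"] uv by auto
      then show False using uv by simp
    qed
    ultimately show False using k deletion_iff[OF assms sg t] by (simp add: is_weight_def)
  qed
  then show ?thesis using False by (auto simp: balanced_def)
qed

subsection \<open>The class of constructible graphs\<close>

lemma conn_inj_image:
  assumes f: "inj_on f V" and E: "\<And>e. e \<in> E \<Longrightarrow> e \<subseteq> V" and X: "X \<subseteq> V"
  shows "conn ((`) f ` E) (f ` X) \<longleftrightarrow> conn E X"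
proof
  assume "conn E X"
  then show "conn ((`) f ` E) (f ` X)"
  proof (rule conn_image[OF _ refl])
    fix a b assume "{a, b} \<in> E"
    then have "f ` {a, b} \<in> (`) f ` E" by (rule imageI)
    then show "f a = f b \<or> {f a, f b} \<in> (`) f ` E" by simp
  qed
next
  let ?g = "inv_into V f"
  have g: "?g (f v) = v" if "v \<in> V" for v using inv_into_f_f[OF f that] .
  assume "conn ((`) f ` E) (f ` X)"
  then show "conn E X"
  proof (rule conn_image)
    show "?g ` f ` X = X" using g X by force
    fix a b assume ab: "a \<in> f ` X" "b \<in> f ` X" "{a, b} \<in> (`) f ` E"
    then obtain e where e: "e \<in> E" "{a, b} = f ` e" by blast
    obtain a' b' where a': "a' \<in> X" "a = f a'" "b' \<in> X" "b = f b'" using ab(1,2) by blast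
    have "f ` {a', b'} = f ` e" using e(2) a' by simp
    then have "{a', b'} = e"
      using inj_on_image_eq_iff[OF f, of "{a', b'}" e] a' X E[OF e(1)] by auto
    then have "{a', b'} \<in> E" using e(1) by simp
    moreover have "?g a = a'" "?g b = b'" using a' X g[of a'] g[of b'] by auto
    ultimately show "?g a = ?g b \<or> {?g a, ?g b} \<in> E" by simp
  qed
qed

context
  fixes f :: "'a \<Rightarrow> 'b" and V :: "'a set" and E :: "'a set set"
  assumes f: "inj_on f V" and sg: "simple_on V E"
begin

lemma edge_sub: "e \<in> E \<Longrightarrow> e \<subseteq> V" using sg by (simp add: simple_on_def)

lemma conn_image_iff: "X \<subseteq> V \<Longrightarrow> conn ((`) f ` E) (f ` X) \<longleftrightarrow> conn E X"
  by (rule conn_inj_image[OF f edge_sub])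

lemma inj_edges: "inj_on ((`) f) E"
  using inj_on_image_eq_iff[OF f] edge_sub by (meson inj_onI)

lemma card_image_sub: "X \<subseteq> V \<Longrightarrow> card (f ` X) = card X"
  using card_image inj_on_subset[OF f] by blast

lemma diff_image: "X \<subseteq> V \<Longrightarrow> Y \<subseteq> V \<Longrightarrow> f ` X - f ` Y = f ` (X - Y)"
  using inj_on_image_set_diff[OF f, of X Y] by auto

lemma biconn_inj_image:
  assumes "F \<subseteq> E" "X \<subseteq> V" shows "biconn ((`) f ` F) (f ` X) \<longleftrightarrow> biconn F X"
proof -
  have c: "conn ((`) f ` F) (f ` Y) \<longleftrightarrow> conn F Y" if "Y \<subseteq> V" for Y
    using conn_inj_image[OF f _ that, of F] assms(1) edge_sub by blast
  have "f ` X - {f x} = f ` (X - {x})" if "x \<in> X" for x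
    using diff_image[of X "{x}"] that assms(2) by auto
  then have "(\<forall>y\<in>f ` X. conn ((`) f ` F) (f ` X - {y})) \<longleftrightarrow> (\<forall>x\<in>X. conn F (X - {x}))"
    using c assms(2) by (simp add: Diff_subset subset_trans[OF Diff_subset])
  then show ?thesis using c[OF assms(2)] card_image_sub[OF assms(2)] by (simp add: biconn_def)
qed

lemma simple_on_image: "simple_on (f ` V) ((`) f ` E)"
  using sg edge_sub card_image_sub by (auto simp: simple_on_def)

lemma wgt_image: "e \<in> E \<Longrightarrow> wgt d ((`) f ` E) (f ` V) (f ` e) = wgt d E V e"
  using conn_image_iff[of "V - e"] diff_image[of V e] edge_sub[of e]
  by (simp add: wgt_def)

lemma sum_wgt_image:
  assumes "A \<subseteq> E" shows "sum (wgt d ((`) f ` E) (f ` V)) ((`) f ` A) = sum (wgt d E V) A"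
proof -
  have "inj_on ((`) f) A" using inj_edges assms by (rule inj_on_subset)
  then have "sum (wgt d ((`) f ` E) (f ` V)) ((`) f ` A) = (\<Sum>e\<in>A. wgt d ((`) f ` E) (f ` V) (f ` e))"
    by (simp add: sum.reindex)
  also have "\<dots> = sum (wgt d E V) A" using assms by (intro sum.cong refl wgt_image) auto
  finally show ?thesis .
qed

lemma balanced_image:
  assumes "balanced d V E" shows "balanced d (f ` V) ((`) f ` E)"
  unfolding balanced_def
proof (intro conjI allI impI)
  show "simple_on (f ` V) ((`) f ` E)" by (rule simple_on_image)
  show "biconn ((`) f ` E) (f ` V)" using biconn_inj_image[of E V] assms by (simp add: balanced_def)
  show "3 \<le> card (f ` V)" using card_image_sub[of V] assms by (simp add: balanced_def)
  show "sum (wgt d ((`) f ` E) (f ` V)) ((`) f ` E) = d * (int (card (f ` V)) - 1)"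
    using sum_wgt_image[of E] card_image_sub[of V] assms by (simp add: balanced_def)
  fix S' assume S': "S' \<subset> f ` V" "biconn ((`) f ` E) S'" "conn ((`) f ` E) (f ` V - S')"
  obtain S where S: "S \<subseteq> V" "S' = f ` S" using S'(1) by (metis psubset_imp_subset subset_imageE)
  have "S \<subset> V" using S S'(1) by auto
  moreover have "biconn E S" using biconn_inj_image[OF subset_refl S(1)] S'(2) S(2) by simp
  moreover have "conn E (V - S)"
    using conn_image_iff[of "V - S"] diff_image[of V S] S'(3) S by simp
  ultimately have "sum (wgt d E V) (induced E S) + 1 = d * (int (card S) - 1)"
    using assms unfolding balanced_def by blast
  moreover have "induced ((`) f ` E) S' = (`) f ` induced E S"
  proof (intro equalityI subsetI)
    fix e' assume "e' \<in> induced ((`) f ` E) S'"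
    then obtain e where e: "e \<in> E" "e' = f ` e" "f ` e \<subseteq> f ` S" using S(2) by (auto simp: induced_def)
    have "e \<subseteq> S"
    proof
      fix v assume "v \<in> e"
      then show "v \<in> S" using inj_on_image_mem_iff[OF f _ S(1), of v] edge_sub[OF e(1)] e(3) by auto
    qed
    then show "e' \<in> (`) f ` induced E S" using e by (auto simp: induced_def)
  qed (auto simp: induced_def S(2))
  moreover have "induced E S \<subseteq> E" by (auto simp: induced_def)
  ultimately show "sum (wgt d ((`) f ` E) (f ` V)) (induced ((`) f ` E) S') + 1 = d * (int (card S') - 1)"
    using sum_wgt_image[of "induced E S"] card_image_sub[OF S(1)] S(2) by simp
qed

lemma exclusive_image:
  assumes "exclusive V E" shows "exclusive (f ` V) ((`) f ` E)"
  unfolding exclusive_def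
proof (intro ballI impI)
  fix e' assume e': "e' \<in> (`) f ` E" "conn ((`) f ` E) (f ` V - e')"
  then obtain e where e: "e \<in> E" "e' = f ` e" by blast
  have "conn E (V - e)"
    using conn_image_iff[of "V - e"] diff_image[of V e] edge_sub[OF e(1)] e'(2) e(2) by simp
  then have "\<not> biconn (E - {e}) V" using assms e(1) by (simp add: exclusive_def)
  moreover have "(`) f ` E - {e'} = (`) f ` (E - {e})"
    using inj_on_image_set_diff[OF inj_edges, of E "{e}"] e by auto
  ultimately show "\<not> biconn ((`) f ` E - {e'}) (f ` V)" using biconn_inj_image[of "E - {e}" V] by auto
qed

end

section \<open>Constructible graphs satisfy the conditions\<close>

lemma spade_weight:
  assumes "2 < \<delta>" "spade \<delta> G" "e \<in> edges G"
  shows "weight \<delta> G e = (if conn (edges G) (verts G - e) then \<delta> - 1 else 1)"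
proof -
  have "balanced (int \<delta>) (verts G) (edges G)" "exclusive (verts G) (edges G)"
    using assms(2) spade_iff[OF assms(1)] by auto
  then show ?thesis using assms(3) unfolding balanced_def by (intro weight_eq(1)[OF assms(1)]) simp_all
qed

lemma is_cycle_spade:
  assumes "2 < \<delta>" "is_cycle \<delta> H"
  shows "spade \<delta> H"
proof -
  obtain p where p: "distinct p" "length p = \<delta>" "verts H = set p"
    "edges H = {{p ! i, p ! (Suc i mod \<delta>)} | i. i < \<delta>}" using assms(2) unfolding is_cycle_def by blast
  have "p \<noteq> []" using p(2) assms(1) by auto
  then have "edges H = insert {last p, hd p} (path_edges p)" using cycle_edges[of p] p(2,4) by simp
  then show ?thesis using cycle_bal[of p "int \<delta>"] p(1-3) assms(1) by (simp add: spade_iff)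
qed

lemma gluing_spade:
  fixes G :: "nat \<Rightarrow> 'a graph"
  assumes \<delta>: "2 < \<delta>" and sp: "\<And>i. i < \<delta> - 1 \<Longrightarrow> spade \<delta> (G i)"
    and e: "\<And>i. i < \<delta> - 1 \<Longrightarrow> e i \<in> edges (G i) \<and> weight \<delta> (G i) (e i) = \<delta> - 1"
    and gl: "is_gluing {..<\<delta> - 1} G e H"
  shows "spade \<delta> H"
proof -
  let ?I = "{..<\<delta> - 1}"
  obtain f c where 1: "\<forall>i\<in>?I. inj_on (f i) (verts (G i)) \<and> f i ` e i = c"
    and 2: "\<forall>i\<in>?I. \<forall>j\<in>?I. i \<noteq> j \<longrightarrow> f i ` verts (G i) \<inter> f j ` verts (G j) = c"
    and V: "verts H = (\<Union>i\<in>?I. f i ` verts (G i))"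
    and E: "edges H = (\<Union>i\<in>?I. (`) (f i) ` edges (G i))"
    using gl unfolding is_gluing_def by (elim exE conjE)
  have f: "inj_on (f i) (verts (G i))" "f i ` e i = c" if "i \<in> ?I" for i
    using 1 that by simp_all
  have int: "f i ` verts (G i) \<inter> f j ` verts (G j) = c" if "i \<in> ?I" "j \<in> ?I" "i \<noteq> j" for i j
    using 2 that by simp
  have bn: "balanced (int \<delta>) (verts (G i)) (edges (G i))" "exclusive (verts (G i)) (edges (G i))" if "i \<in> ?I" for i
    using sp[of i] that spade_iff[OF \<delta>] by auto
  have sg: "simple_on (verts (G i)) (edges (G i))" if "i \<in> ?I" for i using bn(1)[OF that] by (simp add: balanced_def)
  have 0: "0 \<in> ?I" using \<delta> by simp
  have eE: "e i \<in> edges (G i)" if "i \<in> ?I" for i using e that by simp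
  have "c \<in> (`) (f 0) ` edges (G 0)" using f(2)[OF 0] eE[OF 0] by blast
  from simple_on_edge[OF simple_on_image[OF f(1)[OF 0] sg[OF 0]] this]
  obtain x y where xy: "c = {x, y}" "x \<noteq> y" by metis
  have c1: "{x, y} \<in> (`) (f i) ` edges (G i)" if "i \<in> ?I" for i
    using f(2)[OF that] eE[OF that] xy(1) by blast
  have c2: "conn ((`) (f i) ` edges (G i)) (f i ` verts (G i) - {x, y})" if i: "i \<in> ?I" for i
  proof -
    have "weight \<delta> (G i) (e i) \<noteq> 1" using e i \<delta> by simp
    then have "conn (edges (G i)) (verts (G i) - e i)"
      using spade_weight[OF \<delta> sp, of i "e i"] i eE by (auto split: if_splits)
    moreover have "e i \<subseteq> verts (G i)" using sg[OF i] eE[OF i] by (simp add: simple_on_def)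
    ultimately show ?thesis
      using conn_image_iff[OF f(1)[OF i] sg[OF i], of "verts (G i) - e i"]
        diff_image[OF f(1)[OF i] sg[OF i], of "verts (G i)" "e i"] f(2)[OF i] xy(1) by simp
  qed
  have card_I: "int (card ?I) = int \<delta> - 1" "3 \<le> int \<delta>" using \<delta> by simp_all
  have int': "f i ` verts (G i) \<inter> f j ` verts (G j) = {x, y}" if "i \<in> ?I" "j \<in> ?I" "i \<noteq> j" for i j
    using int[OF that] xy(1) by simp
  have bi: "balanced (int \<delta>) (f i ` verts (G i)) ((`) (f i) ` edges (G i))" if "i \<in> ?I" for i
    using balanced_image[OF f(1)[OF that] sg[OF that] bn(1)[OF that]] .
  have ni: "exclusive (f i ` verts (G i)) ((`) (f i) ` edges (G i))" if "i \<in> ?I" for i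
    using exclusive_image[OF f(1)[OF that] sg[OF that] bn(2)[OF that]] .
  show ?thesis unfolding spade_iff[OF \<delta>] V E
  proof
    show "balanced (int \<delta>) (\<Union>i\<in>?I. f i ` verts (G i)) (\<Union>i\<in>?I. (`) (f i) ` edges (G i))"
      by (rule balanced_glue(1)[OF card_I(2) finite_lessThan card_I(1) xy(2)]) (fact bi c1 c2 int')+
    show "exclusive (\<Union>i\<in>?I. f i ` verts (G i)) (\<Union>i\<in>?I. (`) (f i) ` edges (G i))"
      by (rule balanced_glue(2)[OF card_I(2) finite_lessThan card_I(1) xy(2)]) (fact bi c1 c2 int' ni)+
  qed
qed

lemma subdivision_spade:
  assumes \<delta>: "2 < \<delta>" and sp: "spade \<delta> G" and e: "e \<in> edges G" "weight \<delta> G e = 1"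
    and sub: "is_subdivision (\<delta> - 1) G e H"
  shows "spade \<delta> H"
proof -
  obtain u v xs where s: "e = {u, v}" "distinct xs" "length xs = \<delta> - 1 - 1" "set xs \<inter> verts G = {}"
    "verts H = verts G \<union> set xs" "edges H = (edges G - {e}) \<union> path_edges (u # xs @ [v])"
    using sub unfolding is_subdivision_def by (elim exE conjE)
  have b: "balanced (int \<delta>) (verts G) (edges G)" "exclusive (verts G) (edges G)" using sp spade_iff[OF \<delta>] by auto
  have sg: "simple_on (verts G) (edges G)" and tcG: "biconn (edges G) (verts G)" using b(1) by (auto simp: balanced_def)
  have uv: "u \<noteq> v" "u \<in> verts G" "v \<in> verts G" using simple_on_neq[OF sg, of u v] e(1) s(1) by auto
  have nc: "\<not> conn (edges G) (verts G - {u, v})"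
  proof
    assume "conn (edges G) (verts G - {u, v})"
    then have "weight \<delta> G e = \<delta> - 1" using spade_weight[OF \<delta> sp e(1)] unfolding s(1) by simp
    then show False using e(2) \<delta> by simp
  qed
  have nc': "\<not> conn (edges G - {e}) (verts G - {u, v})"
    using nc conn_mono[of "edges G - {e}" "verts G - {u, v}" "edges G"] by blast
  have tc0: "biconn (edges G - {e}) (verts G)" using biconn_del[OF tcG uv(2,3,1) nc] s(1) by simp
  have sg0: "simple_on (verts G) (edges G - {e})" using sg by (simp add: simple_on_def)
  have sd: "subdiv (int \<delta>) (verts G) (edges G - {e}) u v xs"
    using uv s(1-4) sg0 tc0 nc' \<delta> by unfold_locales auto
  have "insert {u, v} (edges G - {e}) = edges G" using e(1) s(1) by auto
  then show ?thesis unfolding spade_iff[OF \<delta>] s(5,6)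
    using subdiv.balanced_subdivide[OF sd] subdiv.exclusive_subdivide[OF sd] b by simp
qed

text \<open>This is also what the converse relies on: a balanced graph known to be constructible is
  exclusive, so exclusiveness of smaller graphs is recovered from balance alone.\<close>

lemma class_F_spade:
  assumes "class_F \<delta> H" "2 < \<delta>"
  shows "spade \<delta> H"
  using assms
proof (induction rule: class_F.induct)
  case (cycle H) then show ?case by (intro is_cycle_spade)
next
  case (gluing G e H)
  show ?case by (rule gluing_spade[OF gluing.prems gluing.hyps(2,3,4)])
next
  case (subdivision G e H)
  show ?case by (rule subdivision_spade[OF subdivision.prems subdivision.hyps(2-5)])
qed

section \<open>Balanced graphs are constructible\<close>

lemma separating_edge_class_F:
  fixes V :: "'a set"
  assumes \<delta>: "2 < \<delta>" and balanced: "balanced (int \<delta>) V E" and c: "{x, y} \<in> E" "\<not> conn E (V - {x, y})"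
    and IH: "\<And>(V' :: 'a set) E'. card V' < card V \<Longrightarrow> balanced (int \<delta>) V' E' \<Longrightarrow> class_F \<delta> \<lparr>verts = V', edges = E'\<rparr>"
  shows "class_F \<delta> \<lparr>verts = V, edges = E\<rparr>"
proof -
  let ?c = "{x, y}"
  have sg: "simple_on V E" and tcV: "biconn E V" using balanced by (auto simp: balanced_def)
  have fin: "finite V" using sg by (simp add: simple_on_def)
  have xy: "x \<in> V" "y \<in> V" "x \<noteq> y" using simple_on_neq[OF sg c(1)] by auto
  \<comment> \<open>The components behind the separating edge. Each of them, with \<open>x\<close>
    and \<open>y\<close> added, inherits the balance and becomes one of the graphs to be
    glued.\<close>
  define \<C> where "\<C> = {C. C \<noteq> {} \<and> conn E C \<and> closed_in E (V - ?c) C}"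
  have C: "C \<noteq> {}" "conn E C" "closed_in E (V - ?c) C" "C \<subseteq> V - ?c" "C \<noteq> V - ?c" if "C \<in> \<C>" for C
    using that c(2) by (auto simp: \<C>_def closed_in_def)
  have fin\<C>: "finite \<C>"
    using finite_subset[of \<C> "Pow V"] fin C(4) by blast
  have cover: "V - ?c = \<Union>\<C>"
  proof (intro equalityI subsetI)
    fix a assume "a \<in> V - ?c"
    then obtain C where "a \<in> C" "conn E C" "closed_in E (V - ?c) C"
      using conn_component[of "V - ?c" a E] fin by blast
    then show "a \<in> \<Union>\<C>" by (auto simp: \<C>_def)
  qed (use C(4) in blast)
  have disj: "C \<inter> C' = {}" if CC: "C \<in> \<C>" "C' \<in> \<C>" "C \<noteq> C'" for C C'
  proof (rule ccontr)
    assume ne: "C \<inter> C' \<noteq> {}"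
    have *: "A \<subseteq> B" if "A \<in> \<C>" "B \<in> \<C>" "A \<inter> B \<noteq> {}" for A B
    proof -
      have "closed_in E A (A \<inter> B)"
        using C(3)[OF that(2)] C(4)[OF that(1)] unfolding closed_in_def by blast
      then show ?thesis using conn_closed[OF C(2)[OF that(1)]] that(3) by blast
    qed
    have "C = C'" using *[OF CC(1,2) ne] *[OF CC(2,1)] ne by blast
    then show False using CC(3) by simp
  qed
  define F where "F D = D \<union> ?c" for D
  have F: "balanced (int \<delta>) (F D) (induced E (F D))" if "D \<in> \<C>" for D
  proof -
    have "insert ?c (induced E (F D)) = induced E (F D)" using c(1) by (auto simp: induced_def F_def)
    then show ?thesis
      using balanced_split[OF balanced xy C(3)[OF that] C(1)[OF that] C(2)[OF that] C(5)[OF that]] c(1)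
      by (simp add: F_def)
  qed
  have cF: "class_F \<delta> \<lparr>verts = F D, edges = induced E (F D)\<rparr>" if "D \<in> \<C>" for D
  proof (rule IH[OF _ F[OF that]])
    have "F D \<subset> V" using C(4,5)[OF that] xy by (auto simp: F_def)
    then show "card (F D) < card V" using fin by (intro psubset_card_mono)
  qed
  \<comment> \<open>Each component \<open>D\<close> accounts for weight
    \<open>\<delta> |D| + 1\<close> and the separating edge for 1. Comparison with the total
    \<open>\<delta> (|V| - 1)\<close> leaves \<open>\<delta> - 1\<close> components.\<close>
  have card_\<C>: "card \<C> = \<delta> - 1"
  proof -
    have D_sum: "sum (wgt (int \<delta>) E V) (meeting E D) = int \<delta> * int (card D) + 1" if "D \<in> \<C>" for D
      using C[OF that] biconn_side[OF sg tcV xy C(3)[OF that] C(5)[OF that]] c(1)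
      by (intro balanced_dual[OF balanced]) auto
    have "E - {?c} = (\<Union>D\<in>\<C>. meeting E D)"
    proof (intro equalityI subsetI)
      fix e assume e: "e \<in> E - {?c}"
      then have "\<not> e \<subseteq> ?c" using induced_single[OF sg c(1)] by (auto simp: induced_def)
      then obtain a where "a \<in> e" "a \<in> V - ?c" using sg e by (auto simp: simple_on_def)
      then show "e \<in> (\<Union>D\<in>\<C>. meeting E D)" using cover e by (auto simp: meeting_def)
    next
      fix e assume "e \<in> (\<Union>D\<in>\<C>. meeting E D)"
      then show "e \<in> E - {?c}" using C(4) by (auto simp: meeting_def)
    qed
    moreover have "sum (wgt (int \<delta>) E V) (\<Union>D\<in>\<C>. meeting E D) = (\<Sum>D\<in>\<C>. sum (wgt (int \<delta>) E V) (meeting E D))"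
    proof (rule sum.UNION_disjoint[OF fin\<C>])
      show "\<forall>D\<in>\<C>. finite (meeting E D)" using simple_on_finite[OF sg] by (simp add: meeting_def)
      show "\<forall>D\<in>\<C>. \<forall>D'\<in>\<C>. D \<noteq> D' \<longrightarrow> meeting E D \<inter> meeting E D' = {}"
      proof (intro ballI impI equals0I)
        fix D D' e assume DD: "D \<in> \<C>" "D' \<in> \<C>" "D \<noteq> D'" and e: "e \<in> meeting E D \<inter> meeting E D'"
        then obtain k where k: "e \<in> E" "k \<in> e" "k \<in> D" by (auto simp: meeting_def)
        obtain k' where k': "k' \<in> e" "k' \<in> D'" using e by (auto simp: meeting_def)
        have "k' \<notin> D" using disj[OF DD] k'(2) by blast
        moreover obtain n where n: "e = {k, n}" using meeting_edge[OF sg k(1,2)] by blast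
        ultimately have "k' = n" using k'(1) k(3) by auto
        then have "n \<in> D" using closed_inD[OF C(3)[OF DD(1)] k(3), of n] k(1) n C(4)[OF DD(2)] k'(2) by blast
        then show False using \<open>k' = n\<close> \<open>k' \<notin> D\<close> by simp
      qed
    qed
    moreover have "sum (wgt (int \<delta>) E V) E = wgt (int \<delta>) E V ?c + sum (wgt (int \<delta>) E V) (E - {?c})"
      using sum.remove[OF simple_on_finite[OF sg] c(1)] by simp
    moreover have "(\<Sum>D\<in>\<C>. sum (wgt (int \<delta>) E V) (meeting E D)) = (\<Sum>D\<in>\<C>. int \<delta> * int (card D) + 1)"
      by (intro sum.cong refl D_sum)
    ultimately have s: "sum (wgt (int \<delta>) E V) E = 1 + (int \<delta> * (\<Sum>D\<in>\<C>. int (card D)) + int (card \<C>))"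
      using c(2) by (simp add: wgt_def sum.distrib sum_distrib_left)
    have "card (\<Union>\<C>) = (\<Sum>D\<in>\<C>. card D)"
    proof (rule card_Union_disjoint)
      show "pairwise disjnt \<C>" using disj by (simp add: pairwise_def disjnt_def)
      show "finite D" if "D \<in> \<C>" for D
        using C(4)[OF that] fin by (meson finite_Diff finite_subset)
    qed
    moreover have "card (V - ?c) = card V - 2" using xy by (simp add: card_Diff_subset)
    moreover have "3 \<le> card V" using balanced by (simp add: balanced_def)
    ultimately have "(\<Sum>D\<in>\<C>. int (card D)) = int (card V) - 2" using cover by (simp flip: of_nat_sum)
    then have "sum (wgt (int \<delta>) E V) E = 1 + int \<delta> * (int (card V) - 2) + int (card \<C>)" using s by simp
    then have "int (card \<C>) = int \<delta> - 1" using balanced by (simp add: balanced_def algebra_simps)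
    then show ?thesis by simp
  qed
  obtain g where g: "bij_betw g {..<\<delta> - 1} \<C>"
    using ex_bij_betw_nat_finite[OF fin\<C>] card_\<C> by (metis atLeast0LessThan)
  have g\<C>: "g i \<in> \<C>" if "i < \<delta> - 1" for i using g that by (auto simp: bij_betw_def)
  define G where "G i = \<lparr>verts = F (g i), edges = induced E (F (g i))\<rparr>" for i
  show ?thesis
  proof (rule class_F.gluing[of \<delta> G "\<lambda>_. ?c"])
    fix i assume i: "i < \<delta> - 1"
    show cl: "class_F \<delta> (G i)" using cF[OF g\<C>[OF i]] by (simp add: G_def)
    show sp: "spade \<delta> (G i)" using class_F_spade[OF cl \<delta>] .
    have cG: "?c \<in> edges (G i)" using c(1) by (simp add: G_def induced_def F_def)
    have "verts (G i) - ?c = g i" using C(4)[OF g\<C>[OF i]] by (auto simp: G_def F_def)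
    moreover have "conn (edges (G i)) (g i)"
      by (rule conn_cong[OF C(2)[OF g\<C>[OF i]]]) (auto simp: G_def induced_def F_def)
    ultimately show "?c \<in> edges (G i) \<and> weight \<delta> (G i) ?c = \<delta> - 1"
      using cG spade_weight[OF \<delta> sp cG] by simp
  next
    have img: "g ` {..<\<delta> - 1} = \<C>" "inj_on g {..<\<delta> - 1}" using g by (auto simp: bij_betw_def)
    show "is_gluing {..<\<delta> - 1} G (\<lambda>_. ?c) \<lparr>verts = V, edges = E\<rparr>"
      unfolding is_gluing_def
    proof (intro exI[of _ "\<lambda>_ x. x"] exI[of _ ?c] conjI ballI impI)
      fix i j assume ij: "i \<in> {..<\<delta> - 1}" "j \<in> {..<\<delta> - 1}" "i \<noteq> j"
      then have "g i \<inter> g j = {}" using disj g\<C> img(2) by (metis inj_on_eq_iff lessThan_iff)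
      then show "(\<lambda>x. x) ` verts (G i) \<inter> (\<lambda>x. x) ` verts (G j) = ?c" by (auto simp: G_def F_def)
    next
      have "V = (\<Union>D\<in>\<C>. F D)"
      proof -
        have "\<C> \<noteq> {}" using card_\<C> \<delta> by auto
        then show ?thesis using cover xy C(4) unfolding F_def by blast
      qed
      also have "\<dots> = (\<Union>i\<in>{..<\<delta> - 1}. F (g i))" using img(1) by blast
      finally show "verts \<lparr>verts = V, edges = E\<rparr> = (\<Union>i\<in>{..<\<delta> - 1}. (\<lambda>x. x) ` verts (G i))"
        by (simp add: G_def)
      have "E = (\<Union>D\<in>\<C>. induced E (F D))"
      proof (intro equalityI subsetI)
        fix e assume e: "e \<in> E"
        obtain a b where ab: "e = {a, b}" "a \<in> V" "b \<in> V" using simple_on_edge[OF sg e] by metis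
        show "e \<in> (\<Union>D\<in>\<C>. induced E (F D))"
        proof (cases "e \<subseteq> ?c")
          case True
          have "\<C> \<noteq> {}" using card_\<C> \<delta> by auto
          then show ?thesis using True e by (auto simp: induced_def F_def)
        next
          case False
          then obtain k where k: "k \<in> e" "k \<in> V - ?c" using ab by auto
          then obtain D where D: "D \<in> \<C>" "k \<in> D" using cover by blast
          obtain n where n: "e = {k, n}" using meeting_edge[OF sg e k(1)] by blast
          have "n \<in> D \<or> n = x \<or> n = y" using closed_in_nbr[OF sg C(3)[OF D(1)] D(2), of n] e n by simp
          then have "e \<in> induced E (F D)" using n D(2) e by (auto simp: induced_def F_def)
          then show ?thesis using D(1) by blast
        qed
      qed (auto simp: induced_def)
      also have "\<dots> = (\<Union>i\<in>{..<\<delta> - 1}. induced E (F (g i)))" using img(1) by blast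
      finally show "edges \<lparr>verts = V, edges = E\<rparr> = (\<Union>i\<in>{..<\<delta> - 1}. (`) (\<lambda>x. x) ` edges (G i))"
        by (simp add: G_def)
    qed simp_all
  qed
qed

lemma balanced_class_F:
  fixes V :: "'a set"
  assumes \<delta>: "2 < \<delta>" and "balanced (int \<delta>) V E"
  shows "class_F \<delta> \<lparr>verts = V, edges = E\<rparr>"
  using assms(2)
proof (induction "card V" arbitrary: V E rule: less_induct)
  case less
  have balanced: "balanced (int \<delta>) V E" by (rule less.prems)
  have IH: "class_F \<delta> \<lparr>verts = V', edges = E'\<rparr>" if "card V' < card V" "balanced (int \<delta>) V' E'"
    for V' :: "'a set" and E'
    using less.hyps[OF that] .
  have sg: "simple_on V E" using balanced by (auto simp: balanced_def)
  show ?case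
  proof (cases "\<forall>e\<in>E. conn E (V - e)")
    case False
    then obtain e where e: "e \<in> E" "\<not> conn E (V - e)" by blast
    obtain x y where "e = {x, y}" using simple_on_edge[OF sg e(1)] by blast
    then show ?thesis using separating_edge_class_F[OF \<delta> balanced _ _ IH, of x y] e by simp
  next
    case True
    interpret crit "int \<delta>" V E
      using \<delta> balanced True by unfold_locales auto
    have ih: "conn E (V - {x, y} - D)"
      if xy: "x \<in> V" "y \<in> V" "x \<noteq> y" and D: "D \<noteq> {}" "conn E D" "closed_in E (V - {x, y}) D"
        "D \<noteq> V - {x, y}" "biconn E (D \<union> {x, y})" for x y D
    proof (rule ccontr)
      assume nc: "\<not> conn E (V - {x, y} - D)"
      define F where "F = D \<union> {x, y}"
      define EF where "EF = insert {x, y} (induced E F)"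
      have DV: "D \<subseteq> V - {x, y}" using D(3) by (simp add: closed_in_def)
      have balF: "balanced (int \<delta>) F EF"
        using balanced_split[OF balanced xy D(3,1,2,4)] nc by (simp add: F_def EF_def)
      have "F \<subset> V" using DV D(4) xy by (auto simp: F_def)
      then have "card F < card V" using basics(4) by (intro psubset_card_mono)
      \<comment> \<open>The induction hypothesis makes the piece constructible, and the direction
        already proved turns this into exclusiveness, which \<open>balanced_split\<close> does not
        provide.\<close>
      then have "spade \<delta> \<lparr>verts = F, edges = EF\<rparr>" using class_F_spade[OF IH[OF _ balF] \<delta>] by simp
      then have nd: "exclusive F EF" unfolding spade_iff[OF \<delta>] by simp
      have "F - {x, y} = D" using DV by (auto simp: F_def)
      moreover have "conn EF D" by (rule conn_cong[OF D(2)]) (auto simp: EF_def induced_def F_def)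
      ultimately have ntc: "\<not> biconn (EF - {{x, y}}) F" using nd by (simp add: exclusive_def EF_def)
      have xyE: "{x, y} \<notin> E" using conn_closed[OF contr D(3,1)] D(4) by blast
      have "biconn (EF - {{x, y}}) F"
      proof (rule biconn_cong[OF D(5)[folded F_def]])
        fix a b assume ab: "a \<in> F" "b \<in> F" "{a, b} \<in> E"
        then have "{a, b} \<noteq> {x, y}" using xyE by metis
        then show "{a, b} \<in> EF - {{x, y}}" using ab by (simp add: EF_def induced_def)
      qed
      then show False using ntc by simp
    qed
    show ?thesis
    proof (cases "\<exists>z. hub z")
      case True
      then obtain z where z: "hub z" by blast
      have "\<exists>x y K. x \<in> V \<and> y \<in> V \<and> x \<noteq> y \<and> K \<noteq> {} \<and> conn E K \<and>
        closed_in E (V - {x, y}) K \<and> (\<forall>k\<in>K. \<not> hub k) \<and> \<not> conn E (V - {x, y} - K)"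
      proof (rule good_side[OF _ z])
        show "conn E (V - {x, y} - D)"
          if "x \<in> V" "y \<in> V" "x \<noteq> y" "D \<noteq> {}" "conn E D" "closed_in E (V - {x, y}) D"
            "D \<noteq> V - {x, y}" "biconn E (D \<union> {x, y})" for x y D
          using that by (rule ih)
        fix x y K
        assume "x \<in> V" "y \<in> V" "x \<noteq> y" "K \<noteq> {}" "conn E K" "closed_in E (V - {x, y}) K"
          and hf: "\<And>k. k \<in> K \<Longrightarrow> \<not> hub k" and "\<not> conn E (V - {x, y} - K)"
        moreover have "\<forall>k\<in>K. \<not> hub k" using hf by (rule ballI)
        ultimately show ?thesis by (intro exI conjI)
      qed
      then obtain x y K where K: "x \<in> V" "y \<in> V" "x \<noteq> y" "K \<noteq> {}" "conn E K"
        "closed_in E (V - {x, y}) K" "\<forall>k\<in>K. \<not> hub k" "\<not> conn E (V - {x, y} - K)"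
        by (elim exE conjE)
      have "\<exists>u v xs. subdiv (int \<delta>) (V - K) (induced E (V - K)) u v xs \<and> set xs = K \<and>
        E = induced E (V - K) \<union> path_edges (u # xs @ [v])"
      proof (rule unsubdivide[OF K(1-6) _ K(8)])
        show "\<not> hub k" if "k \<in> K" for k using K(7) that by blast
        fix u v xs
        assume "subdiv (int \<delta>) (V - K) (induced E (V - K)) u v xs" "set xs = K"
          "E = induced E (V - K) \<union> path_edges (u # xs @ [v])"
        then show ?thesis by (intro exI conjI)
      qed
      then obtain u v xs where s: "subdiv (int \<delta>) (V - K) (induced E (V - K)) u v xs" "set xs = K"
        "E = induced E (V - K) \<union> path_edges (u # xs @ [v])"
        by (elim exE conjE)
      define E' where "E' = insert {u, v} (induced E (V - K))"
      define G where "G = \<lparr>verts = V - K, edges = E'\<rparr>"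
      have KV: "K \<subseteq> V" using K(6) by (auto simp: closed_in_def)
      then have VK: "V - K \<union> K = V" by auto
      have balG: "balanced (int \<delta>) (V - K) E'"
        using subdiv.balanced_unsubdivide[OF s(1)] balanced s(2,3) VK unfolding E'_def by metis
      have "V - K \<subset> V" using KV K(4) by auto
      then have "card (V - K) < card V" using basics(4) by (intro psubset_card_mono)
      then have cG: "class_F \<delta> G" unfolding G_def by (rule IH[OF _ balG])
      have spG: "spade \<delta> G" using class_F_spade[OF cG \<delta>] .
      have eG: "{u, v} \<in> edges G" by (simp add: G_def E'_def)
      have "\<not> conn (edges G) (verts G - {u, v})"
        using subdiv.wgt_c[OF s(1)] \<delta> by (auto simp: G_def E'_def wgt_def split: if_splits)
      then have wG: "weight \<delta> G {u, v} = 1" using spade_weight[OF \<delta> spG eG] by simp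
      have "is_subdivision (\<delta> - 1) G {u, v} \<lparr>verts = V, edges = E\<rparr>"
        unfolding is_subdivision_def
      proof (rule exI[of _ u], rule exI[of _ v], rule exI[of _ xs], intro conjI)
        show "length xs = \<delta> - 1 - 1" using subdiv.xs(3)[OF s(1)] by linarith
        show "set xs \<inter> verts G = {}" using s(2) by (auto simp: G_def)
        show "verts \<lparr>verts = V, edges = E\<rparr> = verts G \<union> set xs" using s(2) VK by (simp add: G_def)
        have "edges G - {{u, v}} = induced E (V - K)" using subdiv.uv(4)[OF s(1)] by (simp add: G_def E'_def)
        then show "edges \<lparr>verts = V, edges = E\<rparr> = edges G - {{u, v}} \<union> path_edges (u # xs @ [v])"
          using s(3) by simp
      qed (use subdiv.xs(1)[OF s(1)] in simp_all)
      then show ?thesis by (rule class_F.subdivision[OF cG spG eG wG])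
    next
      case False
      then obtain p where p: "distinct p" "int (length p) = int \<delta>" "set p = V" "p \<noteq> []"
        "E = insert {last p, hd p} (path_edges p)" using hubfree_cycle by metis
      have l: "length p = \<delta>" using p(2) by simp
      have "is_cycle \<delta> \<lparr>verts = V, edges = E\<rparr>" unfolding is_cycle_def
        using p(1,3,5) l cycle_edges[OF p(4)] by (intro exI[of _ p]) simp
      then show ?thesis by (rule class_F.cycle)
    qed
  qed
qed

theorem theorem4p3:
  fixes G :: "'a graph" and \<delta> :: nat
  assumes "simple_graph G" and "two_connected G" and "2 < \<delta>"
  shows "spade \<delta> G \<longleftrightarrow> class_F \<delta> G"
proof
  assume "spade \<delta> G"
  then have "class_F \<delta> \<lparr>verts = verts G, edges = edges G\<rparr>"
    using balanced_class_F spade_iff assms(3) by blast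
  then show "class_F \<delta> G" by (cases G) simp
next
  assume "class_F \<delta> G"
  then show "spade \<delta> G" using class_F_spade assms(3) by blast
qed

end
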